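(* Let $G=(V,E,w)$ be a connected weighted hypergraph with $V=\{1,\dots,N\}$, let $p\in[1,\infty)$, $a>0$, $q>2$, $T>0$, and let $\pi:\mathbb{R}^N\to\mathbb{R}^N$ be Lipschitz continuous with a primitive $k:\mathbb{R}^N\to\mathbb{R}$ (i.e. $\nabla k=\pi$). For every $u_0\in\mathbb{R}^N$ and $f\in W^{1,1}(0,T;\mathbb{R}^N)$, the system $$\begin{cases} u'(t)+\mathcal{L}_{G,p}(\mu(t))\ni 0, & t\in(0,T),\\ \mu(t)\in \mathcal{L}_{G,p}(u(t))+a\|u(t)\|^{q-2}u(t)+\pi(u(t))-f(t), & t\in(0,T),\\ u(0)=u_0,\end{cases}$$ possesses at least one solution $(u,\mu)$ satisfying $u\in W^{1,\infty}(0,T;\mathbb{R}^N)$ and $\mu\in L^\infty(0,T;\mathbb{R}^N)$.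
   Context: A weighted hypergraph $G=(V,E,w)$ consists of a finite vertex set $V=\{1,\dots,N\}$, a family $E$ of subsets $e\subset V$ with $\#e\ge 2$ (hyperedges), and a weight $w:E\to(0,\infty)$. $G$ is connected if for all $i,j\in V$ there exist $i_1,\dots,i_{n-1}\in V$ and $e_1,\dots,e_n\in E$ such that, with $i_0=i$ and $i_n=j$, one has $i_{l-1},i_l\in e_l$ for every $l=1,\dots,n$. For $e\in E$ and $x\in\mathbb{R}^N$ put $f_e(x):=\max_{i,j\in e}|x_i-x_j|$, and for $p\in[1,\infty)$ put $\varphi_{G,p}(x):=\frac1p\sum_{e\in E}w(e)(f_e(x))^p$, a continuous convex function on $\mathbb{R}^N$. The hypergraph Laplacian is the set-valued operator $\mathcal{L}_{G,p}:=\partial\varphi_{G,p}:\mathbb{R}^N\to 2^{\mathbb{R}^N}$, where $\partial\varphi_{G,p}(x)=\{\eta\in\mathbb{R}^N:\ \eta\cdot(z-x)\le\varphi_{G,p}(z)-\varphi_{G,p}(x)\ \ \forall z\in\mathbb{R}^N\}$. $\|\cdot\|$ and $\cdot$ denote the Euclidean norm and inner product on $\mathbb{R}^N$; $\|x\|^{q-2}x$ is $0$ at $x=0$. A solution on $[0,T]$ is a pair $u,\mu:[0,T]\to\mathbb{R}^N$ with $u\in W^{1,1}(0,T;\mathbb{R}^N)$ (identified with its absolutely continuous representative) and $\mu\in L^1(0,T;\mathbb{R}^N)$ such that the two inclusions hold for a.e. $t\in(0,T)$ and $u(0)=u_0$. *)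

theory Defs
  imports "HOL-Analysis.Analysis"
begin

text \<open>The vertices are the elements of a finite type \<open>'n\<close> (so N is \<open>CARD('n)\<close>, and N is at
  least 1), and \<open>\<real>\<^sup>N\<close> is \<open>real ^ 'n\<close>.\<close>

definition weighted_hypergraph :: "'n::finite set set \<Rightarrow> ('n set \<Rightarrow> real) \<Rightarrow> bool" where
  "weighted_hypergraph E w \<longleftrightarrow> (\<forall>e\<in>E. card e \<ge> 2) \<and> (\<forall>e\<in>E. w e > 0)"

definition hypergraph_connected :: "'n::finite set set \<Rightarrow> bool" where
  "hypergraph_connected E \<longleftrightarrow>
    (\<forall>i j. \<exists>n\<ge>1. \<exists>(v :: nat \<Rightarrow> 'n) (e :: nat \<Rightarrow> 'n set). v 0 = i \<and> v n = j \<and>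
      (\<forall>l\<in>{1..n}. e l \<in> E \<and> v (l - 1) \<in> e l \<and> v l \<in> e l))"

definition edge_spread :: "'n::finite set \<Rightarrow> real ^ 'n \<Rightarrow> real" where
  "edge_spread e x = Max {\<bar>x $ i - x $ j\<bar> | i j. i \<in> e \<and> j \<in> e}"

definition hypergraph_energy ::
    "'n::finite set set \<Rightarrow> ('n set \<Rightarrow> real) \<Rightarrow> real \<Rightarrow> real ^ 'n \<Rightarrow> real" where
  "hypergraph_energy E w p x = (1 / p) * (\<Sum>e\<in>E. w e * edge_spread e x powr p)"

definition subdifferential :: "('a::real_inner \<Rightarrow> real) \<Rightarrow> 'a \<Rightarrow> 'a set" where
  "subdifferential \<phi> x = {\<eta>. \<forall>z. \<eta> \<bullet> (z - x) \<le> \<phi> z - \<phi> x}"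

definition hypergraph_laplacian ::
    "'n::finite set set \<Rightarrow> ('n set \<Rightarrow> real) \<Rightarrow> real \<Rightarrow> real ^ 'n \<Rightarrow> (real ^ 'n) set" where
  "hypergraph_laplacian E w p = subdifferential (hypergraph_energy E w p)"

text \<open>Lebesgue and Sobolev spaces on \<open>(0,T)\<close> are sets of functions \<open>real \<Rightarrow> 'a\<close>, not of
  equivalence classes; only the values on \<open>(0,T)\<close> matter, up to null sets.\<close>

definition L_one :: "real \<Rightarrow> (real \<Rightarrow> 'a::euclidean_space) set" where
  "L_one T = {u. u absolutely_integrable_on {0<..<T}}"

definition L_infty :: "real \<Rightarrow> (real \<Rightarrow> 'a::euclidean_space) set" where
  "L_infty T = {u. u \<in> borel_measurable (lebesgue_on {0<..<T}) \<and>
    (\<exists>C. AE t in lebesgue_on {0<..<T}. norm (u t) \<le> C)}"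

text \<open>Weak derivatives are tested against \<open>C\<^sup>1\<close> functions with compact support in \<open>(0,T)\<close>.\<close>

definition has_weak_derivative ::
    "(real \<Rightarrow> 'a::euclidean_space) \<Rightarrow> (real \<Rightarrow> 'a) \<Rightarrow> real \<Rightarrow> bool" where
  "has_weak_derivative u u' T \<longleftrightarrow> u \<in> L_one T \<and> u' \<in> L_one T \<and>
    (\<forall>(\<psi> :: real \<Rightarrow> real) \<psi>' K.
      (\<forall>t. (\<psi> has_real_derivative \<psi>' t) (at t)) \<and> continuous_on UNIV \<psi>' \<and>
      compact K \<and> K \<subseteq> {0<..<T} \<and> (\<forall>t. t \<notin> K \<longrightarrow> \<psi> t = 0) \<longrightarrow>
      (LINT t:{0<..<T}|lebesgue. \<psi>' t *\<^sub>R u t) = - (LINT t:{0<..<T}|lebesgue. \<psi> t *\<^sub>R u' t))"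

definition W_one_one :: "real \<Rightarrow> (real \<Rightarrow> 'a::euclidean_space) set" where
  "W_one_one T = {u. \<exists>u'. has_weak_derivative u u' T}"

definition W_one_infty :: "real \<Rightarrow> (real \<Rightarrow> 'a::euclidean_space) set" where
  "W_one_infty T = {u \<in> L_infty T. \<exists>u' \<in> L_infty T. has_weak_derivative u u' T}"

definition abs_continuous_on :: "real \<Rightarrow> real \<Rightarrow> (real \<Rightarrow> 'a::real_normed_vector) \<Rightarrow> bool" where
  "abs_continuous_on a b u \<longleftrightarrow>
    (\<forall>\<epsilon>>0. \<exists>\<delta>>0. \<forall>(n::nat) x y.
      (\<forall>i<n. a \<le> x i \<and> x i \<le> y i \<and> y i \<le> b) \<and>
      disjoint_family_on (\<lambda>i. {x i<..<y i}) {..<n} \<and>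
      (\<Sum>i<n. y i - x i) < \<delta> \<longrightarrow>
      (\<Sum>i<n. norm (u (y i) - u (x i))) < \<epsilon>)"

text \<open>Absolute continuity on \<open>[0,T]\<close> selects the representative of \<open>u\<close>, which gives the initial
  condition its meaning. The weak derivative is unique up to null sets, so its existential
  quantifier involves no choice. For \<open>q > 2\<close> the term \<open>norm x powr (q - 2) *\<^sub>R x\<close> is 0 at 0.\<close>

definition is_solution ::
    "'n::finite set set \<Rightarrow> ('n set \<Rightarrow> real) \<Rightarrow> real \<Rightarrow> real \<Rightarrow> real \<Rightarrow> (real ^ 'n \<Rightarrow> real ^ 'n) \<Rightarrow>
     real \<Rightarrow> (real \<Rightarrow> real ^ 'n) \<Rightarrow> real ^ 'n \<Rightarrow> (real \<Rightarrow> real ^ 'n) \<Rightarrow> (real \<Rightarrow> real ^ 'n) \<Rightarrow> bool"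
  where
  "is_solution E w p a q \<pi> T f u\<^sub>0 u \<mu> \<longleftrightarrow>
    u \<in> W_one_one T \<and> abs_continuous_on 0 T u \<and> \<mu> \<in> L_one T \<and>
    (\<exists>u'. has_weak_derivative u u' T \<and>
      (AE t in lebesgue_on {0<..<T}.
        0 \<in> {u' t + \<eta> | \<eta>. \<eta> \<in> hypergraph_laplacian E w p (\<mu> t)})) \<and>
    (AE t in lebesgue_on {0<..<T}.
      \<mu> t \<in> {\<eta> + a *\<^sub>R (norm (u t) powr (q - 2) *\<^sub>R u t) + \<pi> (u t) - f t | \<eta>.
               \<eta> \<in> hypergraph_laplacian E w p (u t)}) \<and>
    u 0 = u\<^sub>0"

end

theory Submission
  imports Defs "HOL-Complex_Analysis.Complex_Analysis"
begin

text \<open>Write \<open>\<phi>\<close> for the hypergraph energy, \<open>g(u) = a \<parallel>u\<parallel>\<^sup>q\<^sup>-\<^sup>2 u + \<pi>(u)\<close> and \<open>K\<close> for the primitive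
  \<open>a/q \<parallel>u\<parallel>\<^sup>q + k(u)\<close> of \<open>g\<close>. All that matters about \<open>\<phi>\<close> is that it is a finite convex function on a
  Euclidean space with minimum \<open>\<phi>(0) = 0\<close>; all that matters about \<open>g\<close> is that it is continuous with
  a primitive that grows superlinearly. The locale \<open>gradient_system\<close> collects these assumptions.

  A priori bounds. Testing the first inclusion with \<open>\<mu>\<close> and the second with \<open>u'\<close> gives
  \<open>(\<phi>(u) + K(u))' = u' \<bullet> (\<mu> + f) \<le> u' \<bullet> f\<close>, because \<open>- u' \<in> \<partial>\<phi>(\<mu>)\<close> implies \<open>u' \<bullet> \<mu> \<le> 0\<close>. Integrating
  the right-hand side by parts in time bounds it linearly in \<open>sup \<parallel>u\<parallel>\<close>, so the superlinear growth of
  \<open>K\<close> bounds \<open>u\<close>. Subgradients of a finite convex function are bounded on bounded sets, so \<open>\<mu>\<close>, and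
  then \<open>u'\<close>, are bounded as well.

  Approximation. Replacing both occurrences of \<open>\<partial>\<phi>\<close> by the Yosida approximation with parameter \<open>\<alpha>\<close>
  makes the system single-valued, and explicit Euler steps of a length \<open>h\<close> that is small compared
  with \<open>\<alpha>\<close> keep the energy estimate up to a small error (\<open>discrete_solutions_exist\<close>). On
  bounded sets the Yosida approximations are \<open>\<epsilon>\<close>-subgradients of \<open>\<phi>\<close> itself with \<open>\<epsilon>\<close> proportional to
  \<open>\<alpha>\<close>, so \<open>\<alpha>\<close> disappears from the limit problem.

  Limit. The discrete \<open>u\<close> and the primitives \<open>p\<close> of \<open>\<mu>\<close> are almost Lipschitz uniformly in the step
  length, so they converge pointwise along a subsequence, and the limits are Lipschitz
  (\<open>almost_lipschitz_subsequence\<close>). Lipschitz functions of one variable have a right derivative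
  almost everywhere and are integrals of it (\<open>lipschitz_derivative\<close>). The inclusions are summed over a
  short interval \<open>[s, t]\<close>, passed to the limit there by Jensen's inequality
  (\<open>local_inequalities\<close>), and divided by \<open>t - s\<close>; at a point \<open>s\<close> where \<open>u\<close> and \<open>p\<close> have right
  derivatives \<open>v\<close> and \<open>\<mu>\<close>, the limit \<open>t \<rightarrow> s\<close> gives the second inclusion \<open>\<eta> = \<mu> - g(u) + f \<in> \<partial>\<phi>(u)\<close>.
  For the first inclusion the product \<open>\<mu> \<bullet> u'\<close> of two weakly convergent sequences has to be
  identified. The discrete chain rule for \<open>\<phi>\<close> bounds its limit from below by the increment of
  \<open>\<phi> \<circ> u\<close> plus the contribution of \<open>g - f\<close>, and this increment is at least
  \<open>\<eta> \<bullet> (u(t) - u(s))\<close> by the second inclusion (\<open>solution_exists\<close>).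

  Two facts link this with Sobolev spaces: Lipschitz functions have their derivative as weak
  derivative (\<open>lipschitz_has_weak_derivative\<close>), and \<open>f\<close> agrees almost everywhere with a primitive of
  its weak derivative (\<open>weak_derivative_representation\<close>), which supplies values of \<open>f\<close> at the mesh
  points and the bound on its variation.\<close>

section \<open>Yosida approximation of a convex potential\<close>

text \<open>A finite convex function with minimum value 0 at the origin.\<close>

locale convex_potential =
  fixes \<phi> :: "'a::euclidean_space \<Rightarrow> real"
  assumes convex: "convex_on UNIV \<phi>"
    and nonneg: "0 \<le> \<phi> x"
    and zero: "\<phi> 0 = 0"
begin

lemma continuous: "continuous_on S \<phi>"
  using convex_on_continuous[OF open_UNIV convex] continuous_on_subset by blast

lemma bounded_on_ball:
  obtains B where "B > 0" "\<And>x. norm x \<le> R \<Longrightarrow> \<phi> x \<le> B"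
proof -
  have "compact (\<phi> ` cball 0 R)"
    by (intro compact_continuous_image continuous) auto
  then obtain B where "\<forall>y\<in>\<phi> ` cball 0 R. norm y \<le> B"
    using compact_imp_bounded bounded_iff by metis
  then have "\<And>x. norm x \<le> R \<Longrightarrow> \<phi> x \<le> max B 1"
    by (force simp: abs_le_iff)
  then show ?thesis using that[of "max B 1"] by auto
qed

text \<open>On a ball of radius \<open>R\<close> the function has as Lipschitz constant its bound on the ball of radius
  \<open>R + 1\<close>: beyond \<open>y\<close>, the segment from \<open>x\<close> to \<open>y\<close> is extended by a unit vector to a point \<open>w\<close>.\<close>

lemma lipschitz_bound:
  assumes B: "\<And>z. norm z \<le> R + 1 \<Longrightarrow> \<phi> z \<le> B" and "norm x \<le> R" "norm y \<le> R"
  shows "\<phi> y - \<phi> x \<le> B * norm (y - x)"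
proof (cases "y = x")
  case False
  define d where "d = norm (y - x)"
  have d: "d > 0" using False by (simp add: d_def)
  define w where "w = y + (1 / d) *\<^sub>R (y - x)"
  define t where "t = d / (1 + d)"
  have t: "0 \<le> t" "t \<le> 1" "t \<le> d" using d by (auto simp: t_def divide_simps)
  have "norm ((1 / d) *\<^sub>R (y - x)) = 1" using d by (simp add: d_def)
  then have "norm w \<le> R + 1"
    using norm_triangle_ineq[of y "(1 / d) *\<^sub>R (y - x)"] assms(3) unfolding w_def by linarith
  then have w: "\<phi> w \<le> B" by (rule B)
  have "(1 - t) *\<^sub>R x + t *\<^sub>R w = x + (t * (1 + 1 / d)) *\<^sub>R (y - x)"
    by (simp add: w_def algebra_simps)
  moreover have "t * (1 + 1 / d) = 1" 
  proof -
    have "1 + 1 / d = (1 + d) / d" using d by (simp add: field_simps)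
    moreover have "1 + d \<noteq> 0" using d by linarith
    ultimately show ?thesis using d by (simp add: t_def)
  qed
  ultimately have "y = (1 - t) *\<^sub>R x + t *\<^sub>R w" by simp
  then have "\<phi> y \<le> (1 - t) * \<phi> x + t * \<phi> w"
    using convex_onD[OF convex, of t x w] t by simp
  then have "\<phi> y - \<phi> x \<le> t * \<phi> w - t * \<phi> x" by (simp add: algebra_simps)
  also have "\<dots> \<le> t * B" using mult_left_mono[OF w t(1)] mult_nonneg_nonneg[OF t(1) nonneg[of x]] by linarith
  also have "\<dots> \<le> d * B"
    using t(3) w nonneg[of w] by (intro mult_right_mono) linarith+
  finally show ?thesis by (simp add: d_def mult.commute)
qed simp

lemma subgradient_bound:
  assumes B: "\<And>z. norm z \<le> R + 1 \<Longrightarrow> \<phi> z \<le> B" and "norm x \<le> R"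
    and "\<eta> \<in> subdifferential \<phi> x"
  shows "norm \<eta> \<le> B"
proof (cases "\<eta> = 0")
  case True
  then show ?thesis using B[of x] nonneg[of x] assms(2) by simp
next
  case False
  define z where "z = x + (1 / norm \<eta>) *\<^sub>R \<eta>"
  have "norm z \<le> R + 1"
    using norm_triangle_ineq[of x "(1 / norm \<eta>) *\<^sub>R \<eta>"] assms(2) False by (simp add: z_def)
  then have "\<phi> z \<le> B" by (rule B)
  moreover have "\<eta> \<bullet> (z - x) \<le> \<phi> z - \<phi> x"
    using assms(3) by (simp add: subdifferential_def)
  moreover have "\<eta> \<bullet> (z - x) = norm \<eta>"
    using False by (simp add: z_def dot_square_norm power2_eq_square)
  ultimately show ?thesis using nonneg[of x] by linarith
qed

text \<open>The resolvent is the minimiser of \<open>\<phi> + \<parallel>\<cdot> - x\<parallel>\<^sup>2 / (2 \<alpha>)\<close>; the optimality condition follows by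
  comparing the minimiser with nearby points of the segment to \<open>z\<close>.\<close>

lemma resolvent_exists:
  assumes "\<alpha> > 0"
  shows "\<exists>y. (1 / \<alpha>) *\<^sub>R (x - y) \<in> subdifferential \<phi> y"
proof -
  define \<Psi> where "\<Psi> = (\<lambda>y. 2 * \<alpha> * \<phi> y + (norm (y - x))\<^sup>2)"
  have cont: "continuous_on S \<Psi>" for S
    unfolding \<Psi>_def by (intro continuous_intros continuous)
  define r where "r = sqrt (\<Psi> x)"
  have r: "0 \<le> r" "r\<^sup>2 = \<Psi> x"
    using nonneg[of x] assms by (auto simp: r_def \<Psi>_def)
  obtain y where y: "y \<in> cball x r" "\<And>z. z \<in> cball x r \<Longrightarrow> \<Psi> y \<le> \<Psi> z"
    using continuous_attains_inf[OF compact_cball _ cont, of x r] r(1) by auto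
  have min: "\<Psi> y \<le> \<Psi> z" for z
  proof (cases "z \<in> cball x r")
    case False
    then have "r\<^sup>2 \<le> (norm (z - x))\<^sup>2"
      using r by (intro power_mono) (auto simp: dist_norm norm_minus_commute)
    also have "\<dots> \<le> \<Psi> z" using nonneg[of z] assms by (simp add: \<Psi>_def)
    finally show ?thesis using y(2)[of x] r by simp
  qed (use y in auto)
  have "(1 / \<alpha>) *\<^sub>R (x - y) \<bullet> (z - y) \<le> \<phi> z - \<phi> y" for z
  proof -
    define c where "c = 2 * \<alpha> * (\<phi> z - \<phi> y) - 2 * ((x - y) \<bullet> (z - y))"
    have step: "0 \<le> c + t * (norm (z - y))\<^sup>2" if t: "0 < t" "t < 1" for t
    proof -
      have "\<Psi> y \<le> \<Psi> ((1 - t) *\<^sub>R y + t *\<^sub>R z)" by (rule min)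
      also have "\<dots> \<le> 2 * \<alpha> * ((1 - t) * \<phi> y + t * \<phi> z) + (norm ((1 - t) *\<^sub>R y + t *\<^sub>R z - x))\<^sup>2"
        unfolding \<Psi>_def using convex_onD[OF convex, of t y z] t assms by simp
      also have "(1 - t) *\<^sub>R y + t *\<^sub>R z - x = (y - x) + t *\<^sub>R (z - y)"
        by (simp add: algebra_simps)
      finally have "0 \<le> t * (c + t * (norm (z - y))\<^sup>2)"
        unfolding \<Psi>_def c_def power2_norm_eq_inner
        by (simp add: algebra_simps inner_commute)
      then show ?thesis using t by (simp add: zero_le_mult_iff)
    qed
    have lim: "((\<lambda>t. c + t * (norm (z - y))\<^sup>2) \<longlongrightarrow> c + 0 * (norm (z - y))\<^sup>2) (at_right 0)"
      by (intro tendsto_intros)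
    have "\<forall>\<^sub>F t in at_right (0::real). 0 \<le> c + t * (norm (z - y))\<^sup>2"
      by (rule eventually_mono[OF eventually_at_right_real[of 0 1]]) (use step in auto)
    from tendsto_lowerbound[OF lim this] have "0 \<le> c" by simp
    then have "(x - y) \<bullet> (z - y) \<le> \<alpha> * (\<phi> z - \<phi> y)" by (simp add: c_def)
    then have "((x - y) \<bullet> (z - y)) / \<alpha> \<le> \<phi> z - \<phi> y" using assms by (simp add: field_simps)
    then show ?thesis unfolding inner_scaleR_left by simp
  qed
  then show ?thesis by (intro exI[of _ y]) (simp add: subdifferential_def)
qed

text \<open>The resolvent \<open>(1 + \<alpha> \<partial>\<phi>)\<^sup>-\<^sup>1\<close>, the Yosida approximation of \<open>\<partial>\<phi>\<close>, and the Moreau envelope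
  of \<open>\<phi>\<close>, meant for \<open>\<alpha> > 0\<close>.\<close>

definition resolvent :: "real \<Rightarrow> 'a \<Rightarrow> 'a" where
  "resolvent \<alpha> x = (SOME y. (1 / \<alpha>) *\<^sub>R (x - y) \<in> subdifferential \<phi> y)"

definition yosida :: "real \<Rightarrow> 'a \<Rightarrow> 'a" where
  "yosida \<alpha> x = (1 / \<alpha>) *\<^sub>R (x - resolvent \<alpha> x)"

definition moreau :: "real \<Rightarrow> 'a \<Rightarrow> real" where
  "moreau \<alpha> x = \<phi> (resolvent \<alpha> x) + \<alpha> / 2 * (norm (yosida \<alpha> x))\<^sup>2"

context
  fixes \<alpha> :: real
  assumes pos: "\<alpha> > 0"
begin

lemma yosida_subgradient: "yosida \<alpha> x \<in> subdifferential \<phi> (resolvent \<alpha> x)"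
  unfolding yosida_def resolvent_def by (rule someI_ex[OF resolvent_exists[OF pos]])

lemma yosida_ineq: "yosida \<alpha> x \<bullet> (z - resolvent \<alpha> x) \<le> \<phi> z - \<phi> (resolvent \<alpha> x)"
  using yosida_subgradient[of x] by (simp add: subdifferential_def)

lemma resolvent_eq: "resolvent \<alpha> x = x - \<alpha> *\<^sub>R yosida \<alpha> x"
  using pos by (simp add: yosida_def)

lemma yosida_inner_nonneg: "0 \<le> yosida \<alpha> x \<bullet> x"
  and norm_resolvent_le: "norm (resolvent \<alpha> x) \<le> norm x"
proof -
  have J: "0 \<le> yosida \<alpha> x \<bullet> resolvent \<alpha> x"
    using yosida_ineq[of x 0] nonneg[of "resolvent \<alpha> x"] by (simp add: zero)
  have x: "x = resolvent \<alpha> x + \<alpha> *\<^sub>R yosida \<alpha> x" by (simp add: resolvent_eq)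
  have "yosida \<alpha> x \<bullet> x = yosida \<alpha> x \<bullet> resolvent \<alpha> x + \<alpha> * (yosida \<alpha> x \<bullet> yosida \<alpha> x)"
    by (subst x) (simp add: inner_add_right)
  then show "0 \<le> yosida \<alpha> x \<bullet> x" using J pos by simp
  have "(norm x)\<^sup>2 = (norm (resolvent \<alpha> x))\<^sup>2 + 2 * \<alpha> * (yosida \<alpha> x \<bullet> resolvent \<alpha> x)
      + \<alpha>\<^sup>2 * (norm (yosida \<alpha> x))\<^sup>2"
    by (subst x) (simp only: power2_norm_eq_inner, simp add: algebra_simps inner_commute power2_eq_square)
  then have "(norm (resolvent \<alpha> x))\<^sup>2 \<le> (norm x)\<^sup>2" using J pos by simp
  then show "norm (resolvent \<alpha> x) \<le> norm x" by (rule power2_le_imp_le) simp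
qed

lemma yosida_lipschitz: "norm (yosida \<alpha> x - yosida \<alpha> y) \<le> norm (x - y) / \<alpha>"
proof -
  define a where "a = yosida \<alpha> x - yosida \<alpha> y"
  define j where "j = resolvent \<alpha> x - resolvent \<alpha> y"
  have "yosida \<alpha> x \<bullet> (resolvent \<alpha> y - resolvent \<alpha> x)
      + yosida \<alpha> y \<bullet> (resolvent \<alpha> x - resolvent \<alpha> y) \<le> 0"
    using yosida_ineq[of x "resolvent \<alpha> y"] yosida_ineq[of y "resolvent \<alpha> x"] by simp
  then have "0 \<le> a \<bullet> j" by (simp add: a_def j_def algebra_simps)
  moreover have xy: "x - y = j + \<alpha> *\<^sub>R a"
    by (simp add: a_def j_def resolvent_eq algebra_simps)
  have "(norm (x - y))\<^sup>2 = (norm j)\<^sup>2 + 2 * \<alpha> * (a \<bullet> j) + \<alpha>\<^sup>2 * (norm a)\<^sup>2"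
    unfolding xy power2_norm_eq_inner by (simp add: algebra_simps inner_commute power2_eq_square)
  ultimately have "(\<alpha> * norm a)\<^sup>2 \<le> (norm (x - y))\<^sup>2"
    using pos by (simp add: power_mult_distrib)
  then have "\<alpha> * norm a \<le> norm (x - y)" by (rule power2_le_imp_le) simp
  then show ?thesis using pos by (simp add: a_def field_simps)
qed

text \<open>Unlike \<open>\<phi>\<close>, the Moreau envelope has the Yosida approximation as an exact subgradient. In the
  time discretisation this keeps the errors of the individual steps summable.\<close>

lemma moreau_subgradient: "yosida \<alpha> x \<bullet> (y - x) \<le> moreau \<alpha> y - moreau \<alpha> x"
proof -
  define a b where "a = yosida \<alpha> x" and "b = yosida \<alpha> y"
  have "a \<bullet> (resolvent \<alpha> y - resolvent \<alpha> x) = a \<bullet> (y - x) - \<alpha> * (a \<bullet> b) + \<alpha> * (a \<bullet> a)"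
    by (simp add: a_def b_def resolvent_eq algebra_simps)
  then have "a \<bullet> (y - x) - \<alpha> * (a \<bullet> b) + \<alpha> * (a \<bullet> a) \<le> \<phi> (resolvent \<alpha> y) - \<phi> (resolvent \<alpha> x)"
    using yosida_ineq[of x "resolvent \<alpha> y"] by (simp add: a_def)
  moreover have "0 \<le> \<alpha> / 2 * ((b - a) \<bullet> (b - a))" using pos by simp
  ultimately show ?thesis
    unfolding moreau_def power2_norm_eq_inner a_def[symmetric] b_def[symmetric]
    by (simp add: algebra_simps inner_commute)
qed

lemma moreau_le: "moreau \<alpha> x \<le> \<phi> x"
proof -
  have "yosida \<alpha> x \<bullet> (\<alpha> *\<^sub>R yosida \<alpha> x) \<le> \<phi> x - \<phi> (resolvent \<alpha> x)"
    using yosida_ineq[of x x] by (simp add: resolvent_eq)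
  moreover have "0 \<le> \<alpha> * (yosida \<alpha> x \<bullet> yosida \<alpha> x)" using pos by simp
  ultimately show ?thesis by (simp add: moreau_def power2_norm_eq_inner)
qed

lemma moreau_nonneg: "0 \<le> moreau \<alpha> x"
  using pos nonneg by (simp add: moreau_def)

context
  fixes R B :: real
  assumes B: "\<And>z. norm z \<le> R + 1 \<Longrightarrow> \<phi> z \<le> B"
begin

lemma norm_yosida_le: "norm x \<le> R \<Longrightarrow> norm (yosida \<alpha> x) \<le> B"
  using subgradient_bound[of R B, OF _ _ yosida_subgradient[of x]] B norm_resolvent_le[of x] by simp

lemma resolvent_close:
  assumes "norm x \<le> R"
  shows "\<phi> x - \<phi> (resolvent \<alpha> x) \<le> \<alpha> * B\<^sup>2"
proof -
  have "0 \<le> B" using norm_yosida_le[OF assms] norm_ge_zero order_trans by blast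
  have "\<phi> x - \<phi> (resolvent \<alpha> x) \<le> B * norm (x - resolvent \<alpha> x)"
    using lipschitz_bound[of R B "resolvent \<alpha> x" x] B norm_resolvent_le[of x] assms by simp
  also have "\<dots> = B * (\<alpha> * norm (yosida \<alpha> x))" using pos by (simp add: resolvent_eq)
  also have "\<dots> \<le> B * (\<alpha> * B)"
    using norm_yosida_le[OF assms] pos \<open>0 \<le> B\<close> by (intro mult_left_mono) auto
  finally show ?thesis by (simp add: power2_eq_square algebra_simps)
qed

lemma moreau_close:
  assumes "norm x \<le> R"
  shows "\<phi> x - moreau \<alpha> x \<le> \<alpha> * B\<^sup>2"
proof -
  have "0 \<le> \<alpha> / 2 * (norm (yosida \<alpha> x))\<^sup>2" using pos by simp
  then show ?thesis unfolding moreau_def using resolvent_close[OF assms] by linarith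
qed

text \<open>The Yosida approximation is a subgradient of \<open>\<phi>\<close> at the resolvent; it is an
  \<open>\<alpha> B\<^sup>2\<close>-subgradient at the point itself.\<close>

lemma yosida_approx_subgradient:
  assumes "norm x \<le> R"
  shows "\<phi> x + yosida \<alpha> x \<bullet> (z - x) - \<alpha> * B\<^sup>2 \<le> \<phi> z"
proof -
  have "yosida \<alpha> x \<bullet> (z - resolvent \<alpha> x) = yosida \<alpha> x \<bullet> (z - x) + \<alpha> * (yosida \<alpha> x \<bullet> yosida \<alpha> x)"
    by (simp add: resolvent_eq algebra_simps)
  moreover have "0 \<le> \<alpha> * (yosida \<alpha> x \<bullet> yosida \<alpha> x)" using pos by simp
  ultimately show ?thesis using yosida_ineq[of x z] resolvent_close[OF assms] by linarith
qed

end

end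

end

section \<open>A discrete approximation with uniform bounds\<close>

lemma gderiv_increment:
  fixes K :: "'a::real_inner \<Rightarrow> real"
  assumes K: "\<And>x. GDERIV K x :> g x"
  obtains s where "0 < s" "s < 1" "K y - K x = g (x + s *\<^sub>R (y - x)) \<bullet> (y - x)"
proof -
  have "((\<lambda>t. K (x + t *\<^sub>R (y - x))) has_real_derivative g (x + t *\<^sub>R (y - x)) \<bullet> (y - x)) (at t)" for t
  proof -
    have "((\<lambda>t. K (x + t *\<^sub>R (y - x))) has_derivative
        (\<lambda>d. (d *\<^sub>R (y - x)) \<bullet> g (x + t *\<^sub>R (y - x)))) (at t)"
      by (rule has_derivative_compose[OF _ K[unfolded gderiv_def]])
         (auto intro!: derivative_eq_intros)
    then show ?thesis
      unfolding has_field_derivative_def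
      by (rule has_derivative_eq_rhs) (simp add: fun_eq_iff inner_commute mult.commute)
  qed
  from MVT2[of 0 1, OF _ this] that show ?thesis by auto
qed

text \<open>The data of the system \<open>u' + \<partial>\<phi>(\<mu>) \<ni> 0\<close>, \<open>\<mu> \<in> \<partial>\<phi>(u) + g(u) - f\<close>, \<open>u(0) = u\<^sub>0\<close>. The function
  \<open>G\<close> dominates the variation of \<open>f\<close>.\<close>

locale gradient_system = convex_potential \<phi>
  for \<phi> :: "'a::euclidean_space \<Rightarrow> real" +
  fixes g :: "'a \<Rightarrow> 'a" and K :: "'a \<Rightarrow> real" and f :: "real \<Rightarrow> 'a"
    and G :: "real \<Rightarrow> real" and T :: real and u\<^sub>0 :: 'a
  assumes g_continuous: "continuous_on UNIV g"
    and K_gradient: "GDERIV K x :> g x"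
    and K_superlinear: "\<exists>D. \<forall>x. c * norm x - D \<le> K x"
    and T_pos: "0 < T"
    and f_continuous: "continuous_on {0..T} f"
    and f_variation: "0 \<le> s \<Longrightarrow> s \<le> t \<Longrightarrow> t \<le> T \<Longrightarrow> norm (f t - f s) \<le> G t - G s"
begin

text \<open>The explicit Euler scheme with step \<open>h\<close> in which both occurrences of \<open>\<partial>\<phi>\<close> are replaced by
  the Yosida approximation.\<close>

primrec euler :: "real \<Rightarrow> real \<Rightarrow> nat \<Rightarrow> 'a" where
  "euler \<alpha> h 0 = u\<^sub>0"
| "euler \<alpha> h (Suc k) = euler \<alpha> h k -
    h *\<^sub>R yosida \<alpha> (yosida \<alpha> (euler \<alpha> h k) + g (euler \<alpha> h k) - f (real k * h))"

text \<open>A discrete solution with \<open>m\<close> steps, bound \<open>M\<close> and tolerance \<open>\<epsilon>\<close>: the increments of \<open>u\<close> are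
  \<open>T / m\<close> times the velocities \<open>v\<close>; \<open>- v\<close> is an \<open>\<epsilon>\<close>-subgradient of \<open>\<phi>\<close> at \<open>\<mu>\<close>, and
  \<open>\<mu> - g(u) + f\<close> is one at \<open>u\<close>; and the increments of \<open>\<phi>\<close> along \<open>u\<close> obey one half of the chain
  rule up to \<open>\<epsilon>\<close>.\<close>

definition discrete_solution ::
    "real \<Rightarrow> real \<Rightarrow> nat \<Rightarrow> (nat \<Rightarrow> 'a) \<Rightarrow> (nat \<Rightarrow> 'a) \<Rightarrow> (nat \<Rightarrow> 'a) \<Rightarrow> bool" where
  "discrete_solution M \<epsilon> m u v \<mu> \<longleftrightarrow>
    0 < m \<and> T / m \<le> \<epsilon> \<and> u 0 = u\<^sub>0 \<and> (\<forall>k. u (Suc k) = u k + (T / m) *\<^sub>R v k) \<and>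
    (\<forall>k\<le>m. norm (u k) \<le> M \<and> norm (v k) \<le> M \<and> norm (\<mu> k) \<le> M) \<and>
    (\<forall>k\<le>m. \<forall>z. \<phi> (\<mu> k) - v k \<bullet> (z - \<mu> k) - \<epsilon> \<le> \<phi> z) \<and>
    (\<forall>k\<le>m. \<forall>z. \<phi> (u k) + (\<mu> k - g (u k) + f (k * (T / m))) \<bullet> (z - u k) - \<epsilon> \<le> \<phi> z) \<and>
    (\<forall>i j. i \<le> j \<longrightarrow> j \<le> m \<longrightarrow> \<phi> (u j) - \<phi> (u i) - \<epsilon>
      \<le> (\<Sum>k=i..<j. (T / m) * ((\<mu> k - g (u k) + f (k * (T / m))) \<bullet> v k)))"

text \<open>The work of \<open>f\<close> is bounded linearly in the size of \<open>u\<close>, whatever the increments of \<open>u\<close>.\<close>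

lemma summation_by_parts_bound:
  fixes u :: "nat \<Rightarrow> 'a"
  assumes F: "\<And>t. 0 \<le> t \<Longrightarrow> t \<le> T \<Longrightarrow> norm (f t) \<le> F"
    and "0 < h" "real j * h \<le> T" and u: "\<And>k. k \<le> j \<Longrightarrow> norm (u k) \<le> \<rho>"
  shows "(\<Sum>k<j. f (real k * h) \<bullet> (u (Suc k) - u k)) \<le> F * \<rho> + F * norm (u 0) + (G T - G 0) * \<rho>"
proof -
  have \<rho>: "0 \<le> \<rho>" using u[of 0] norm_ge_zero order_trans by blast
  have le_T: "real k * h \<le> T" if "k \<le> j" for k
    using order_trans[OF mult_right_mono[of "real k" "real j" h]] that assms(2,3) by simp
  have "(\<Sum>k<i. f (real k * h) \<bullet> (u (Suc k) - u k))
      \<le> f (real i * h) \<bullet> u i - f 0 \<bullet> u 0 + (G (real i * h) - G 0) * \<rho>" if "i \<le> j" for i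
    using that
  proof (induction i)
    case (Suc i)
    have "(f (real i * h) - f (real (Suc i) * h)) \<bullet> u (Suc i)
        \<le> norm (f (real (Suc i) * h) - f (real i * h)) * norm (u (Suc i))"
      using norm_cauchy_schwarz[of "f (real i * h) - f (real (Suc i) * h)" "u (Suc i)"]
      by (simp add: norm_minus_commute)
    also have "\<dots> \<le> (G (real (Suc i) * h) - G (real i * h)) * \<rho>"
    proof (intro mult_mono)
      show *: "norm (f (real (Suc i) * h) - f (real i * h)) \<le> G (real (Suc i) * h) - G (real i * h)"
        using Suc.prems assms(2) le_T[of "Suc i"] by (intro f_variation) (auto simp: algebra_simps)
      show "0 \<le> G (real (Suc i) * h) - G (real i * h)"
        using * norm_ge_zero order_trans by blast
    qed (use u[of "Suc i"] Suc.prems in auto)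
    finally have "f (real i * h) \<bullet> u (Suc i) - f (real (Suc i) * h) \<bullet> u (Suc i)
        \<le> (G (real (Suc i) * h) - G (real i * h)) * \<rho>" by (simp only: inner_diff_left)
    moreover have "(\<Sum>k<Suc i. f (real k * h) \<bullet> (u (Suc k) - u k)) =
        (\<Sum>k<i. f (real k * h) \<bullet> (u (Suc k) - u k)) + f (real i * h) \<bullet> u (Suc i) - f (real i * h) \<bullet> u i"
      by (simp add: inner_diff_right)
    moreover have "(\<Sum>k<i. f (real k * h) \<bullet> (u (Suc k) - u k))
        \<le> f (real i * h) \<bullet> u i - f 0 \<bullet> u 0 + (G (real i * h) - G 0) * \<rho>"
      using Suc by simp
    ultimately show ?case unfolding left_diff_distrib by linarith
  qed simp
  from this[of j] have "(\<Sum>k<j. f (real k * h) \<bullet> (u (Suc k) - u k))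
      \<le> f (real j * h) \<bullet> u j - f 0 \<bullet> u 0 + (G (real j * h) - G 0) * \<rho>" by simp
  moreover have "f (real j * h) \<bullet> u j \<le> F * \<rho>"
  proof -
    have "f (real j * h) \<bullet> u j \<le> norm (f (real j * h)) * norm (u j)" by (rule norm_cauchy_schwarz)
    also have "\<dots> \<le> F * \<rho>"
      using F[of "real j * h"] order_trans[OF norm_ge_zero F[of "real j * h"]] assms(2,3) u[of j]
      by (intro mult_mono) auto
    finally show ?thesis .
  qed
  moreover have "- (f 0 \<bullet> u 0) \<le> F * norm (u 0)"
  proof -
    have "- (f 0 \<bullet> u 0) \<le> norm (f 0) * norm (u 0)"
      using Cauchy_Schwarz_ineq2[of "f 0" "u 0"] by linarith
    also have "\<dots> \<le> F * norm (u 0)" using F[of 0] T_pos by (intro mult_right_mono) auto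
    finally show ?thesis .
  qed
  moreover have "(G (real j * h) - G 0) * \<rho> \<le> (G T - G 0) * \<rho>"
  proof (rule mult_right_mono[OF _ \<rho>])
    have "norm (f T - f (real j * h)) \<le> G T - G (real j * h)"
      using assms by (intro f_variation) auto
    then show "G (real j * h) - G 0 \<le> G T - G 0" using norm_ge_zero[of "f T - f (real j * h)"] by linarith
  qed
  ultimately show ?thesis by linarith
qed


text \<open>A bound of \<open>K\<close> that is linear in the size of \<open>u\<close> bounds \<open>u\<close>, since \<open>K\<close> grows faster: the two are
  compared where the norm of \<open>u\<close> is largest.\<close>

lemma norm_bound_from_coercivity:
  fixes u :: "nat \<Rightarrow> 'a"
  assumes "\<And>x. (c + 1) * norm x - D \<le> K x"
    and "\<And>k. k \<le> j \<Longrightarrow> K (u k) \<le> C + c * \<rho>" and "\<And>k. k \<le> j \<Longrightarrow> norm (u k) \<le> \<rho>"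
    and "\<exists>k\<le>j. norm (u k) = \<rho>"
  shows "\<rho> \<le> C + D"
proof -
  obtain k where k: "k \<le> j" "norm (u k) = \<rho>" using assms(4) by blast
  show ?thesis using assms(1)[of "u k"] assms(2)[OF k(1)] k(2) by (simp add: algebra_simps)
qed

lemma discrete_solutions_exist:
  obtains M where "M > 0" "\<And>\<epsilon>. \<epsilon> > 0 \<Longrightarrow> \<exists>m u v \<mu>. discrete_solution M \<epsilon> m u v \<mu>"
proof -
  have "compact (f ` {0..T})" by (intro compact_continuous_image f_continuous) auto
  then obtain F where F: "\<And>t. 0 \<le> t \<Longrightarrow> t \<le> T \<Longrightarrow> norm (f t) \<le> F"
    by (metis atLeastAtMost_iff bounded_iff compact_imp_bounded imageI)
  have F0: "0 \<le> F" using F[of 0] T_pos norm_ge_zero order_trans by (metis less_imp_le order_refl)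
  define c where "c = F + (G T - G 0)"
  obtain D where D: "\<And>x. (c + 1) * norm x - D \<le> K x" using K_superlinear by blast
  define C where "C = \<phi> u\<^sub>0 + K u\<^sub>0 + 1 + F * norm u\<^sub>0"
  \<comment> \<open>\<open>R\<close> will bound the states, \<open>B1\<close> their Yosida approximations, \<open>M2\<close> the potentials \<open>\<mu>\<close> and
    \<open>B2\<close> the velocities.\<close>
  define R where "R = max (C + D) (norm u\<^sub>0)"
  have R0: "0 \<le> R" by (simp add: R_def le_max_iff_disj)
  obtain B1 where B1: "B1 > 0" "\<And>x. norm x \<le> R + 1 \<Longrightarrow> \<phi> x \<le> B1" using bounded_on_ball by blast
  have "compact (g ` cball 0 (R + 1))"
    by (intro compact_continuous_image continuous_on_subset[OF g_continuous]) auto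
  then obtain Mg where Mg: "\<And>x. norm x \<le> R + 1 \<Longrightarrow> norm (g x) \<le> Mg"
    by (metis mem_cball_0 bounded_iff compact_imp_bounded imageI)
  have Mg0: "0 \<le> Mg" using Mg[of 0] R0 norm_ge_zero order_trans by (metis add_increasing norm_zero zero_le_one)
  define M2 where "M2 = B1 + Mg + F"
  obtain B2 where B2: "B2 > 0" "\<And>x. norm x \<le> M2 + 1 \<Longrightarrow> \<phi> x \<le> B2" using bounded_on_ball by blast
  define M where "M = R + M2 + B2"
  have M: "M > 0" "R \<le> M" "M2 \<le> M" "B2 \<le> M"
    using R0 B1 B2 F0 Mg0 by (auto simp: M_def M2_def)
  have "\<exists>m u v \<mu>. discrete_solution M \<epsilon> m u v \<mu>" if \<epsilon>: "\<epsilon> > 0" for \<epsilon>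
  proof -
    define \<delta> where "\<delta> = 1 / (2 * T * M)"
    have \<delta>: "\<delta> > 0" using T_pos M by (simp add: \<delta>_def)
    have "uniformly_continuous_on (cball 0 (R + 1)) g"
      by (intro compact_uniformly_continuous continuous_on_subset[OF g_continuous]) auto
    then obtain d where d: "d > 0" "\<And>x y. norm x \<le> R + 1 \<Longrightarrow> norm y \<le> R + 1 \<Longrightarrow> norm (x - y) < d
        \<Longrightarrow> norm (g x - g y) < \<delta>"
      using \<delta> unfolding uniformly_continuous_on_def by (metis dist_norm mem_cball_0)
    define \<alpha> where "\<alpha> = min 1 (\<epsilon> / (2 * (B1\<^sup>2 + B2\<^sup>2)))"
    have B12: "0 < B1\<^sup>2 + B2\<^sup>2" using B1 B2 by (simp add: add_pos_pos)
    have \<alpha>: "\<alpha> > 0" using B12 \<epsilon> by (simp add: \<alpha>_def)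
    have "\<alpha> \<le> \<epsilon> / (2 * (B1\<^sup>2 + B2\<^sup>2))" by (simp add: \<alpha>_def)
    then have "\<alpha> * (2 * (B1\<^sup>2 + B2\<^sup>2)) \<le> \<epsilon>" using B12 by (subst (asm) pos_le_divide_eq) auto
    then have "\<alpha> * (B1\<^sup>2 + B2\<^sup>2) \<le> \<epsilon> / 2" by linarith
    then have \<alpha>B: "\<alpha> * B1\<^sup>2 \<le> \<epsilon> / 2" "\<alpha> * B2\<^sup>2 \<le> \<epsilon> / 2"
      using mult_nonneg_nonneg[OF less_imp_le[OF \<alpha>] zero_le_power2[of B1]]
        mult_nonneg_nonneg[OF less_imp_le[OF \<alpha>] zero_le_power2[of B2]]
      unfolding distrib_left by linarith+
    \<comment> \<open>The step is small compared with \<open>\<alpha>\<close>, since the Yosida approximation has Lipschitz constant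
      \<open>1 / \<alpha>\<close>.\<close>
    define h0 where "h0 = min \<epsilon> (min (1 / M) (min (d / (2 * M))
      (min (\<alpha> / (2 * T * M\<^sup>2)) (\<epsilon> * \<alpha> / (2 * T * M\<^sup>2)))))"
    have h0: "h0 > 0" using \<epsilon> M d \<alpha> T_pos by (simp add: h0_def)
    obtain m :: nat where m0: "T / h0 < m" using reals_Archimedean2 by blast
    have m: "0 < m" using m0 T_pos h0 by (metis divide_pos_pos less_trans of_nat_0_less_iff)
    define h where "h = T / m"
    have h: "h > 0" "h \<le> h0" "real m * h = T"
      using m T_pos m0 h0 by (auto simp: h_def field_simps)
    then have h_le: "h \<le> \<epsilon>" "h \<le> 1 / M" "h \<le> d / (2 * M)" "h \<le> \<alpha> / (2 * T * M\<^sup>2)"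
        "h \<le> \<epsilon> * \<alpha> / (2 * T * M\<^sup>2)"
      unfolding h0_def min.bounded_iff by blast+
    then have hM: "h * M \<le> 1" "h * M < d" "T * (h * M\<^sup>2 / \<alpha>) \<le> 1 / 2" "T * (h * M\<^sup>2 / \<alpha>) \<le> \<epsilon> / 2"
      using M T_pos \<alpha> d by (auto simp: field_simps)
    have le_T: "real k * h \<le> T" if "k \<le> m" for k
      using order_trans[OF mult_right_mono[of "real k" "real m" h]] that h by simp
    define u where "u = euler \<alpha> h"
    define \<eta> where "\<eta> = (\<lambda>k. yosida \<alpha> (u k))"
    define \<mu> where "\<mu> = (\<lambda>k. \<eta> k + g (u k) - f (real k * h))"
    define v where "v = (\<lambda>k. - yosida \<alpha> (\<mu> k))"
    have u0: "u 0 = u\<^sub>0" by (simp add: u_def)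
    have uSuc: "u (Suc k) = u k + h *\<^sub>R v k" for k
      by (simp add: u_def v_def \<mu>_def \<eta>_def)
    have bounds: "norm (\<eta> k) \<le> B1" "norm (\<mu> k) \<le> M2" "norm (v k) \<le> B2"
      if "norm (u k) \<le> R" "k \<le> m" for k
    proof -
      show 1: "norm (\<eta> k) \<le> B1"
        unfolding \<eta>_def by (rule norm_yosida_le[OF \<alpha>, of R]) (use B1 that in auto)
      have "norm (\<mu> k) \<le> norm (\<eta> k) + norm (g (u k)) + norm (f (real k * h))"
        unfolding \<mu>_def by (meson add_mono_thms_linordered_semiring(3) norm_triangle_ineq norm_triangle_ineq4 order_trans)
      also have "\<dots> \<le> M2"
        unfolding M2_def using 1 Mg[of "u k"] F[of "real k * h"] le_T[OF that(2)] h(1) that(1)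
        by (intro add_mono) auto
      finally show 2: "norm (\<mu> k) \<le> M2" .
      show "norm (v k) \<le> B2"
        unfolding v_def norm_minus_cancel by (rule norm_yosida_le[OF \<alpha>, of M2]) (use B2 2 in auto)
    qed
    have increment: "moreau \<alpha> (u (Suc k)) - moreau \<alpha> (u k) \<le> h * (\<eta> k \<bullet> v k) + h * (h * M\<^sup>2 / \<alpha>)"
        "K (u (Suc k)) - K (u k) \<le> h * (g (u k) \<bullet> v k) + h * (\<delta> * M)"
      if "norm (u k) \<le> R" "k \<le> m" for k
    proof -
      have vM: "norm (v k) \<le> M" using bounds[OF that] M by linarith
      have du: "u (Suc k) - u k = h *\<^sub>R v k" by (simp add: uSuc)
      have norm_du: "norm (u (Suc k) - u k) \<le> h * M" using vM h by (simp add: du)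
      have "moreau \<alpha> (u (Suc k)) - moreau \<alpha> (u k) \<le> yosida \<alpha> (u (Suc k)) \<bullet> (u (Suc k) - u k)"
        using moreau_subgradient[OF \<alpha>, of "u (Suc k)" "u k"]
          inner_minus_right[of "yosida \<alpha> (u (Suc k))" "u (Suc k) - u k"] by simp
      also have "\<dots> = \<eta> k \<bullet> (u (Suc k) - u k)
          + (yosida \<alpha> (u (Suc k)) - yosida \<alpha> (u k)) \<bullet> (u (Suc k) - u k)"
        by (simp add: \<eta>_def inner_diff_left)
      also have "(yosida \<alpha> (u (Suc k)) - yosida \<alpha> (u k)) \<bullet> (u (Suc k) - u k)
          \<le> norm (yosida \<alpha> (u (Suc k)) - yosida \<alpha> (u k)) * norm (u (Suc k) - u k)"
        by (rule norm_cauchy_schwarz)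
      also have "\<dots> \<le> (norm (u (Suc k) - u k) / \<alpha>) * norm (u (Suc k) - u k)"
        by (intro mult_right_mono yosida_lipschitz[OF \<alpha>]) simp
      also have "\<dots> \<le> (h * M / \<alpha>) * (h * M)"
        using norm_du \<alpha> M h by (intro mult_mono divide_right_mono) auto
      finally show "moreau \<alpha> (u (Suc k)) - moreau \<alpha> (u k) \<le> h * (\<eta> k \<bullet> v k) + h * (h * M\<^sup>2 / \<alpha>)"
        by (simp add: du power2_eq_square algebra_simps)
      obtain s where s: "0 < s" "s < 1"
        "K (u (Suc k)) - K (u k) = g (u k + s *\<^sub>R (u (Suc k) - u k)) \<bullet> (u (Suc k) - u k)"
        using gderiv_increment[OF K_gradient] by blast
      define x where "x = u k + s *\<^sub>R (u (Suc k) - u k)"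
      have "norm (s *\<^sub>R (u (Suc k) - u k)) \<le> 1 * norm (u (Suc k) - u k)"
        unfolding norm_scaleR using s by (intro mult_right_mono) auto
      then have x_le: "norm (x - u k) \<le> h * M" using norm_du by (simp add: x_def)
      then have "norm x \<le> R + 1" using that(1) hM(1) norm_triangle_ineq2[of x "u k"] by linarith
      then have "norm (g x - g (u k)) \<le> \<delta>"
        using d(2)[of x "u k"] x_le hM(2) that(1) by force
      have "K (u (Suc k)) - K (u k) = g (u k) \<bullet> (u (Suc k) - u k) + (g x - g (u k)) \<bullet> (u (Suc k) - u k)"
        using s(3) by (simp add: x_def inner_diff_left)
      also have "(g x - g (u k)) \<bullet> (u (Suc k) - u k) \<le> norm (g x - g (u k)) * norm (u (Suc k) - u k)"
        by (rule norm_cauchy_schwarz)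
      also have "\<dots> \<le> \<delta> * (h * M)"
        using \<open>norm (g x - g (u k)) \<le> \<delta>\<close> norm_du \<delta> by (intro mult_mono) auto
      finally show "K (u (Suc k)) - K (u k) \<le> h * (g (u k) \<bullet> v k) + h * (\<delta> * M)"
        by (simp add: du algebra_simps)
    qed
    \<comment> \<open>The discrete energy, whose increments are bounded by the work of \<open>f\<close>.\<close>
    define E where "E = (\<lambda>k. moreau \<alpha> (u k) + K (u k))"
    have E_step: "E (Suc k) - E k \<le> f (real k * h) \<bullet> (u (Suc k) - u k) + h * (1 / T)"
      if "norm (u k) \<le> R" "k \<le> m" for k
    proof -
      have "\<mu> k \<bullet> v k \<le> 0"
        using yosida_inner_nonneg[OF \<alpha>, of "\<mu> k"] by (simp add: v_def inner_commute)
      then have "h * ((\<eta> k + g (u k) - f (real k * h)) \<bullet> v k) \<le> 0"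
        using h(1) by (simp add: \<mu>_def mult_nonneg_nonpos)
      moreover have "f (real k * h) \<bullet> (u (Suc k) - u k) = h * (f (real k * h) \<bullet> v k)"
        by (simp add: uSuc)
      moreover have "h * (h * M\<^sup>2 / \<alpha>) + h * (\<delta> * M) \<le> h * (1 / T)"
      proof -
        have "h * M\<^sup>2 / \<alpha> \<le> 1 / (2 * T)" using hM(3) T_pos by (simp add: field_simps)
        moreover have "\<delta> * M = 1 / (2 * T)" using M by (simp add: \<delta>_def)
        moreover have "1 / (2 * T) + 1 / (2 * T) = 1 / T" using T_pos by (simp add: field_simps)
        ultimately have "h * M\<^sup>2 / \<alpha> + \<delta> * M \<le> 1 / T" by linarith
        then show ?thesis using h(1) by (metis distrib_left less_imp_le mult_left_mono)
      qed
      ultimately show ?thesis using increment[OF that]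
        unfolding E_def inner_add_left inner_diff_left distrib_left right_diff_distrib by linarith
    qed
    \<comment> \<open>Each energy increment uses the bound of the preceding state only, so the bound propagates.\<close>
    have u_bound: "\<forall>k\<le>j. norm (u k) \<le> R" if "j \<le> m" for j
      using that
    proof (induction j)
      case 0
      then show ?case by (simp add: u0 R_def)
    next
      case (Suc j)
      then have IH: "\<And>k. k \<le> j \<Longrightarrow> norm (u k) \<le> R" by simp
      define \<rho> where "\<rho> = Max ((\<lambda>k. norm (u k)) ` {..Suc j})"
      have \<rho>: "norm (u k) \<le> \<rho>" if "k \<le> Suc j" for k using that by (auto simp: \<rho>_def)
      have "\<rho> \<in> (\<lambda>k. norm (u k)) ` {..Suc j}" unfolding \<rho>_def by (intro Max_in) auto
      then have \<rho>_ex: "\<exists>k\<le>Suc j. norm (u k) = \<rho>" by auto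
      have E_sum: "E i - E 0 \<le> (\<Sum>k<i. f (real k * h) \<bullet> (u (Suc k) - u k)) + real i * h * (1 / T)"
        if "i \<le> Suc j" for i
        using that
      proof (induction i)
        case (Suc i)
        then show ?case using E_step[of i] IH[of i] Suc.prems \<open>Suc j \<le> m\<close>
          by (simp add: algebra_simps add_divide_distrib)
      qed simp
      have "K (u i) \<le> C + c * \<rho>" if i: "i \<le> Suc j" for i
      proof -
        have "(\<Sum>k<i. f (real k * h) \<bullet> (u (Suc k) - u k)) \<le> F * \<rho> + F * norm u\<^sub>0 + (G T - G 0) * \<rho>"
          using summation_by_parts_bound[OF F h(1), of i u \<rho>] \<rho> le_T i Suc.prems u0 by simp
        moreover have "real i * h * (1 / T) \<le> 1"
          using le_T[of i] i Suc.prems T_pos by simp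
        moreover have "K (u i) \<le> E i" using moreau_nonneg[OF \<alpha>] by (simp add: E_def)
        moreover have "E 0 \<le> \<phi> u\<^sub>0 + K u\<^sub>0" using moreau_le[OF \<alpha>, of u\<^sub>0] by (simp add: E_def u0)
        ultimately show ?thesis using E_sum[OF i] by (simp add: C_def c_def algebra_simps)
      qed
      then have "\<rho> \<le> C + D" using norm_bound_from_coercivity[of c D "Suc j" u C \<rho>] D \<rho> \<rho>_ex by blast
      then show ?case using \<rho> unfolding R_def by (meson le_max_iff_disj order_trans)
    qed
    then have uR: "\<And>k. k \<le> m \<Longrightarrow> norm (u k) \<le> R" by blast
    \<comment> \<open>The inequality holds for the Moreau envelope up to the step errors, and the envelope is within
      \<open>\<epsilon> / 2\<close> of \<open>\<phi>\<close>.\<close>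
    have chain: "\<phi> (u j) - \<phi> (u i) - \<epsilon> \<le> (\<Sum>k=i..<j. h * (\<eta> k \<bullet> v k))" if ij: "i \<le> j" "j \<le> m" for i j
    proof -
      have sum: "moreau \<alpha> (u l) - moreau \<alpha> (u i)
          \<le> (\<Sum>k=i..<l. h * (\<eta> k \<bullet> v k)) + real (l - i) * h * (h * M\<^sup>2 / \<alpha>)" if "i \<le> l" "l \<le> m" for l
        using that
      proof (induction l rule: dec_induct)
        case (step l)
        then show ?case using increment(1)[of l] uR[of l] by (simp add: Suc_diff_le distrib_right add_divide_distrib)
      qed simp
      have "real (j - i) * h \<le> T"
        using le_T[of "j - i"] ij by simp
      then have "real (j - i) * h * (h * M\<^sup>2 / \<alpha>) \<le> T * (h * M\<^sup>2 / \<alpha>)"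
        using h(1) \<alpha> by (intro mult_right_mono) auto
      moreover have "\<phi> (u j) - moreau \<alpha> (u j) \<le> \<epsilon> / 2"
        using moreau_close[OF \<alpha>, of R B1 "u j"] B1 uR[OF ij(2)] \<alpha>B(1) by simp
      moreover have "moreau \<alpha> (u i) \<le> \<phi> (u i)" by (rule moreau_le[OF \<alpha>])
      ultimately show ?thesis using sum[OF ij] hM(4) by linarith
    qed
    have \<eta>_eq: "\<mu> k - g (u k) + f (real k * h) = \<eta> k" for k by (simp add: \<mu>_def)
    have "discrete_solution M \<epsilon> m u v \<mu>"
      unfolding discrete_solution_def h_def[symmetric] \<eta>_eq
    proof (intro conjI allI impI)
      fix k z assume k: "k \<le> m"
      show "norm (u k) \<le> M" "norm (v k) \<le> M" "norm (\<mu> k) \<le> M"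
        using uR[OF k] bounds[OF uR[OF k] k] M by auto
      show "\<phi> (\<mu> k) - v k \<bullet> (z - \<mu> k) - \<epsilon> \<le> \<phi> z"
        using yosida_approx_subgradient[OF \<alpha>, of M2 B2 "\<mu> k" z] B2 bounds(2)[OF uR[OF k] k] \<alpha>B(2) \<epsilon>
        by (simp add: v_def)
      show "\<phi> (u k) + \<eta> k \<bullet> (z - u k) - \<epsilon> \<le> \<phi> z"
        using yosida_approx_subgradient[OF \<alpha>, of R B1 "u k" z] B1 uR[OF k] \<alpha>B(1) \<epsilon>
        by (simp add: \<eta>_def)
    qed (use m h_le u0 uSuc chain in auto)
    then show ?thesis by blast
  qed
  with M(1) that show ?thesis by blast
qed

end

section \<open>Lipschitz functions of one real variable\<close>

text \<open>The Lebesgue differentiation theorem on the line, for right difference quotients.\<close>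

lemma right_derivative_of_integral:
  fixes X :: "real \<Rightarrow> 'a::euclidean_space"
  assumes x: "\<And>a b. a \<le> b \<Longrightarrow> (x has_integral X b - X a) {a..b}"
  obtains N where "negligible N"
    "\<And>t. t \<notin> N \<Longrightarrow> ((\<lambda>h. (X (t + h) - X t) /\<^sub>R h) \<longlongrightarrow> x t) (at_right 0)"
proof -
  have "x integrable_on cbox a b" for a b
  proof (cases "a \<le> b")
    case True
    then show ?thesis using x by (auto simp: integrable_on_def)
  qed (simp add: integrable_on_empty)
  then obtain N where N: "negligible N" "\<And>t e. t \<notin> N \<Longrightarrow> 0 < e \<Longrightarrow>
      \<exists>d>0. \<forall>h. 0 < h \<and> h < d \<longrightarrow> norm (integral (cbox t (t + h *\<^sub>R One)) x /\<^sub>R h ^ DIM(real) - x t) < e"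
    using integrable_ccontinuous_explicit[of x] by blast
  have "((\<lambda>h. (X (t + h) - X t) /\<^sub>R h) \<longlongrightarrow> x t) (at_right 0)" if t: "t \<notin> N" for t
  proof (rule tendstoI)
    fix e :: real assume "0 < e"
    then obtain d where d: "d > 0" "\<And>h. 0 < h \<Longrightarrow> h < d \<Longrightarrow> norm (integral {t..t + h} x /\<^sub>R h - x t) < e"
      using N(2)[OF t] by fastforce
    have "dist ((X (t + h) - X t) /\<^sub>R h) (x t) < e" if "h \<in> {0<..<d}" for h
    proof -
      have "integral {t..t + h} x = X (t + h) - X t" using that by (intro integral_unique x) simp
      then show ?thesis using d(2)[of h] that by (simp add: dist_norm)
    qed
    then show "\<forall>\<^sub>F h in at_right 0. dist ((X (t + h) - X t) /\<^sub>R h) (x t) < e"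
      by (rule eventually_mono[OF eventually_at_right_real[OF d(1)]])
  qed
  with N(1) that show ?thesis by blast
qed

text \<open>Adding a linear function turns \<open>X\<close> into a strictly increasing Lipschitz bijection \<open>F\<close>. It maps
  null sets to null sets, so the pullback of Lebesgue measure along \<open>F\<close> is absolutely continuous, and
  its Radon-Nikodym density is the derivative of \<open>F\<close>.\<close>

lemma lipschitz_density_real:
  fixes X :: "real \<Rightarrow> real"
  assumes X: "C-lipschitz_on UNIV X"
  obtains x where "x \<in> borel_measurable borel" "\<And>a b. a \<le> b \<Longrightarrow> (x has_integral X b - X a) {a..b}"
proof -
  have C: "0 \<le> C" using X by (rule lipschitz_on_nonneg)
  define F where "F = (\<lambda>t. X t + (C + 1) * t)"
  have increase: "t - s \<le> F t - F s" if "s \<le> t" for s t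
  proof -
    have "\<bar>X t - X s\<bar> \<le> C * (t - s)"
      using lipschitz_onD[OF X, of t s] that by (simp add: dist_real_def)
    then show ?thesis by (simp add: F_def algebra_simps abs_le_iff)
  qed
  have F_lip: "\<bar>F t - F s\<bar> \<le> (2 * C + 1) * \<bar>t - s\<bar>" for s t
  proof -
    have "\<bar>F t - F s\<bar> \<le> \<bar>X t - X s\<bar> + \<bar>(C + 1) * (t - s)\<bar>"
      by (simp add: F_def algebra_simps abs_le_iff) linarith
    also have "\<bar>X t - X s\<bar> \<le> C * \<bar>t - s\<bar>"
      using lipschitz_onD[OF X, of t s] by (simp add: dist_real_def)
    also have "\<bar>(C + 1) * (t - s)\<bar> = (C + 1) * \<bar>t - s\<bar>" using C by (simp add: abs_mult)
    finally show ?thesis by (simp add: algebra_simps)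
  qed
  have less_iff: "F s < F t \<longleftrightarrow> s < t" for s t
  proof (cases "s < t")
    case True
    then show ?thesis using increase[of s t] by linarith
  next
    case False
    then show ?thesis using increase[of t s] by linarith
  qed
  then have inj: "inj F" by (metis injI less_irrefl linorder_neqE_linordered_idom)
  have "continuous_on S X" for S
    using continuous_on_subset[OF lipschitz_on_continuous_on[OF X] subset_UNIV] .
  then have contF: "continuous_on S F" for S unfolding F_def by (intro continuous_intros)
  have surj: "\<exists>t. F t = y" for y
  proof -
    define b where "b = \<bar>y - F 0\<bar>"
    have "F (- b) \<le> y" "y \<le> F b"
      using increase[of "- b" 0] increase[of 0 b] by (auto simp: b_def abs_if split: if_splits)
    then show ?thesis using IVT'[of F "- b" y b] contF by (auto simp: b_def)
  qed
  define H where "H = inv F"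
  have FH: "F (H y) = y" for y unfolding H_def by (metis f_inv_into_f rangeI surj)
  have HF: "H (F t) = t" for t unfolding H_def using inj by simp
  have "mono H" by (rule monoI) (metis FH less_iff not_le)
  then have H_meas[measurable]: "H \<in> borel_measurable borel" by (rule borel_measurable_mono)
  have vimage: "H -` A = F ` A" for A using FH HF by (auto simp: image_iff) (metis)
  define \<nu> where "\<nu> = distr lborel borel H"
  have em: "emeasure \<nu> A = emeasure lborel (F ` A)" if "A \<in> sets borel" for A
    using that by (simp add: \<nu>_def emeasure_distr vimage)
  have ac: "absolutely_continuous lborel \<nu>"
    unfolding absolutely_continuous_def
  proof
    fix A :: "real set" assume A: "A \<in> null_sets lborel"
    then have A': "A \<in> sets borel" by auto
    have "negligible A" using A by (simp add: negligible_iff_null_sets null_sets_completionI)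
    then have "negligible (F ` A)"
      by (rule negligible_locally_Lipschitz_image[OF order_refl])
         (use F_lip in \<open>auto intro!: exI[of _ UNIV] exI[of _ "2 * C + 1"] simp: abs_minus_commute\<close>)
    moreover have "F ` A \<in> sets lborel"
      using measurable_sets[OF H_meas, of A] A' by (simp add: vimage)
    ultimately have "F ` A \<in> null_sets lborel"
      using null_sets_completion_iff negligible_iff_null_sets by blast
    then show "A \<in> null_sets \<nu>" using em[OF A'] A' by (auto simp: null_sets_def \<nu>_def)
  qed
  obtain d where d[measurable]: "d \<in> borel_measurable lborel" and d_eq: "density lborel d = \<nu>"
    using sigma_finite_measure.Radon_Nikodym[OF lborel.sigma_finite_measure_axioms ac] by (auto simp: \<nu>_def)
  define x where "x = (\<lambda>t. enn2real (d t) - (C + 1))"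
  have "(x has_integral X b - X a) {a..b}" if ab: "a \<le> b" for a b
  proof -
    have Fab: "F a \<le> F b" using increase[OF ab] ab by linarith
    have img: "F ` {a..b} = {F a..F b}"
    proof safe
      fix t assume "t \<in> {a..b}" then show "F t \<in> {F a..F b}" using less_iff by (auto simp: not_less[symmetric])
    next
      fix y assume "y \<in> {F a..F b}"
      then have "H y \<in> {a..b}" using less_iff[of "H y" a] less_iff[of b "H y"] by (auto simp: FH)
      then show "y \<in> F ` {a..b}" using FH by (metis imageI)
    qed
    have int_d: "(\<integral>\<^sup>+t. d t * indicator {a..b} t \<partial>lborel) = ennreal (F b - F a)"
    proof -
      have "(\<integral>\<^sup>+t. d t * indicator {a..b} t \<partial>lborel) = emeasure (density lborel d) {a..b}"
        by (simp add: emeasure_density)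
      also have "\<dots> = emeasure lborel {F a..F b}" by (simp add: d_eq em img)
      finally show ?thesis using Fab by simp
    qed
    have fin: "AE t in lborel. d t * indicator {a..b} t \<noteq> \<infinity>"
      by (rule nn_integral_PInf_AE) (use int_d in auto)
    have "(\<integral>\<^sup>+t. ennreal (enn2real (d t) * indicator {a..b} t) \<partial>lborel)
        = (\<integral>\<^sup>+t. d t * indicator {a..b} t \<partial>lborel)"
      using fin by (intro nn_integral_cong_AE) (auto split: split_indicator simp: less_top elim!: eventually_mono)
    then have "((\<lambda>t. enn2real (d t) * indicator {a..b} t) has_integral (F b - F a)) UNIV"
      using int_d Fab by (intro nn_integral_has_integral) auto
    then have "((\<lambda>t. if t \<in> {a..b} then enn2real (d t) else 0) has_integral (F b - F a)) UNIV"
      by (rule has_integral_eq[rotated]) auto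
    then have "((\<lambda>t. enn2real (d t)) has_integral (F b - F a)) {a..b}"
      by (simp only: has_integral_restrict_UNIV)
    from has_integral_diff[OF this has_integral_const_real[of "C + 1" a b]] show ?thesis
      unfolding x_def using ab by (simp add: F_def algebra_simps)
  qed
  moreover have "x \<in> borel_measurable borel" using d unfolding x_def by simp
  ultimately show ?thesis using that by blast
qed

proposition lipschitz_derivative:
  fixes X :: "real \<Rightarrow> 'a::euclidean_space"
  assumes X: "C-lipschitz_on UNIV X"
  obtains x N where "x \<in> borel_measurable borel" "\<And>t. norm (x t) \<le> C"
    "\<And>a b. a \<le> b \<Longrightarrow> (x has_integral X b - X a) {a..b}" "negligible N"
    "\<And>t. t \<notin> N \<Longrightarrow> ((\<lambda>h. (X (t + h) - X t) /\<^sub>R h) \<longlongrightarrow> x t) (at_right 0)"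
proof -
  have C: "0 \<le> C" using X by (rule lipschitz_on_nonneg)
  have "\<exists>y. y \<in> borel_measurable borel \<and> (\<forall>a b. a \<le> b \<longrightarrow> (y has_integral X b \<bullet> i - X a \<bullet> i) {a..b})"
    if i: "i \<in> Basis" for i
  proof -
    have "C-lipschitz_on UNIV (\<lambda>t. X t \<bullet> i)"
    proof (rule lipschitz_onI[OF _ C])
      fix s t
      have "\<bar>(X s - X t) \<bullet> i\<bar> \<le> norm (X s - X t)" by (rule Basis_le_norm[OF i])
      then show "dist (X s \<bullet> i) (X t \<bullet> i) \<le> C * dist s t"
        using lipschitz_onD[OF X, of s t] by (simp add: dist_norm inner_diff_left)
    qed
    then show ?thesis using lipschitz_density_real by metis
  qed
  then obtain y where y: "\<And>i. i \<in> Basis \<Longrightarrow> y i \<in> borel_measurable borel"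
      "\<And>i a b. i \<in> Basis \<Longrightarrow> a \<le> b \<Longrightarrow> (y i has_integral X b \<bullet> i - X a \<bullet> i) {a..b}"
    by metis
  define z where "z = (\<lambda>t. \<Sum>i\<in>Basis. y i t *\<^sub>R i)"
  have z_meas: "z \<in> borel_measurable borel" unfolding z_def using y(1) by (intro borel_measurable_sum) simp
  have z_int: "(z has_integral X b - X a) {a..b}" if "a \<le> b" for a b
  proof -
    have "(z has_integral (\<Sum>i\<in>Basis. (X b \<bullet> i - X a \<bullet> i) *\<^sub>R i)) {a..b}"
      unfolding z_def using y(2)[OF _ that] by (intro has_integral_sum has_integral_scaleR_left) auto
    moreover have "(\<Sum>i\<in>Basis. (X b \<bullet> i - X a \<bullet> i) *\<^sub>R i) = X b - X a"
      using euclidean_representation[of "X b - X a"] by (simp add: inner_diff_left)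
    ultimately show ?thesis by simp
  qed
  obtain N where N: "negligible N"
      "\<And>t. t \<notin> N \<Longrightarrow> ((\<lambda>h. (X (t + h) - X t) /\<^sub>R h) \<longlongrightarrow> z t) (at_right 0)"
    using right_derivative_of_integral[OF z_int] by blast
  have bound: "norm (z t) \<le> C" if "t \<notin> N" for t
  proof (rule tendsto_upperbound[OF tendsto_norm[OF N(2)[OF that]]])
    have "norm ((X (t + h) - X t) /\<^sub>R h) \<le> C" if "0 < h" for h
      using lipschitz_onD[OF X, of "t + h" t] that by (simp add: dist_norm divide_simps mult.commute)
    then show "\<forall>\<^sub>F h in at_right 0. norm ((X (t + h) - X t) /\<^sub>R h) \<le> C"
      by (auto intro!: eventually_mono[OF eventually_at_right_less])
  qed simp
  \<comment> \<open>On the exceptional set the density is reset to 0, so that the bound holds everywhere.\<close>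
  define x where "x = (\<lambda>t. if norm (z t) \<le> C then z t else 0)"
  have eq: "x t = z t" if "t \<notin> N" for t using bound[OF that] by (simp add: x_def)
  show ?thesis
  proof (rule that[OF _ _ _ N(1)])
    show "x \<in> borel_measurable borel" unfolding x_def using z_meas by measurable
    show "norm (x t) \<le> C" for t using C by (simp add: x_def)
    show "(x has_integral X b - X a) {a..b}" if "a \<le> b" for a b
      using has_integral_spike[OF N(1) _ z_int[OF that], of x] eq by auto
  qed (use N(2) eq in auto)
qed

lemma lipschitz_on_clamp:
  fixes X :: "real \<Rightarrow> 'a::metric_space"
  assumes X: "C-lipschitz_on {0..T} X" and "0 \<le> T"
  shows "C-lipschitz_on UNIV (\<lambda>t. X (max 0 (min T t)))"
proof (rule lipschitz_onI[OF _ lipschitz_on_nonneg[OF X]])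
  fix s t :: real
  have "dist (X (max 0 (min T s))) (X (max 0 (min T t))) \<le> C * dist (max 0 (min T s)) (max 0 (min T t))"
    using assms by (intro lipschitz_onD[OF X]) auto
  also have "\<dots> \<le> C * dist s t"
    using lipschitz_on_nonneg[OF X] by (intro mult_left_mono) (auto simp: dist_real_def)
  finally show "dist (X (max 0 (min T s))) (X (max 0 (min T t))) \<le> C * dist s t" .
qed

corollary lipschitz_derivative_on:
  fixes X :: "real \<Rightarrow> 'a::euclidean_space"
  assumes X: "C-lipschitz_on {0..T} X" and T: "0 < T"
  obtains x N where "x \<in> borel_measurable borel" "\<And>t. norm (x t) \<le> C"
    "\<And>a b. 0 \<le> a \<Longrightarrow> a \<le> b \<Longrightarrow> b \<le> T \<Longrightarrow> (x has_integral X b - X a) {a..b}" "negligible N"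
    "\<And>t. t \<notin> N \<Longrightarrow> 0 \<le> t \<Longrightarrow> t < T \<Longrightarrow> ((\<lambda>h. (X (t + h) - X t) /\<^sub>R h) \<longlongrightarrow> x t) (at_right 0)"
proof -
  define Y where "Y = (\<lambda>t. X (max 0 (min T t)))"
  have Y: "Y t = X t" if "0 \<le> t" "t \<le> T" for t using that by (simp add: Y_def)
  have "C-lipschitz_on UNIV Y" unfolding Y_def using lipschitz_on_clamp[OF X] T by simp
  then obtain x N where x: "x \<in> borel_measurable borel" "\<And>t. norm (x t) \<le> C"
    "\<And>a b. a \<le> b \<Longrightarrow> (x has_integral Y b - Y a) {a..b}" "negligible N"
    "\<And>t. t \<notin> N \<Longrightarrow> ((\<lambda>h. (Y (t + h) - Y t) /\<^sub>R h) \<longlongrightarrow> x t) (at_right 0)"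
    by (rule lipschitz_derivative) blast
  show ?thesis
  proof (rule that[OF x(1,2) _ x(4)])
    show "(x has_integral X b - X a) {a..b}" if "0 \<le> a" "a \<le> b" "b \<le> T" for a b
      using x(3)[OF that(2)] that Y[of a] Y[of b] by simp
    show "((\<lambda>h. (X (t + h) - X t) /\<^sub>R h) \<longlongrightarrow> x t) (at_right 0)" if "t \<notin> N" "0 \<le> t" "t < T" for t
    proof (rule Lim_transform_eventually[OF x(5)[OF that(1)]])
      show "\<forall>\<^sub>F h in at_right 0. (Y (t + h) - Y t) /\<^sub>R h = (X (t + h) - X t) /\<^sub>R h"
        by (rule eventually_mono[OF eventually_at_right_real[of 0 "T - t"]]) (use that Y in auto)
    qed
  qed
qed

lemma bounded_measurable_L_infty:
  fixes x :: "real \<Rightarrow> 'a::euclidean_space"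
  assumes m: "x \<in> borel_measurable (lebesgue_on {0<..<T})"
    and C: "\<And>t. 0 < t \<Longrightarrow> t < T \<Longrightarrow> norm (x t) \<le> C"
  shows "x \<in> L_infty T" and "x \<in> L_one T"
proof -
  show "x \<in> L_infty T"
    unfolding L_infty_def using m C by (auto intro!: exI[of _ C] AE_I2 simp: space_restrict_space)
  have "integrable (lebesgue_on {0<..<T}) x"
  proof (rule measurable_bounded_by_integrable_imp_lebesgue_integrable[OF m, where g = "\<lambda>_. C"])
    show "integrable (lebesgue_on {0<..<T}) (\<lambda>_. C)"
      by (intro finite_measure.integrable_const finite_measureI)
        (use emeasure_bounded_finite[of "{0<..<T}"] in
          \<open>simp add: emeasure_restrict_space space_restrict_space\<close>)
  qed (use C in auto)
  then show "x \<in> L_one T"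
    unfolding L_one_def by (simp add: set_integrable_def integrable_restrict_space)
qed

lemma continuous_on_Icc_bounded:
  fixes h :: "real \<Rightarrow> 'a::real_normed_vector"
  assumes "continuous_on {a..b} h"
  obtains B where "\<And>t. a \<le> t \<Longrightarrow> t \<le> b \<Longrightarrow> norm (h t) \<le> B"
proof -
  obtain B where "\<forall>y\<in>h ` {a..b}. norm y \<le> B"
    using compact_imp_bounded[OF compact_continuous_image[OF assms compact_Icc]] bounded_iff by metis
  then show ?thesis using that[of B] by simp
qed

lemma borel_measurable_lebesgue_on:
  fixes x :: "real \<Rightarrow> 'a::euclidean_space"
  shows "x \<in> borel_measurable borel \<Longrightarrow> x \<in> borel_measurable (lebesgue_on S)"
  by (intro measurable_restrict_space1 measurable_completion) simp

text \<open>The weak derivative of a Lipschitz function is its classical one: for a test function \<open>\<psi>\<close>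
  the product \<open>\<psi> U\<close> is again Lipschitz, so it is the integral of its derivative.\<close>

lemma lipschitz_has_weak_derivative:
  fixes U :: "real \<Rightarrow> 'a::euclidean_space"
  assumes U: "C-lipschitz_on {0..T} U" and T: "0 < T"
    and x: "x \<in> borel_measurable borel" "\<And>t. norm (x t) \<le> C" and N: "negligible N"
    and deriv: "\<And>t. t \<notin> N \<Longrightarrow> 0 \<le> t \<Longrightarrow> t < T \<Longrightarrow> ((\<lambda>h. (U (t + h) - U t) /\<^sub>R h) \<longlongrightarrow> x t) (at_right 0)"
  shows "has_weak_derivative U x T" and "U \<in> L_infty T" and "x \<in> L_infty T"
proof -
  have U_cont: "continuous_on {0..T} U" by (rule lipschitz_on_continuous_on[OF U])
  obtain B where B: "\<And>t. 0 \<le> t \<Longrightarrow> t \<le> T \<Longrightarrow> norm (U t) \<le> B"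
    using continuous_on_Icc_bounded[OF U_cont] by blast
  have U_meas: "U \<in> borel_measurable (lebesgue_on {0<..<T})"
    by (rule continuous_imp_measurable_on_sets_lebesgue[OF continuous_on_subset[OF U_cont]]) auto
  have U_L: "U \<in> L_infty T" "U \<in> L_one T"
    using bounded_measurable_L_infty[OF U_meas, of B] B by auto
  have x_L: "x \<in> L_infty T" "x \<in> L_one T"
    using bounded_measurable_L_infty[OF borel_measurable_lebesgue_on[OF x(1)]] x(2) by blast+
  show "U \<in> L_infty T" "x \<in> L_infty T" by (fact U_L x_L)+
  have "(LINT t:{0<..<T}|lebesgue. \<psi>' t *\<^sub>R U t) = - (LINT t:{0<..<T}|lebesgue. \<psi> t *\<^sub>R x t)"
    if \<psi>: "\<And>t. (\<psi> has_real_derivative \<psi>' t) (at t)" "continuous_on UNIV \<psi>'"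
      and K: "compact K" "K \<subseteq> {0<..<T}" "\<And>t. t \<notin> K \<Longrightarrow> \<psi> t = 0" for \<psi> \<psi>' :: "real \<Rightarrow> real" and K
  proof -
    have \<psi>_cont: "continuous_on S \<psi>" for S
      using \<psi>(1) by (meson DERIV_isCont continuous_at_imp_continuous_on)
    have \<psi>'_cont: "continuous_on S \<psi>'" for S using \<psi>(2) continuous_on_subset by blast
    obtain B1 where B1: "\<And>t. 0 \<le> t \<Longrightarrow> t \<le> T \<Longrightarrow> \<bar>\<psi> t\<bar> \<le> B1"
      using continuous_on_Icc_bounded[OF \<psi>_cont] unfolding real_norm_def by blast
    obtain B2 where B2: "\<And>t. 0 \<le> t \<Longrightarrow> t \<le> T \<Longrightarrow> \<bar>\<psi>' t\<bar> \<le> B2"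
      using continuous_on_Icc_bounded[OF \<psi>'_cont] unfolding real_norm_def by blast
    have pos: "0 \<le> B" "0 \<le> B1" "0 \<le> B2" "0 \<le> C"
      using B[of 0] B1[of 0] B2[of 0] T lipschitz_on_nonneg[OF U] by (auto intro: order_trans[OF norm_ge_zero] order_trans[OF abs_ge_zero])
    have \<psi>_lip: "\<bar>\<psi> s - \<psi> t\<bar> \<le> B2 * \<bar>s - t\<bar>" if "s \<in> {0..T}" "t \<in> {0..T}" for s t
      using field_differentiable_bound[of "{0..T}" \<psi> \<psi>' B2 s t] B2 \<psi>(1) that
      by (auto intro: has_field_derivative_at_within)
    define P where "P = (\<lambda>t. \<psi> t *\<^sub>R U t)"
    have "(B1 * C + B2 * B)-lipschitz_on {0..T} P"
    proof (rule lipschitz_onI)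
      fix s t assume st: "s \<in> {0..T}" "t \<in> {0..T}"
      have "P s - P t = \<psi> s *\<^sub>R (U s - U t) + (\<psi> s - \<psi> t) *\<^sub>R U t"
        by (simp add: P_def algebra_simps)
      then have "norm (P s - P t) \<le> \<bar>\<psi> s\<bar> * norm (U s - U t) + \<bar>\<psi> s - \<psi> t\<bar> * norm (U t)"
        using norm_triangle_ineq by (metis norm_scaleR real_norm_def)
      also have "\<dots> \<le> B1 * (C * \<bar>s - t\<bar>) + (B2 * \<bar>s - t\<bar>) * B"
        using st B1[of s] B[of t] \<psi>_lip[OF st] lipschitz_onD[OF U st] pos
        by (intro add_mono mult_mono) (auto simp: dist_norm)
      finally show "dist (P s) (P t) \<le> (B1 * C + B2 * B) * dist s t"
        by (simp add: dist_norm algebra_simps)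
    qed (use pos in simp)
    then obtain y N' where y: "\<And>a b. 0 \<le> a \<Longrightarrow> a \<le> b \<Longrightarrow> b \<le> T \<Longrightarrow> (y has_integral P b - P a) {a..b}"
        "negligible N'"
        "\<And>t. t \<notin> N' \<Longrightarrow> 0 \<le> t \<Longrightarrow> t < T \<Longrightarrow> ((\<lambda>h. (P (t + h) - P t) /\<^sub>R h) \<longlongrightarrow> y t) (at_right 0)"
      by (rule lipschitz_derivative_on[OF _ T]) blast
    have y_eq: "y t = \<psi>' t *\<^sub>R U t + \<psi> t *\<^sub>R x t" if t: "t \<notin> N \<union> N'" "0 \<le> t" "t < T" for t
    proof (rule tendsto_unique[OF _ y(3)])
      have shift: "((\<lambda>h. t + h) \<longlongrightarrow> t) (at_right 0)" by real_asymp
      have "((\<lambda>h. \<psi> (t + h)) \<longlongrightarrow> \<psi> t) (at_right 0)"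
        by (rule isCont_tendsto_compose[OF _ shift]) (use \<psi>(1) DERIV_isCont in blast)
      moreover have "((\<lambda>h. (\<psi> (t + h) - \<psi> t) / h) \<longlongrightarrow> \<psi>' t) (at_right 0)"
        using \<psi>(1)[of t] unfolding DERIV_def by (rule tendsto_mono[rotated]) (simp add: at_le)
      ultimately have lim: "((\<lambda>h. \<psi> (t + h) *\<^sub>R ((U (t + h) - U t) /\<^sub>R h) + ((\<psi> (t + h) - \<psi> t) / h) *\<^sub>R U t)
          \<longlongrightarrow> \<psi> t *\<^sub>R x t + \<psi>' t *\<^sub>R U t) (at_right 0)"
        using deriv t by (intro tendsto_intros) auto
      have "((\<lambda>h. (P (t + h) - P t) /\<^sub>R h) \<longlongrightarrow> \<psi> t *\<^sub>R x t + \<psi>' t *\<^sub>R U t) (at_right 0)"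
        by (rule Lim_transform_eventually[OF lim], rule eventually_mono[OF eventually_at_right_less])
          (simp add: P_def algebra_simps divide_inverse)
      then show "((\<lambda>h. (P (t + h) - P t) /\<^sub>R h) \<longlongrightarrow> \<psi>' t *\<^sub>R U t + \<psi> t *\<^sub>R x t) (at_right 0)"
        by (simp add: add.commute)
    qed (use t in auto)
    have "T \<notin> K" "0 \<notin> K" using K(2) by auto
    then have "P T = 0" "P 0 = 0" using K(3) by (auto simp: P_def)
    then have "(y has_integral 0) {0..T}" using y(1)[of 0 T] T by simp
    then have "((\<lambda>t. \<psi>' t *\<^sub>R U t + \<psi> t *\<^sub>R x t) has_integral 0) {0..T}"
      by (rule has_integral_spike[rotated 2, where S = "N \<union> N' \<union> {T}"])
        (use N y(2) y_eq in \<open>auto simp: negligible_Un_eq\<close>)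
    then have 0: "integral {0<..<T} (\<lambda>t. \<psi>' t *\<^sub>R U t + \<psi> t *\<^sub>R x t) = 0"
      by (metis integral_open_interval_real integral_unique)
    have product: "(\<lambda>t. \<theta> t *\<^sub>R z t) absolutely_integrable_on {0<..<T}"
      if "continuous_on {0..T} \<theta>" "z \<in> L_one T" for \<theta> :: "real \<Rightarrow> real" and z :: "real \<Rightarrow> 'a"
    proof (rule absolutely_integrable_bounded_measurable_product[where h = scaleR])
      show "\<theta> \<in> borel_measurable (lebesgue_on {0<..<T})"
        by (rule continuous_imp_measurable_on_sets_lebesgue[OF continuous_on_subset[OF that(1)]]) auto
      show "bounded (\<theta> ` {0<..<T})"
        using compact_imp_bounded[OF compact_continuous_image[OF that(1) compact_Icc]]
        by (rule bounded_subset) auto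
    qed (use that(2) in \<open>auto simp: L_one_def bilinear_conv_bounded_bilinear bounded_bilinear_scaleR\<close>)
    note i1 = product[OF \<psi>'_cont U_L(2)] and i2 = product[OF \<psi>_cont x_L(2)]
    have "(LINT t:{0<..<T}|lebesgue. \<psi>' t *\<^sub>R U t) + (LINT t:{0<..<T}|lebesgue. \<psi> t *\<^sub>R x t) = 0"
      using 0 set_lebesgue_integral_eq_integral[OF i1] set_lebesgue_integral_eq_integral[OF i2]
      by (simp add: integral_add)
    then show ?thesis by (simp add: eq_neg_iff_add_eq_0)
  qed
  then show "has_weak_derivative U x T"
    unfolding has_weak_derivative_def using U_L x_L by blast
qed

section \<open>Functions with an integrable weak derivative\<close>

text \<open>Almost every point is a Lebesgue point in the strong sense, by differentiating the integrals of
  \<open>norm (f r - q)\<close> for all \<open>q\<close> in a countable dense set.\<close>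

lemma lebesgue_points:
  fixes f :: "real \<Rightarrow> 'a::euclidean_space"
  assumes f: "\<And>a b. f absolutely_integrable_on {a..b}"
  obtains N where "negligible N"
    "\<And>t. t \<notin> N \<Longrightarrow> ((\<lambda>h. (1 / h) * integral {t..t + h} (\<lambda>r. norm (f r - f t))) \<longlongrightarrow> 0) (at_right 0)"
proof -
  obtain D :: "'a set" where D: "countable D" "\<And>X. open X \<Longrightarrow> X \<noteq> {} \<Longrightarrow> \<exists>d\<in>D. d \<in> X"
    using countable_dense_exists by blast
  have norm_int: "(\<lambda>r. norm (f r - q)) integrable_on {a..b}" for q a b
  proof -
    have "(\<lambda>r. f r - q) absolutely_integrable_on {a..b}"
      using absolutely_integrable_on_const[of "{a..b}" q] f[of a b] by (intro set_integral_diff) auto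
    then show ?thesis by (simp add: absolutely_integrable_on_def)
  qed
  have "\<exists>N. negligible N \<and> (\<forall>t. t \<notin> N \<longrightarrow>
      ((\<lambda>h. (1 / h) * integral {t..t + h} (\<lambda>r. norm (f r - q))) \<longlongrightarrow> norm (f t - q)) (at_right 0))" for q
  proof -
    define X where "X = (\<lambda>t. if 0 \<le> t then integral {0..t} (\<lambda>r. norm (f r - q))
      else - integral {t..0} (\<lambda>r. norm (f r - q)))"
    have "((\<lambda>r. norm (f r - q)) has_integral X b - X a) {a..b}" if "a \<le> b" for a b
    proof -
      have "integral {a..b} (\<lambda>r. norm (f r - q)) = X b - X a"
        using that Henstock_Kurzweil_Integration.integral_combine[OF _ _ norm_int, of 0 a b q]
          Henstock_Kurzweil_Integration.integral_combine[OF _ _ norm_int, of a 0 b q]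
          Henstock_Kurzweil_Integration.integral_combine[OF _ _ norm_int, of a b 0 q]
        by (cases "0 \<le> a"; cases "0 \<le> b") (simp_all add: X_def)
      then show ?thesis using norm_int by (metis integrable_integral)
    qed
    from right_derivative_of_integral[OF this] obtain N where N: "negligible N"
      "\<And>t. t \<notin> N \<Longrightarrow> ((\<lambda>h. (X (t + h) - X t) /\<^sub>R h) \<longlongrightarrow> norm (f t - q)) (at_right 0)" by blast
    have "((\<lambda>h. (1 / h) * integral {t..t + h} (\<lambda>r. norm (f r - q))) \<longlongrightarrow> norm (f t - q)) (at_right 0)"
      if "t \<notin> N" for t
    proof (rule Lim_transform_eventually[OF N(2)[OF that]],
        rule eventually_mono[OF eventually_at_right_less])
      fix h :: real assume "0 < h"
      then have "integral {t..t + h} (\<lambda>r. norm (f r - q)) = X (t + h) - X t"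
        using \<open>\<And>a b. a \<le> b \<Longrightarrow> ((\<lambda>r. norm (f r - q)) has_integral X b - X a) {a..b}\<close>
        by (intro integral_unique) auto
      then show "(X (t + h) - X t) /\<^sub>R h = (1 / h) * integral {t..t + h} (\<lambda>r. norm (f r - q))"
        by (simp add: divide_inverse)
    qed
    with N(1) show ?thesis by blast
  qed
  then have "\<exists>N. \<forall>q. negligible (N q) \<and> (\<forall>t. t \<notin> N q \<longrightarrow>
      ((\<lambda>h. (1 / h) * integral {t..t + h} (\<lambda>r. norm (f r - q))) \<longlongrightarrow> norm (f t - q)) (at_right 0))"
    by (intro choice allI)
  then obtain N where N: "\<And>q. negligible (N q)" "\<And>q t. t \<notin> N q \<Longrightarrow>
      ((\<lambda>h. (1 / h) * integral {t..t + h} (\<lambda>r. norm (f r - q))) \<longlongrightarrow> norm (f t - q)) (at_right 0)"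
    by blast
  show ?thesis
  proof (rule that)
    show "negligible (\<Union>(N ` D))" using D(1) N(1) by (intro negligible_countable_Union) auto
    fix t assume t: "t \<notin> \<Union>(N ` D)"
    show "((\<lambda>h. (1 / h) * integral {t..t + h} (\<lambda>r. norm (f r - f t))) \<longlongrightarrow> 0) (at_right 0)"
    proof (rule tendstoI)
      fix e :: real assume "0 < e"
      then obtain q where q: "q \<in> D" "q \<in> ball (f t) (e / 3)"
        using D(2)[of "ball (f t) (e / 3)"] by auto
      have q_le: "norm (f t - q) < e / 3" using q(2) by (simp add: dist_norm)
      have "\<forall>\<^sub>F h in at_right 0. dist ((1 / h) * integral {t..t + h} (\<lambda>r. norm (f r - q))) (norm (f t - q)) < e / 3"
        using N(2)[of t q] t q(1) \<open>0 < e\<close> by (intro tendstoD) auto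
      then show "\<forall>\<^sub>F h in at_right 0. dist ((1 / h) * integral {t..t + h} (\<lambda>r. norm (f r - f t))) 0 < e"
      proof (rule eventually_elim2[OF _ eventually_at_right_less])
        fix h :: real
        assume h: "dist ((1 / h) * integral {t..t + h} (\<lambda>r. norm (f r - q))) (norm (f t - q)) < e / 3" "0 < h"
        have "integral {t..t + h} (\<lambda>r. norm (f r - f t))
            \<le> integral {t..t + h} (\<lambda>r. norm (f r - q) + norm (f t - q))"
        proof (rule integral_le)
          show "norm (f r - f t) \<le> norm (f r - q) + norm (f t - q)" for r
            using norm_triangle_ineq4[of "f r - q" "f t - q"] by simp
        qed (intro norm_int integrable_add integrable_const_ivl)+
        also have "\<dots> = integral {t..t + h} (\<lambda>r. norm (f r - q)) + h * norm (f t - q)"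
          using h(2) by (subst integral_add) (auto intro: norm_int)
        finally have "(1 / h) * integral {t..t + h} (\<lambda>r. norm (f r - f t))
            \<le> (1 / h) * integral {t..t + h} (\<lambda>r. norm (f r - q)) + norm (f t - q)"
          using h(2) by (simp add: field_simps)
        moreover have "0 \<le> (1 / h) * integral {t..t + h} (\<lambda>r. norm (f r - f t))"
          using h(2) by (intro mult_nonneg_nonneg integral_nonneg norm_int) auto
        ultimately show "dist ((1 / h) * integral {t..t + h} (\<lambda>r. norm (f r - f t))) 0 < e"
          using h(1) q_le unfolding dist_real_def by linarith
      qed
    qed
  qed
qed

text \<open>A \<open>C\<^sup>1\<close> step from 0 to 1 on the unit interval: the quadratic spline whose derivative is the tent
  of height 2.\<close>

definition smooth_step :: "real \<Rightarrow> real" where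
  "smooth_step x = 2 * (max 0 x)\<^sup>2 - 4 * (max 0 (x - 1 / 2))\<^sup>2 + 2 * (max 0 (x - 1))\<^sup>2"

definition tent :: "real \<Rightarrow> real" where
  "tent x = 4 * max 0 x - 8 * max 0 (x - 1 / 2) + 4 * max 0 (x - 1)"

lemma pos_part_square_deriv: "((\<lambda>x::real. (max 0 x)\<^sup>2) has_real_derivative 2 * max 0 x) (at x)"
proof -
  consider "x < 0" | "x > 0" | "x = 0" by linarith
  then show ?thesis
  proof cases
    case 1
    have "((\<lambda>_. 0) has_real_derivative 0) (at x)" by simp
    then have "((\<lambda>x::real. (max 0 x)\<^sup>2) has_real_derivative 0) (at x)"
      by (rule has_field_derivative_transform_within_open[where S = "{..<0}"]) (use 1 in auto)
    then show ?thesis using 1 by simp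
  next
    case 2
    have "((\<lambda>x. x\<^sup>2) has_real_derivative 2 * x) (at x)" by (auto intro!: derivative_eq_intros)
    then have "((\<lambda>x::real. (max 0 x)\<^sup>2) has_real_derivative 2 * x) (at x)"
      by (rule has_field_derivative_transform_within_open[where S = "{0<..}"]) (use 2 in auto)
    then show ?thesis using 2 by simp
  next
    case 3
    have "((\<lambda>h. (max 0 h)\<^sup>2 / h) \<longlongrightarrow> 0) (at (0::real))"
    proof (rule Lim_null_comparison)
      show "((\<lambda>h::real. \<bar>h\<bar>) \<longlongrightarrow> 0) (at 0)" by (auto intro!: tendsto_eq_intros)
      have "norm ((max 0 h)\<^sup>2 / h) \<le> \<bar>h\<bar>" for h :: real
        by (cases "h > 0") (auto simp: power2_eq_square max_def)
      then show "\<forall>\<^sub>F h in at 0. norm ((max 0 h)\<^sup>2 / h) \<le> \<bar>h\<bar>" by simp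
    qed
    then show ?thesis using 3 by (simp add: DERIV_def)
  qed
qed

lemma smooth_step_deriv: "(smooth_step has_real_derivative tent x) (at x)"
proof -
  note d = pos_part_square_deriv
  have shift: "((\<lambda>x. (max 0 (x - c))\<^sup>2) has_real_derivative 2 * max 0 (x - c)) (at x)" for c :: real
  proof -
    have "((\<lambda>x. x - c) has_real_derivative 1) (at x)" by (auto intro!: derivative_eq_intros)
    from DERIV_chain2[where f = "\<lambda>x. (max 0 x)\<^sup>2", OF d[of "x - c"] this] show ?thesis by simp
  qed
  show ?thesis
    unfolding smooth_step_def[abs_def] tent_def
    by (rule derivative_eq_intros d shift refl | simp)+
qed

lemma smooth_step_le_0: "x \<le> 0 \<Longrightarrow> smooth_step x = 0"
  by (simp add: smooth_step_def)

lemma smooth_step_ge_1: "1 \<le> x \<Longrightarrow> smooth_step x = 1"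
  by (simp add: smooth_step_def max_def power2_eq_square algebra_simps)

lemma tent_bounds: "0 \<le> tent x" "tent x \<le> 2"
  by (auto simp: tent_def max_def)

lemma tent_outside: "x \<le> 0 \<or> 1 \<le> x \<Longrightarrow> tent x = 0"
  by (auto simp: tent_def max_def)

lemma tent_continuous: "continuous_on S tent"
  unfolding tent_def[abs_def] by (intro continuous_intros)

lemma smooth_step_bounds: "0 \<le> smooth_step x" "smooth_step x \<le> 1"
proof -
  have mono: "smooth_step y \<le> smooth_step z" if "y \<le> z" for y z
    using DERIV_nonneg_imp_nondecreasing[OF that] smooth_step_deriv tent_bounds(1) by blast
  show "0 \<le> smooth_step x" using mono[of "min x 0" x] smooth_step_le_0[of "min x 0"] by simp
  show "smooth_step x \<le> 1" using mono[of x "max x 1"] smooth_step_ge_1[of "max x 1"] by simp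
qed


text \<open>The average of \<open>f\<close> with the rescaled tent as weight on \<open>[a, a + e]\<close>.\<close>

lemma tent_average_close:
  fixes f :: "real \<Rightarrow> 'a::euclidean_space"
  assumes f: "f absolutely_integrable_on {a..a + e}" and e: "0 < e"
  shows "(\<lambda>r. (tent ((r - a) / e) / e) *\<^sub>R f r) absolutely_integrable_on {a..a + e}"
    and "norm (integral {a..a + e} (\<lambda>r. (tent ((r - a) / e) / e) *\<^sub>R f r) - c)
      \<le> 2 * ((1 / e) * integral {a..a + e} (\<lambda>r. norm (f r - c)))"
proof -
  define \<kappa> where "\<kappa> = (\<lambda>r. tent ((r - a) / e) / e)"
  have \<kappa>_cont: "continuous_on S \<kappa>" for S
    unfolding \<kappa>_def by (intro continuous_intros continuous_on_compose2[OF tent_continuous[of UNIV]]) (use e in auto)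
  have \<kappa>_abs: "\<bar>\<kappa> r\<bar> \<le> 2 / e" for r
    using tent_bounds[of "(r - a) / e"] e by (simp add: \<kappa>_def divide_right_mono)
  have scale: "(\<lambda>r. \<kappa> r *\<^sub>R z r) absolutely_integrable_on {a..a + e}"
    if "z absolutely_integrable_on {a..a + e}" for z :: "real \<Rightarrow> 'a"
  proof (rule absolutely_integrable_bounded_measurable_product[where h = scaleR])
    show "\<kappa> \<in> borel_measurable (lebesgue_on {a..a + e})"
      by (rule continuous_imp_measurable_on_sets_lebesgue[OF \<kappa>_cont]) auto
    show "bounded (\<kappa> ` {a..a + e})" using \<kappa>_abs by (auto simp: bounded_iff)
  qed (use that in \<open>auto simp: bilinear_conv_bounded_bilinear bounded_bilinear_scaleR\<close>)
  show "(\<lambda>r. (tent ((r - a) / e) / e) *\<^sub>R f r) absolutely_integrable_on {a..a + e}"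
    using scale[OF f] by (simp add: \<kappa>_def)
  have "((\<lambda>r. smooth_step ((r - a) / e)) has_real_derivative \<kappa> r) (at r)" for r
  proof -
    have "((\<lambda>r. (r - a) / e) has_real_derivative 1 / e) (at r)"
      using e by (auto intro!: derivative_eq_intros)
    from DERIV_chain2[where f = smooth_step, OF smooth_step_deriv this] show ?thesis by (simp add: \<kappa>_def)
  qed
  then have "(\<kappa> has_integral smooth_step ((a + e - a) / e) - smooth_step ((a - a) / e)) {a..a + e}"
    by (intro fundamental_theorem_of_calculus)
      (use e in \<open>auto simp: has_real_derivative_iff_has_vector_derivative[symmetric] intro: has_field_derivative_at_within\<close>)
  then have "(\<kappa> has_integral 1) {a..a + e}" using e by (simp add: smooth_step_le_0 smooth_step_ge_1)
  then have \<kappa>_c: "((\<lambda>r. \<kappa> r *\<^sub>R c) has_integral c) {a..a + e}"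
    using has_integral_scaleR_left[of \<kappa> 1 _ c] by simp
  have fc: "(\<lambda>r. f r - c) absolutely_integrable_on {a..a + e}"
    using absolutely_integrable_on_const[of "{a..a + e}" c] f by (intro set_integral_diff) auto
  have "integral {a..a + e} (\<lambda>r. \<kappa> r *\<^sub>R f r) - c = integral {a..a + e} (\<lambda>r. \<kappa> r *\<^sub>R f r - \<kappa> r *\<^sub>R c)"
    using \<kappa>_c set_lebesgue_integral_eq_integral(1)[OF scale[OF f]]
    by (subst integral_diff) (auto simp: integral_unique)
  also have "\<dots> = integral {a..a + e} (\<lambda>r. \<kappa> r *\<^sub>R (f r - c))" by (simp add: scaleR_diff_right)
  also have "norm \<dots> \<le> integral {a..a + e} (\<lambda>r. (2 / e) * norm (f r - c))"
  proof (rule integral_norm_bound_integral)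
    show "(\<lambda>r. \<kappa> r *\<^sub>R (f r - c)) integrable_on {a..a + e}"
      by (rule set_lebesgue_integral_eq_integral(1)[OF scale[OF fc]])
    show "(\<lambda>r. (2 / e) * norm (f r - c)) integrable_on {a..a + e}"
      using fc integrable_cmul[of "\<lambda>r. norm (f r - c)" _ "2 / e"]
      by (simp add: absolutely_integrable_on_def)
    show "norm (\<kappa> r *\<^sub>R (f r - c)) \<le> (2 / e) * norm (f r - c)" for r
      unfolding norm_scaleR real_norm_def by (intro mult_right_mono \<kappa>_abs) simp
  qed
  finally show "norm (integral {a..a + e} (\<lambda>r. (tent ((r - a) / e) / e) *\<^sub>R f r) - c)
      \<le> 2 * ((1 / e) * integral {a..a + e} (\<lambda>r. norm (f r - c)))"
    by (simp add: \<kappa>_def)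
qed

text \<open>Between almost all points the increments of a function are the integrals of its weak derivative:
  the test functions \<open>smooth_step ((r - s) / e) - smooth_step ((r - t) / e)\<close> converge to the
  indicator of the interval from \<open>s\<close> to \<open>t\<close>, and their derivatives average \<open>f\<close> near the Lebesgue
  points \<open>s\<close> and \<open>t\<close>.\<close>

lemma weak_derivative_increment:
  fixes f :: "real \<Rightarrow> 'a::euclidean_space"
  assumes weak: "has_weak_derivative f f' T"
  obtains N where "negligible N"
    "\<And>s t. s \<notin> N \<Longrightarrow> t \<notin> N \<Longrightarrow> 0 < s \<Longrightarrow> s < t \<Longrightarrow> t < T \<Longrightarrow> f t - f s = integral {s..t} f'"
proof -
  have f_int: "f absolutely_integrable_on {0<..<T}" and f'_int: "f' absolutely_integrable_on {0<..<T}"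
    using weak by (auto simp: has_weak_derivative_def L_one_def)
  define f0 where "f0 = (\<lambda>t. if t \<in> {0<..<T} then f t else 0)"
  have "f0 absolutely_integrable_on UNIV"
    using f_int unfolding f0_def by (simp only: absolutely_integrable_restrict_UNIV)
  then have f0_int: "f0 absolutely_integrable_on {a..b}" for a b
    by (rule set_integrable_subset) auto
  obtain N where N: "negligible N" "\<And>t. t \<notin> N \<Longrightarrow>
      ((\<lambda>h. (1 / h) * integral {t..t + h} (\<lambda>r. norm (f0 r - f0 t))) \<longlongrightarrow> 0) (at_right 0)"
    using lebesgue_points[OF f0_int] by blast
  have "f t - f s = integral {s..t} f'" if st: "s \<notin> N" "t \<notin> N" "0 < s" "s < t" "t < T" for s t
  proof -
    define e where "e = (\<lambda>n::nat. (T - t) / (real n + 2))"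
    have e_pos: "0 < e n" and e_lt: "t + e n < T" for n
    proof -
      have "(T - t) / (real n + 2) < (T - t) / 1"
        using st by (intro divide_strict_left_mono) auto
      then show "0 < e n" "t + e n < T" using st by (auto simp: e_def)
    qed
    have e_lim: "filterlim e (at_right 0) sequentially"
    proof -
      have "e \<longlonglongrightarrow> 0" unfolding e_def by real_asymp
      then show ?thesis using e_pos less_imp_neq[OF e_pos]
        by (auto simp: filterlim_at intro!: always_eventually)
    qed
    define \<psi> where "\<psi> = (\<lambda>n r. smooth_step ((r - s) / e n) - smooth_step ((r - t) / e n))"
    define \<psi>' where "\<psi>' = (\<lambda>n r. tent ((r - s) / e n) / e n - tent ((r - t) / e n) / e n)"
    define A where "A = (\<lambda>a n. integral {a..a + e n} (\<lambda>r. (tent ((r - a) / e n) / e n) *\<^sub>R f0 r))"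
    have A_lim: "A a \<longlonglongrightarrow> f0 a" if "a \<notin> N" for a
    proof (rule Lim_null_comparison[THEN Lim_null[THEN iffD2]])
      show "\<forall>\<^sub>F n in sequentially. norm (A a n - f0 a)
          \<le> 2 * ((1 / e n) * integral {a..a + e n} (\<lambda>r. norm (f0 r - f0 a)))"
        unfolding A_def using tent_average_close(2)[OF f0_int e_pos] by (intro always_eventually allI)
      show "(\<lambda>n. 2 * ((1 / e n) * integral {a..a + e n} (\<lambda>r. norm (f0 r - f0 a)))) \<longlonglongrightarrow> 0"
        using tendsto_mult_left[OF filterlim_compose[OF N(2)[OF that] e_lim], of 2] by simp
    qed
    have A_eq: "(LINT r:{0<..<T}|lebesgue. (tent ((r - a) / e n) / e n) *\<^sub>R f r) = A a n"
      and A_int: "(\<lambda>r. (tent ((r - a) / e n) / e n) *\<^sub>R f r) absolutely_integrable_on {0<..<T}"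
      if a: "0 < a" "a \<le> t" for a n
    proof -
      have sub: "{a..a + e n} \<subseteq> {0<..<T}" using a e_lt[of n] e_pos[of n] by auto
      have 1: "(\<lambda>r. if r \<in> {a..a + e n} then (tent ((r - a) / e n) / e n) *\<^sub>R f0 r else 0) absolutely_integrable_on UNIV"
        using tent_average_close(1)[OF f0_int e_pos] by (simp only: absolutely_integrable_restrict_UNIV)
      have 2: "(\<lambda>r. if r \<in> {a..a + e n} then (tent ((r - a) / e n) / e n) *\<^sub>R f0 r else 0)
          = (\<lambda>r. if r \<in> {0<..<T} then (tent ((r - a) / e n) / e n) *\<^sub>R f r else 0)"
      proof (rule ext)
        fix r
        have "tent ((r - a) / e n) = 0" if "r \<notin> {a..a + e n}"
        proof (rule tent_outside)
          show "(r - a) / e n \<le> 0 \<or> 1 \<le> (r - a) / e n"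
            using that e_pos[of n] by (auto simp: field_simps)
        qed
        then show "(if r \<in> {a..a + e n} then (tent ((r - a) / e n) / e n) *\<^sub>R f0 r else 0)
          = (if r \<in> {0<..<T} then (tent ((r - a) / e n) / e n) *\<^sub>R f r else 0)"
          using sub by (auto simp: f0_def)
      qed
      show int: "(\<lambda>r. (tent ((r - a) / e n) / e n) *\<^sub>R f r) absolutely_integrable_on {0<..<T}"
        using 1 unfolding 2 by (simp only: absolutely_integrable_restrict_UNIV)
      have "A a n = integral UNIV (\<lambda>r. if r \<in> {a..a + e n} then (tent ((r - a) / e n) / e n) *\<^sub>R f0 r else 0)"
        by (simp only: A_def integral_restrict_UNIV)
      also have "\<dots> = integral {0<..<T} (\<lambda>r. (tent ((r - a) / e n) / e n) *\<^sub>R f r)"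
        unfolding 2 by (simp only: integral_restrict_UNIV)
      finally show "(LINT r:{0<..<T}|lebesgue. (tent ((r - a) / e n) / e n) *\<^sub>R f r) = A a n"
        using set_lebesgue_integral_eq_integral(2)[OF int] by simp
    qed
    have identity: "A s n - A t n = - (LINT r:{0<..<T}|lebesgue. \<psi> n r *\<^sub>R f' r)" for n
    proof -
      have "(\<psi> n has_real_derivative \<psi>' n r) (at r)" for r
      proof -
        have "((\<lambda>r. smooth_step ((r - a) / e n)) has_real_derivative tent ((r - a) / e n) / e n) (at r)" for a
        proof -
          have "((\<lambda>r. (r - a) / e n) has_real_derivative 1 / e n) (at r)"
            using e_pos[of n] by (auto intro!: derivative_eq_intros)
          from DERIV_chain2[where f = smooth_step, OF smooth_step_deriv this] show ?thesis by simp
        qed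
        then show ?thesis unfolding \<psi>_def \<psi>'_def by (intro DERIV_diff)
      qed
      moreover have "continuous_on UNIV (\<psi>' n)"
        unfolding \<psi>'_def by (intro continuous_intros continuous_on_compose2[OF tent_continuous[of UNIV]])
          (use e_pos[of n] in auto)
      moreover have "compact {s..t + e n}" "{s..t + e n} \<subseteq> {0<..<T}" using st e_lt[of n] by auto
      moreover have "\<psi> n r = 0" if "r \<notin> {s..t + e n}" for r
      proof (cases "r < s")
        case True
        then have "(r - s) / e n \<le> 0" "(r - t) / e n \<le> 0"
          using st e_pos[of n] by (auto simp: divide_le_0_iff)
        then show ?thesis by (simp add: \<psi>_def smooth_step_le_0)
      next
        case False
        then have "1 \<le> (r - s) / e n" "1 \<le> (r - t) / e n"
          using that st e_pos[of n] by (auto simp: le_divide_eq_1)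
        then show ?thesis by (simp add: \<psi>_def smooth_step_ge_1)
      qed
      ultimately have "(LINT r:{0<..<T}|lebesgue. \<psi>' n r *\<^sub>R f r) = - (LINT r:{0<..<T}|lebesgue. \<psi> n r *\<^sub>R f' r)"
        using weak unfolding has_weak_derivative_def by blast
      moreover have "(LINT r:{0<..<T}|lebesgue. \<psi>' n r *\<^sub>R f r) = A s n - A t n"
        unfolding \<psi>'_def scaleR_diff_left using st
        by (subst set_integral_diff(2)) (auto simp: A_eq A_int)
      ultimately show ?thesis by simp
    qed
    have "(\<lambda>n. LINT r:{0<..<T}|lebesgue. \<psi> n r *\<^sub>R f' r)
        \<longlonglongrightarrow> (LINT r:{0<..<T}|lebesgue. indicat_real {s<..t} r *\<^sub>R f' r)"
      unfolding set_lebesgue_integral_def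
    proof (rule integral_dominated_convergence[where w = "\<lambda>r. norm (indicator {0<..<T} r *\<^sub>R f' r)"])
      have f'm: "(\<lambda>r. indicator {0<..<T} r *\<^sub>R f' r) \<in> borel_measurable lebesgue"
        using f'_int by (simp add: set_integrable_def borel_measurable_integrable)
      have "(\<lambda>r. indicat_real {s<..t} r *\<^sub>R (indicator {0<..<T} r *\<^sub>R f' r)) \<in> borel_measurable lebesgue"
        by (rule borel_measurable_scaleR[OF borel_measurable_indicator f'm])
          (rule sets_completionI_sets, simp)
      then show "(\<lambda>r. indicat_real {0<..<T} r *\<^sub>R indicat_real {s<..t} r *\<^sub>R f' r) \<in> borel_measurable lebesgue"
        by (simp add: mult.commute)
      have "(\<lambda>r. \<psi> n r *\<^sub>R (indicator {0<..<T} r *\<^sub>R f' r)) \<in> borel_measurable lebesgue" for n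
      proof (rule borel_measurable_scaleR[OF _ f'm])
        have "continuous_on UNIV smooth_step"
          using smooth_step_deriv by (meson DERIV_isCont continuous_at_imp_continuous_on)
        then have "continuous_on UNIV (\<lambda>r. smooth_step ((r - a) / e n))" for a
          by (rule continuous_on_compose2) (use e_pos[of n] in \<open>auto intro!: continuous_intros\<close>)
        then have "continuous_on UNIV (\<psi> n)"
          unfolding \<psi>_def by (intro continuous_on_diff)
        then show "\<psi> n \<in> borel_measurable lebesgue"
          by (intro measurable_completion) (simp add: borel_measurable_continuous_onI)
      qed
      then show "(\<lambda>r. indicat_real {0<..<T} r *\<^sub>R \<psi> n r *\<^sub>R f' r) \<in> borel_measurable lebesgue" for n
        by (simp add: mult.commute)
      show "integrable lebesgue (\<lambda>r. norm (indicator {0<..<T} r *\<^sub>R f' r))"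
        using f'_int unfolding set_integrable_def by (rule integrable_norm)
      have \<psi>_abs: "\<bar>\<psi> n r\<bar> \<le> 1" for n r
        using smooth_step_bounds[of "(r - s) / e n"] smooth_step_bounds[of "(r - t) / e n"]
        by (simp add: \<psi>_def)
      show "AE r in lebesgue. norm (indicat_real {0<..<T} r *\<^sub>R \<psi> n r *\<^sub>R f' r)
          \<le> norm (indicator {0<..<T} r *\<^sub>R f' r)" for n
        using mult_right_mono[OF \<psi>_abs[of n]] by (intro AE_I2) (auto simp: indicator_def)
      have step_lim: "(\<lambda>n. smooth_step ((r - a) / e n)) \<longlonglongrightarrow> indicat_real {a<..} r" for a r
      proof (cases "a < r")
        case True
        have "e \<longlonglongrightarrow> 0" using e_lim by (auto simp: filterlim_at)
        then have "\<forall>\<^sub>F n in sequentially. e n < r - a" using True by (intro order_tendstoD(2)) auto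
        then have "\<forall>\<^sub>F n in sequentially. smooth_step ((r - a) / e n) = 1"
          by (rule eventually_mono) (use e_pos in \<open>auto intro!: smooth_step_ge_1 simp: le_divide_eq_1\<close>)
        then show ?thesis using True by (simp add: tendsto_eventually)
      next
        case False
        then have "smooth_step ((r - a) / e n) = 0" for n
          using e_pos[of n] by (intro smooth_step_le_0) (simp add: divide_le_0_iff)
        then show ?thesis using False by simp
      qed
      have "(\<lambda>n. \<psi> n r) \<longlonglongrightarrow> indicat_real {s<..} r - indicat_real {t<..} r" for r
        unfolding \<psi>_def by (intro tendsto_diff step_lim)
      moreover have "indicat_real {s<..} r - indicat_real {t<..} r = indicat_real {s<..t} r" for r
        using st by (auto simp: indicator_def)
      ultimately have "(\<lambda>n. \<psi> n r) \<longlonglongrightarrow> indicat_real {s<..t} r" for r by simp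
      then show "AE r in lebesgue. (\<lambda>n. indicat_real {0<..<T} r *\<^sub>R \<psi> n r *\<^sub>R f' r)
          \<longlonglongrightarrow> indicat_real {0<..<T} r *\<^sub>R indicat_real {s<..t} r *\<^sub>R f' r"
        by (intro AE_I2 tendsto_intros)
    qed
    moreover have "(LINT r:{0<..<T}|lebesgue. indicat_real {s<..t} r *\<^sub>R f' r) = integral {s..t} f'"
    proof -
      have "f' absolutely_integrable_on {s..t}"
        by (rule set_integrable_subset[OF f'_int]) (use st in auto)
      have "(LINT r:{0<..<T}|lebesgue. indicat_real {s<..t} r *\<^sub>R f' r) = (LINT r:{s<..t}|lebesgue. f' r)"
        unfolding set_lebesgue_integral_def
        by (intro Bochner_Integration.integral_cong) (use st in \<open>auto simp: indicator_def\<close>)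
      also have "\<dots> = integral {s<..t} f'"
        by (intro set_lebesgue_integral_eq_integral(2) set_integrable_subset[OF f'_int]) (use st in auto)
      also have "\<dots> = integral {s..t} f'"
        by (rule integral_spike_set) (rule negligible_subset[of "{s}"], auto)+
      finally show ?thesis .
    qed
    ultimately have "(\<lambda>n. A s n - A t n) \<longlonglongrightarrow> - integral {s..t} f'"
      unfolding identity by (intro tendsto_minus) simp
    moreover have "(\<lambda>n. A s n - A t n) \<longlonglongrightarrow> f0 s - f0 t" using st by (intro tendsto_diff A_lim)
    ultimately have "f0 s - f0 t = - integral {s..t} f'" by (rule LIMSEQ_unique[symmetric])
    then show ?thesis using st by (simp add: f0_def algebra_simps)
  qed
  with N(1) that show ?thesis by blast
qed

lemma weak_derivative_representation:
  fixes f :: "real \<Rightarrow> 'a::euclidean_space"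
  assumes weak: "has_weak_derivative f f' T" and T: "0 < T"
  obtains F N where "negligible N" "\<And>t. t \<notin> N \<Longrightarrow> 0 < t \<Longrightarrow> t < T \<Longrightarrow> f t = F t"
    "\<And>s t. 0 \<le> s \<Longrightarrow> s \<le> t \<Longrightarrow> t \<le> T \<Longrightarrow> F t - F s = integral {s..t} f'"
    "f' absolutely_integrable_on {0..T}"
proof -
  have f'_int: "f' absolutely_integrable_on {0..T}"
    using weak by (simp add: has_weak_derivative_def L_one_def absolutely_integrable_on_Icc_iff_Ioo)
  have int: "f' integrable_on {a..b}" if "0 \<le> a" "b \<le> T" for a b
    by (rule set_lebesgue_integral_eq_integral(1)[OF set_integrable_subset[OF f'_int]]) (use that in auto)
  obtain N where N: "negligible N"
    "\<And>s t. s \<notin> N \<Longrightarrow> t \<notin> N \<Longrightarrow> 0 < s \<Longrightarrow> s < t \<Longrightarrow> t < T \<Longrightarrow> f t - f s = integral {s..t} f'"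
    using weak_derivative_increment[OF weak] by blast
  have "\<not> negligible {0<..<T}" using T by (simp add: negligible_interval[of 0 T, unfolded box_real])
  then have "\<not> {0<..<T} \<subseteq> N" using negligible_subset[OF N(1)] by blast
  then obtain r where r: "0 < r" "r < T" "r \<notin> N" unfolding subset_iff greaterThanLessThan_iff by blast
  define F where "F = (\<lambda>t. f r + (integral {0..t} f' - integral {0..r} f'))"
  have inc: "F t - F s = integral {s..t} f'" if "0 \<le> s" "s \<le> t" "t \<le> T" for s t
    using Henstock_Kurzweil_Integration.integral_combine[OF that(1,2) int] that
    by (simp add: F_def algebra_simps)
  have "F t = f t" if "t \<notin> N" "0 < t" "t < T" for t
  proof (rule linorder_cases[of t r])
    assume "t < r"
    then have "F r - F t = f r - f t" using inc[of t r] N(2)[of t r] that r by simp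
    moreover have "F r = f r" by (simp add: F_def)
    ultimately show ?thesis by simp
  next
    assume "r < t"
    then have "F t - F r = f t - f r" using inc[of r t] N(2)[of r t] that r by simp
    then show ?thesis by (simp add: F_def)
  qed (simp add: F_def)
  then show ?thesis using that[of N F] N(1) inc f'_int by auto
qed

section \<open>Passage to the limit\<close>

text \<open>A bounded sequence of functions on an interval that is Lipschitz up to an error tending to
  zero has a pointwise convergent subsequence with a Lipschitz limit; the functions themselves need
  not be continuous.\<close>

lemma almost_lipschitz_subsequence:
  fixes X :: "nat \<Rightarrow> real \<Rightarrow> 'b::{banach,heine_borel}"
  assumes lip: "\<And>n s t. 0 \<le> s \<Longrightarrow> s \<le> t \<Longrightarrow> t \<le> T \<Longrightarrow> norm (X n t - X n s) \<le> C * (t - s + \<delta> n)"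
    and \<delta>: "\<delta> \<longlonglongrightarrow> 0" and bound: "\<And>n t. 0 \<le> t \<Longrightarrow> t \<le> T \<Longrightarrow> norm (X n t) \<le> B"
    and T: "0 < T" and C: "0 \<le> C"
  obtains r Y where "strict_mono r" "\<And>t. 0 \<le> t \<Longrightarrow> t \<le> T \<Longrightarrow> (\<lambda>n. X (r n) t) \<longlonglongrightarrow> Y t"
    "C-lipschitz_on {0..T} Y"
proof -
  have "countable ({0..T} \<inter> \<rat>)" using countable_rat by (rule countable_Int2)
  then obtain r :: "nat \<Rightarrow> nat" where r: "strict_mono r"
      "\<And>t. t \<in> {0..T} \<inter> \<rat> \<Longrightarrow> \<exists>l. (\<lambda>n. X (r n) t) \<longlonglongrightarrow> l"
    by (rule function_convergent_subsequence[where f = X and M = B]) (use bound in auto)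
  have \<delta>r: "(\<lambda>n. \<delta> (r n)) \<longlonglongrightarrow> 0"
    using LIMSEQ_subseq_LIMSEQ[OF \<delta> r(1)] by (simp add: o_def)
  have "Cauchy (\<lambda>n. X (r n) t)" if t: "0 \<le> t" "t \<le> T" for t
  proof (rule CauchyI)
    fix e :: real assume e: "0 < e"
    define d where "d = (e / 8) / (C + 1)"
    have C1: "C + 1 \<noteq> 0" using C by linarith
    have d: "0 < d" using e C by (simp add: d_def)
    have Cd: "C * (2 * d) \<le> e / 4"
    proof -
      have "C * d \<le> (C + 1) * d" using d by (intro mult_right_mono) auto
      also have "\<dots> = e / 8" unfolding d_def by (rule nonzero_mult_div_cancel_left[OF C1, folded times_divide_eq_right])
      finally show ?thesis by simp
    qed
    obtain q where q: "q \<in> {0..T} \<inter> \<rat>" "\<bar>t - q\<bar> < d"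
    proof -
      have "max 0 (t - d) < min T (t + d)" using t T d by auto
      then obtain q where "q \<in> \<rat>" "max 0 (t - d) < q" "q < min T (t + d)"
        using Rats_dense_in_real by blast
      then show ?thesis by (intro that[of q]) auto
    qed
    have close: "norm (X n t - X n q) \<le> C * (\<bar>t - q\<bar> + \<delta> n)" for n
    proof (cases "q \<le> t")
      case True
      then show ?thesis using lip[of q t n] t q by simp
    next
      case False
      then show ?thesis using lip[of t q n] t q by (simp add: norm_minus_commute)
    qed
    have "\<forall>\<^sub>F n in sequentially. \<delta> (r n) < d" using \<delta>r d by (rule order_tendstoD)
    then obtain n1 where n1: "\<And>n. n1 \<le> n \<Longrightarrow> \<delta> (r n) < d" by (auto simp: eventually_sequentially)
    have "Cauchy (\<lambda>n. X (r n) q)" using r(2)[OF q(1)] by (auto intro: LIMSEQ_imp_Cauchy)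
    then obtain n2 where n2: "\<And>m n. n2 \<le> m \<Longrightarrow> n2 \<le> n \<Longrightarrow> norm (X (r m) q - X (r n) q) < e / 2"
      using CauchyD[of _ "e / 2"] e by (metis half_gt_zero)
    have near: "norm (X (r n) t - X (r n) q) \<le> e / 4" if "n1 \<le> n" for n
    proof -
      have "C * (\<bar>t - q\<bar> + \<delta> (r n)) \<le> C * (2 * d)"
        using q(2) n1[OF that] C by (intro mult_left_mono) auto
      then show ?thesis using close[of "r n"] Cd by linarith
    qed
    have "norm (X (r m) t - X (r n) t) < e" if "max n1 n2 \<le> m" "max n1 n2 \<le> n" for m n
    proof -
      have "X (r m) t - X (r n) t = (X (r m) t - X (r m) q) + (X (r m) q - X (r n) q) - (X (r n) t - X (r n) q)"
        by simp
      also have "norm \<dots> \<le> norm (X (r m) t - X (r m) q) + norm (X (r m) q - X (r n) q) + norm (X (r n) t - X (r n) q)"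
        by (rule order_trans[OF norm_triangle_ineq4 add_right_mono[OF norm_triangle_ineq]])
      also have "\<dots> < e" using near[of m] near[of n] n2[of m n] that by simp
      finally show ?thesis .
    qed
    then show "\<exists>n0. \<forall>m\<ge>n0. \<forall>n\<ge>n0. norm (X (r m) t - X (r n) t) < e" by blast
  qed
  then have lim: "(\<lambda>n. X (r n) t) \<longlonglongrightarrow> lim (\<lambda>n. X (r n) t)" if "0 \<le> t" "t \<le> T" for t
    using that by (simp add: Cauchy_convergent convergent_LIMSEQ_iff[symmetric])
  define Y where "Y = (\<lambda>t. lim (\<lambda>n. X (r n) t))"
  have Y_lip: "norm (Y t - Y s) \<le> C * (t - s)" if st: "0 \<le> s" "s \<le> t" "t \<le> T" for s t
  proof (rule LIMSEQ_le)
    show "(\<lambda>n. norm (X (r n) t - X (r n) s)) \<longlonglongrightarrow> norm (Y t - Y s)"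
      unfolding Y_def using st by (intro tendsto_intros lim) auto
    have "(\<lambda>n. C * (t - s + \<delta> (r n))) \<longlonglongrightarrow> C * (t - s + 0)" by (intro tendsto_intros \<delta>r)
    then show "(\<lambda>n. C * (t - s + \<delta> (r n))) \<longlonglongrightarrow> C * (t - s)" by simp
  qed (use lip[OF st] in blast)
  have "C-lipschitz_on {0..T} Y"
  proof (rule lipschitz_on_leI[OF _ C])
    fix s t assume "s \<in> {0..T}" "t \<in> {0..T}" "s \<le> t"
    then show "dist (Y s) (Y t) \<le> C * dist s t"
      using Y_lip[of s t] by (simp add: dist_norm norm_minus_commute)
  qed
  with lim show ?thesis by (intro that[OF r(1), of Y]) (auto simp: Y_def)
qed

context gradient_system
begin

lemma discrete_increment:
  assumes "discrete_solution M \<epsilon> m u v \<mu>" "i \<le> j"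
  shows "u j - u i = (\<Sum>k=i..<j. (T / m) *\<^sub>R v k)"
proof -
  have "(\<Sum>k=i..<j. (T / m) *\<^sub>R v k) = (\<Sum>k=i..<j. u (Suc k) - u k)"
    using assms(1) by (simp add: discrete_solution_def)
  then show ?thesis using assms(2) by (simp add: sum_Suc_diff')
qed

text \<open>The inclusion \<open>- v \<in> \<partial>\<phi>(\<mu>)\<close>, summed over the steps from \<open>i\<close> to \<open>j\<close> while \<open>g(u) - f\<close> stays within
  \<open>\<delta>\<close> of \<open>c\<close>. Jensen's inequality replaces the values \<open>\<mu> k\<close> by their average, and the chain rule
  replaces \<open>(\<mu> - g(u) + f) \<bullet> v\<close> by the increment of \<open>\<phi>\<close>.\<close>

lemma discrete_inclusion_outer:
  assumes sol: "discrete_solution M \<epsilon> m u v \<mu>" and ij: "i < j" "j \<le> m"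
    and c: "\<And>k. i \<le> k \<Longrightarrow> k < j \<Longrightarrow> norm (g (u k) - f (k * (T / m)) - c) \<le> \<delta>"
  defines "\<tau> \<equiv> real (j - i) * (T / m)"
  shows "\<tau> * \<phi> ((1 / \<tau>) *\<^sub>R (\<Sum>k=i..<j. (T / m) *\<^sub>R \<mu> k)) + (c - z) \<bullet> (u j - u i) + \<phi> (u j) - \<phi> (u i) - \<epsilon>
    - \<tau> * (M * \<delta> + \<epsilon>) \<le> \<tau> * \<phi> z"
proof -
  define h where "h = T / m"
  have m: "0 < m" using sol by (simp add: discrete_solution_def)
  have h: "0 < h" using m T_pos by (simp add: h_def)
  have du: "u j - u i = (\<Sum>k=i..<j. h *\<^sub>R v k)" using discrete_increment[OF sol] ij by (simp add: h_def)
  define \<eta> where "\<eta> = (\<lambda>k. \<mu> k - g (u k) + f (k * h))"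
  have step: "h * \<phi> (\<mu> k) - h * (v k \<bullet> z) + h * (\<eta> k \<bullet> v k) + c \<bullet> (h *\<^sub>R v k) - h * (M * \<delta> + \<epsilon>) \<le> h * \<phi> z"
    if k: "k \<in> {i..<j}" for k
  proof -
    have "\<phi> (\<mu> k) - v k \<bullet> (z - \<mu> k) - \<epsilon> \<le> \<phi> z" and vM: "norm (v k) \<le> M"
      using sol k ij by (auto simp: discrete_solution_def)
    then have 1: "\<phi> (\<mu> k) - v k \<bullet> z + v k \<bullet> \<mu> k - \<epsilon> \<le> \<phi> z" by (simp add: inner_diff_right)
    have "\<bar>(g (u k) - f (k * h) - c) \<bullet> v k\<bar> \<le> norm (g (u k) - f (k * h) - c) * norm (v k)"
      by (rule Cauchy_Schwarz_ineq2)
    also have "\<dots> \<le> \<delta> * M"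
      using c[of k] k vM order_trans[OF norm_ge_zero c[of k]] by (intro mult_mono) (auto simp: h_def)
    finally have "\<eta> k \<bullet> v k + c \<bullet> v k - M * \<delta> \<le> v k \<bullet> \<mu> k"
      by (simp add: \<eta>_def inner_diff_left inner_add_left inner_commute algebra_simps abs_le_iff)
    with 1 have "\<phi> (\<mu> k) - v k \<bullet> z + \<eta> k \<bullet> v k + c \<bullet> v k - (M * \<delta> + \<epsilon>) \<le> \<phi> z" by linarith
    from mult_left_mono[OF this, of h] h show ?thesis by (simp add: algebra_simps)
  qed
  have "(\<Sum>k=i..<j. h * \<phi> (\<mu> k) - h * (v k \<bullet> z) + h * (\<eta> k \<bullet> v k) + c \<bullet> (h *\<^sub>R v k) - h * (M * \<delta> + \<epsilon>))
      \<le> (\<Sum>k=i..<j. h * \<phi> z)" by (rule sum_mono[OF step])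
  then have "(\<Sum>k=i..<j. h * \<phi> (\<mu> k)) - (\<Sum>k=i..<j. h * (v k \<bullet> z)) + (\<Sum>k=i..<j. h * (\<eta> k \<bullet> v k))
      + c \<bullet> (u j - u i) - real (j - i) * (h * (M * \<delta> + \<epsilon>)) \<le> real (j - i) * (h * \<phi> z)"
    unfolding du by (simp add: sum.distrib sum_subtractf inner_sum_right)
  moreover have "(\<Sum>k=i..<j. h * (v k \<bullet> z)) = z \<bullet> (u j - u i)"
    unfolding du by (simp add: inner_sum_right inner_commute)
  moreover have "\<phi> (u j) - \<phi> (u i) - \<epsilon> \<le> (\<Sum>k=i..<j. h * (\<eta> k \<bullet> v k))"
    using sol ij by (simp add: discrete_solution_def \<eta>_def h_def)
  moreover have "\<tau> * \<phi> ((1 / \<tau>) *\<^sub>R (\<Sum>k=i..<j. h *\<^sub>R \<mu> k)) \<le> (\<Sum>k=i..<j. h * \<phi> (\<mu> k))"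
  proof -
    have "\<phi> (\<Sum>k=i..<j. (1 / real (j - i)) *\<^sub>R \<mu> k) \<le> (\<Sum>k=i..<j. (1 / real (j - i)) * \<phi> (\<mu> k))"
      using ij by (intro convex_on_sum[OF _ _ convex]) auto
    also have "(\<Sum>k=i..<j. (1 / real (j - i)) *\<^sub>R \<mu> k) = (1 / \<tau>) *\<^sub>R (\<Sum>k=i..<j. h *\<^sub>R \<mu> k)"
      using ij h by (simp add: \<tau>_def h_def[symmetric] scaleR_sum_right[symmetric])
    finally have "\<tau> * \<phi> ((1 / \<tau>) *\<^sub>R (\<Sum>k=i..<j. h *\<^sub>R \<mu> k)) \<le> \<tau> * (\<Sum>k=i..<j. (1 / real (j - i)) * \<phi> (\<mu> k))"
      using h by (intro mult_left_mono) (auto simp: \<tau>_def h_def[symmetric])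
    also have "\<dots> = (\<Sum>k=i..<j. h * \<phi> (\<mu> k))"
      unfolding sum_distrib_left using ij by (intro sum.cong) (auto simp: \<tau>_def h_def[symmetric])
    finally show ?thesis .
  qed
  ultimately show ?thesis
    unfolding \<tau>_def h_def[symmetric] inner_diff_left by (simp add: algebra_simps)
qed

text \<open>The inclusion \<open>\<mu> - g(u) + f \<in> \<partial>\<phi>(u)\<close>, summed over the same steps while \<open>u\<close> moreover stays
  within \<open>\<delta>\<close> of \<open>a\<close> and \<open>\<phi>(u)\<close> above \<open>\<phi>(a) - \<delta>\<close>.\<close>

lemma discrete_inclusion_inner:
  assumes sol: "discrete_solution M \<epsilon> m u v \<mu>" and ij: "i < j" "j \<le> m"
    and c: "\<And>k. i \<le> k \<Longrightarrow> k < j \<Longrightarrow> norm (g (u k) - f (k * (T / m)) - c) \<le> \<delta>"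
    and a: "\<And>k. i \<le> k \<Longrightarrow> k < j \<Longrightarrow> norm (u k - a) \<le> \<delta>"
      "\<And>k. i \<le> k \<Longrightarrow> k < j \<Longrightarrow> \<phi> a - \<delta> \<le> \<phi> (u k)"
  defines "\<tau> \<equiv> real (j - i) * (T / m)"
  shows "\<tau> * \<phi> a + ((\<Sum>k=i..<j. (T / m) *\<^sub>R \<mu> k) - \<tau> *\<^sub>R c) \<bullet> (z - a)
    - \<tau> * (\<delta> + \<epsilon> + \<delta> * norm (z - a) + (M + norm c + \<delta>) * \<delta>) \<le> \<tau> * \<phi> z"
proof -
  define h where "h = T / m"
  have m: "0 < m" using sol by (simp add: discrete_solution_def)
  have h: "0 < h" using m T_pos by (simp add: h_def)
  define err where "err = \<delta> + \<epsilon> + \<delta> * norm (z - a) + (M + norm c + \<delta>) * \<delta>"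
  have step: "h * \<phi> a + (h *\<^sub>R \<mu> k) \<bullet> (z - a) - h * (c \<bullet> (z - a)) - h * err \<le> h * \<phi> z"
    if k: "k \<in> {i..<j}" for k
  proof -
    define \<eta> where "\<eta> = \<mu> k - g (u k) + f (k * h)"
    define d where "d = g (u k) - f (k * h) - c"
    have sub: "\<phi> (u k) + \<eta> \<bullet> (z - u k) - \<epsilon> \<le> \<phi> z" and \<mu>M: "norm (\<mu> k) \<le> M"
      using sol k ij by (auto simp: discrete_solution_def \<eta>_def h_def)
    have d: "norm d \<le> \<delta>" using c[of k] k by (simp add: d_def h_def)
    have \<eta>_eq: "\<eta> = \<mu> k - c - d" by (simp add: \<eta>_def d_def)
    have \<eta>_le: "norm \<eta> \<le> M + norm c + \<delta>"
      unfolding \<eta>_eq using norm_triangle_ineq4[of "\<mu> k - c" d] norm_triangle_ineq4[of "\<mu> k" c] \<mu>M d by linarith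
    have "\<bar>\<eta> \<bullet> (u k - a)\<bar> \<le> norm \<eta> * norm (u k - a)" by (rule Cauchy_Schwarz_ineq2)
    also have "\<dots> \<le> (M + norm c + \<delta>) * \<delta>"
      using \<eta>_le a(1)[of k] k order_trans[OF norm_ge_zero \<eta>_le] by (intro mult_mono) auto
    finally have 1: "\<eta> \<bullet> (u k - a) \<le> (M + norm c + \<delta>) * \<delta>" by linarith
    have "\<bar>d \<bullet> (z - a)\<bar> \<le> norm d * norm (z - a)" by (rule Cauchy_Schwarz_ineq2)
    also have "\<dots> \<le> \<delta> * norm (z - a)" using d by (rule mult_right_mono) simp
    finally have 2: "d \<bullet> (z - a) \<le> \<delta> * norm (z - a)" by linarith
    have "\<eta> \<bullet> (z - u k) = \<mu> k \<bullet> (z - a) - c \<bullet> (z - a) - d \<bullet> (z - a) - \<eta> \<bullet> (u k - a)"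
      by (simp add: \<eta>_eq algebra_simps)
    with sub 1 2 a(2)[of k] k have "\<phi> a + \<mu> k \<bullet> (z - a) - c \<bullet> (z - a) - err \<le> \<phi> z"
      unfolding err_def by force
    from mult_left_mono[OF this, of h] h show ?thesis by (simp add: algebra_simps)
  qed
  have "(\<Sum>k=i..<j. h * \<phi> a + (h *\<^sub>R \<mu> k) \<bullet> (z - a) - h * (c \<bullet> (z - a)) - h * err) \<le> (\<Sum>k=i..<j. h * \<phi> z)"
    by (rule sum_mono[OF step])
  then show ?thesis
    unfolding err_def[symmetric] \<tau>_def h_def[symmetric]
    by (simp add: sum.distrib sum_subtractf inner_sum_left inner_diff_left algebra_simps)
qed

end

lemma le_if_le_up_to_small:
  fixes a b c :: real
  assumes "\<And>\<delta>. 0 < \<delta> \<Longrightarrow> a - \<delta> * (b + \<delta>) \<le> c"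
  shows "a \<le> c"
proof (rule tendsto_upperbound)
  have "((\<lambda>\<delta>. a - \<delta> * (b + \<delta>)) \<longlongrightarrow> a - 0 * (b + 0)) (at_right 0)" by (intro tendsto_intros)
  then show "((\<lambda>\<delta>. a - \<delta> * (b + \<delta>)) \<longlongrightarrow> a) (at_right 0)" by simp
  show "\<forall>\<^sub>F \<delta> in at_right 0. a - \<delta> * (b + \<delta>) \<le> c"
    by (rule eventually_mono[OF eventually_at_right_less]) (rule assms)
qed simp

text \<open>The index of the cell containing \<open>t\<close> in the mesh of width \<open>h > 0\<close>.\<close>

definition mesh_index :: "real \<Rightarrow> real \<Rightarrow> nat" where
  "mesh_index h t = nat \<lfloor>t / h\<rfloor>"

lemma mesh_index_bounds:
  assumes "0 < h" "0 \<le> t"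
  shows "real (mesh_index h t) * h \<le> t" "t < (real (mesh_index h t) + 1) * h"
proof -
  have "real (mesh_index h t) = of_int \<lfloor>t / h\<rfloor>" using assms by (simp add: mesh_index_def)
  then have "real (mesh_index h t) \<le> t / h" "t / h < real (mesh_index h t) + 1" by linarith+
  then show "real (mesh_index h t) * h \<le> t" "t < (real (mesh_index h t) + 1) * h"
    using assms by (auto simp: pos_le_divide_eq pos_divide_less_eq)
qed

lemma mesh_index_le:
  assumes "0 < h" "0 \<le> t" "t \<le> real m * h"
  shows "mesh_index h t \<le> m"
proof -
  have "real (mesh_index h t) * h \<le> real m * h" using mesh_index_bounds(1)[OF assms(1,2)] assms(3) by linarith
  then show ?thesis using assms(1) by simp
qed

lemma mesh_index_mono: "0 < h \<Longrightarrow> a \<le> b \<Longrightarrow> mesh_index h a \<le> mesh_index h b"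
  by (auto simp: mesh_index_def intro!: nat_mono floor_mono divide_right_mono)

context gradient_system
begin

text \<open>The two inclusions, integrated over a short interval \<open>[s, t]\<close> and up to an error \<open>\<delta>\<close>, pass
  to the limit; only pointwise convergence of the discrete solutions and of the primitives of the
  discrete chemical potentials is used.\<close>

lemma local_inequalities:
  fixes m :: "nat \<Rightarrow> nat" and x w y :: "nat \<Rightarrow> nat \<Rightarrow> 'a"
  assumes sol: "\<And>n. discrete_solution M (\<epsilon> n) (m n) (x n) (w n) (y n)"
    and \<epsilon>: "\<epsilon> \<longlonglongrightarrow> 0" and M: "0 < M"
    and U: "\<And>t. 0 \<le> t \<Longrightarrow> t \<le> T \<Longrightarrow> (\<lambda>n. x n (mesh_index (T / m n) t)) \<longlonglongrightarrow> u t"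
    and P: "\<And>t. 0 \<le> t \<Longrightarrow> t \<le> T \<Longrightarrow>
      (\<lambda>n. \<Sum>k<mesh_index (T / m n) t. (T / m n) *\<^sub>R y n k) \<longlonglongrightarrow> p t"
    and s: "0 \<le> s" "s < T" and \<delta>: "0 < \<delta>"
  defines "c \<equiv> g (u s) - f s"
  obtains \<rho> where "0 < \<rho>"
    "\<And>t z. s < t \<Longrightarrow> t < s + \<rho> \<Longrightarrow> t \<le> T \<Longrightarrow>
      (t - s) * \<phi> ((1 / (t - s)) *\<^sub>R (p t - p s)) + (c - z) \<bullet> (u t - u s) + \<phi> (u t) - \<phi> (u s)
        - (t - s) * (M * \<delta>) \<le> (t - s) * \<phi> z"
    "\<And>t z. s < t \<Longrightarrow> t < s + \<rho> \<Longrightarrow> t \<le> T \<Longrightarrow>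
      (t - s) * \<phi> (u s) + ((p t - p s) - (t - s) *\<^sub>R c) \<bullet> (z - u s)
        - (t - s) * (\<delta> + \<delta> * norm (z - u s) + (M + norm c + \<delta>) * \<delta>) \<le> (t - s) * \<phi> z"
proof -
  define h where "h = (\<lambda>n. T / m n)"
  have m: "0 < m n" and h_le: "h n \<le> \<epsilon> n" for n using sol[of n] by (auto simp: discrete_solution_def h_def)
  have h: "0 < h n" and mh: "real (m n) * h n = T" for n using m[of n] T_pos by (auto simp: h_def)
  have h_lim: "h \<longlonglongrightarrow> 0"
    by (rule tendsto_sandwich[OF _ _ tendsto_const \<epsilon>]) (use h h_le in \<open>auto intro!: always_eventually less_imp_le\<close>)
  define idx where "idx = (\<lambda>n. mesh_index (h n))"
  have idx: "real (idx n t) * h n \<le> t" "t < (real (idx n t) + 1) * h n" if "0 \<le> t" for n t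
    unfolding idx_def by (fact mesh_index_bounds[OF h that])+
  have idx_le: "idx n t \<le> m n" if "0 \<le> t" "t \<le> T" for n t
    unfolding idx_def by (rule mesh_index_le[OF h that(1)]) (use that mh in simp)
  have idx_mono: "idx n a \<le> idx n b" if "a \<le> b" for n a b
    unfolding idx_def by (rule mesh_index_mono[OF h that])
  have U: "(\<lambda>n. x n (idx n t)) \<longlonglongrightarrow> u t" and P: "(\<lambda>n. \<Sum>k<idx n t. h n *\<^sub>R y n k) \<longlonglongrightarrow> p t"
    if "0 \<le> t" "t \<le> T" for t
    using U[OF that] P[OF that] by (auto simp: idx_def h_def)
  have "isCont g (u s)" using g_continuous by (simp add: continuous_on_eq_continuous_at)
  then obtain d1 where d1: "0 < d1" "\<And>a. norm (a - u s) < d1 \<Longrightarrow> norm (g a - g (u s)) < \<delta> / 2"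
    using \<delta> unfolding continuous_at_eps_delta dist_norm by (meson half_gt_zero)
  have "isCont \<phi> (u s)" using continuous[of UNIV] by (simp add: continuous_on_eq_continuous_at)
  then obtain d2 where d2: "0 < d2" "\<And>a. norm (a - u s) < d2 \<Longrightarrow> norm (\<phi> a - \<phi> (u s)) < \<delta>"
    using \<delta> unfolding continuous_at_eps_delta dist_norm by meson
  obtain d3 where d3: "0 < d3" "\<And>a. 0 \<le> a \<Longrightarrow> a \<le> T \<Longrightarrow> \<bar>a - s\<bar> < d3 \<Longrightarrow> norm (f a - f s) < \<delta> / 2"
    using f_continuous \<delta> s unfolding continuous_on_iff dist_norm real_norm_def
    by (metis atLeastAtMost_iff half_gt_zero less_imp_le)
  define d where "d = min (min d1 d2) \<delta>"
  have d: "0 < d" "d \<le> d1" "d \<le> d2" "d \<le> \<delta>" using d1 d2 \<delta> by (auto simp: d_def)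
  \<comment> \<open>While \<open>t - s < \<rho>\<close>, the states move by less than \<open>d / 2\<close>, and the remaining \<open>d / 2\<close> absorbs the
    discretisation error.\<close>
  define \<rho> where "\<rho> = min d3 (d / (2 * M))"
  have \<rho>: "0 < \<rho>" "\<rho> \<le> d3" "M * \<rho> \<le> d / 2"
    using d3 d M by (auto simp: \<rho>_def min_def field_simps)
  have main:
    "(t - s) * \<phi> ((1 / (t - s)) *\<^sub>R (p t - p s)) + (c - z) \<bullet> (u t - u s) + \<phi> (u t) - \<phi> (u s)
        - (t - s) * (M * \<delta>) \<le> (t - s) * \<phi> z" (is ?A)
    "(t - s) * \<phi> (u s) + ((p t - p s) - (t - s) *\<^sub>R c) \<bullet> (z - u s)
        - (t - s) * (\<delta> + \<delta> * norm (z - u s) + (M + norm c + \<delta>) * \<delta>) \<le> (t - s) * \<phi> z" (is ?B)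
    if t: "s < t" "t < s + \<rho>" "t \<le> T" for t z
  proof -
    have t0: "0 \<le> t" and sT: "s \<le> T" using s t by auto
    define \<tau> where "\<tau> = (\<lambda>n. real (idx n t - idx n s) * h n)"
    have \<tau>_bounds: "t - s - h n \<le> \<tau> n" "\<tau> n \<le> t - s + h n" for n
      using idx[OF t0, of n] idx[OF s(1), of n] idx_mono[of s t n] t
      by (auto simp: \<tau>_def of_nat_diff algebra_simps)
    have \<tau>_lim: "\<tau> \<longlonglongrightarrow> t - s"
    proof (rule tendsto_sandwich)
      show "(\<lambda>n. t - s - h n) \<longlonglongrightarrow> t - s" "(\<lambda>n. t - s + h n) \<longlonglongrightarrow> t - s"
        by (auto intro!: tendsto_eq_intros h_lim)
    qed (use \<tau>_bounds in auto)
    have P_lim: "(\<lambda>n. \<Sum>k=idx n s..<idx n t. h n *\<^sub>R y n k) \<longlonglongrightarrow> p t - p s"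
    proof -
      have "(\<Sum>k=idx n s..<idx n t. h n *\<^sub>R y n k)
          = (\<Sum>k<idx n t. h n *\<^sub>R y n k) - (\<Sum>k<idx n s. h n *\<^sub>R y n k)" for n
        using sum_diff_nat_ivl[of 0 "idx n s" "idx n t" "\<lambda>k. h n *\<^sub>R y n k"] idx_mono[of s t n] t
        by (simp add: atLeast0LessThan)
      then show ?thesis using tendsto_diff[OF P[OF t0 t(3)] P[OF s(1) sT]] by simp
    qed
    have "M * (t - s) < d / 2"
      using mult_strict_left_mono[of "t - s" \<rho> M] t M \<rho>(3) by linarith
    then have gap: "0 < d - M * (t - s)" using d(1) by linarith
    have small: "(\<lambda>n. M * h n + norm (x n (idx n s) - u s)) \<longlonglongrightarrow> 0"
      using tendsto_add[OF tendsto_mult_left[OF h_lim, of M] tendsto_norm[OF Lim_null[THEN iffD1, OF U[OF s(1) sT]]]]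
      by simp
    have good: "\<forall>\<^sub>F n in sequentially. M * h n + norm (x n (idx n s) - u s) < d - M * (t - s) \<and> h n < d3 \<and> h n < t - s"
      using order_tendstoD(2)[OF small gap] order_tendstoD(2)[OF h_lim d3(1)]
        order_tendstoD(2)[OF h_lim, of "t - s"] t by (intro eventually_conj) auto
    have close: "norm (x n k - u s) < d \<and> norm (g (x n k) - f (k * h n) - c) \<le> \<delta>"
      if n: "M * h n + norm (x n (idx n s) - u s) < d - M * (t - s)" "h n < d3"
        and k: "idx n s \<le> k" "k < idx n t" for n k
    proof -
      have km: "k \<le> m n" using k idx_le[OF t0 t(3), of n] by simp
      have "norm (x n k - x n (idx n s)) \<le> (\<Sum>l=idx n s..<k. norm (h n *\<^sub>R w n l))"
        using discrete_increment[OF sol k(1)] by (simp only: h_def norm_sum)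
      also have "\<dots> \<le> (\<Sum>l=idx n s..<k. h n * M)"
        using sol[of n] km h[of n] by (intro sum_mono) (auto simp: discrete_solution_def)
      also have "\<dots> = real (k - idx n s) * h n * M" by simp
      also have "\<dots> \<le> \<tau> n * M"
        unfolding \<tau>_def using k h[of n] M by (intro mult_right_mono) auto
      also have "\<dots> \<le> (t - s + h n) * M" using \<tau>_bounds(2)[of n] M by (intro mult_right_mono) auto
      finally have "norm (x n k - x n (idx n s)) \<le> M * (t - s) + M * h n" by (simp add: algebra_simps)
      then have xd: "norm (x n k - u s) < d"
        using norm_triangle_ineq[of "x n k - x n (idx n s)" "x n (idx n s) - u s"] n(1) by simp
      have "real (idx n s) * h n \<le> real k * h n" "(real k + 1) * h n \<le> real (idx n t) * h n"
        using k h[of n] by (auto intro!: mult_right_mono)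
      then have "s - h n < real k * h n" "real k * h n < t"
        using idx(2)[OF s(1), of n] idx(1)[OF t0, of n] h[of n] unfolding distrib_right by linarith+
      then have "\<bar>real k * h n - s\<bar> < d3" "real k * h n \<le> T" using n(2) t \<rho>(2) by auto
      then have "norm (f (real k * h n) - f s) < \<delta> / 2" using d3(2)[of "real k * h n"] h[of n] by simp
      moreover have "norm (g (x n k) - g (u s)) < \<delta> / 2" using d1(2) xd d(2) by simp
      moreover have eq: "g (x n k) - f (real k * h n) - c = (g (x n k) - g (u s)) - (f (real k * h n) - f s)"
        by (simp add: c_def)
      ultimately have "norm (g (x n k) - f (real k * h n) - c) \<le> \<delta>"
        using norm_triangle_ineq4[of "g (x n k) - g (u s)" "f (real k * h n) - f s"]
        unfolding eq by linarith
      with xd show ?thesis by simp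
    qed
    have less: "idx n s < idx n t" if "h n < t - s" for n
    proof (rule ccontr)
      assume "\<not> idx n s < idx n t"
      then have "\<tau> n = 0" by (simp add: \<tau>_def)
      then show False using \<tau>_bounds(1)[of n] that by simp
    qed
    have \<phi>_lim: "(\<lambda>n. \<phi> (X n)) \<longlonglongrightarrow> \<phi> l" if "X \<longlonglongrightarrow> l" for X l
      using continuous[of UNIV] by (intro isCont_tendsto_compose[OF _ that]) (simp add: continuous_on_eq_continuous_at)
    show ?A
    proof (rule tendsto_le[OF sequentially_bot])
      show "(\<lambda>n. \<tau> n * \<phi> z) \<longlonglongrightarrow> (t - s) * \<phi> z" by (intro tendsto_intros \<tau>_lim)
      have "(\<lambda>n. \<tau> n * \<phi> ((1 / \<tau> n) *\<^sub>R (\<Sum>k=idx n s..<idx n t. h n *\<^sub>R y n k))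
            + (c - z) \<bullet> (x n (idx n t) - x n (idx n s)) + \<phi> (x n (idx n t)) - \<phi> (x n (idx n s)) - \<epsilon> n
            - \<tau> n * (M * \<delta> + \<epsilon> n))
          \<longlonglongrightarrow> (t - s) * \<phi> ((1 / (t - s)) *\<^sub>R (p t - p s)) + (c - z) \<bullet> (u t - u s) + \<phi> (u t) - \<phi> (u s)
            - 0 - (t - s) * (M * \<delta> + 0)"
        using t s by (intro tendsto_intros \<phi>_lim \<tau>_lim P_lim U \<epsilon>) auto
      then show "(\<lambda>n. \<tau> n * \<phi> ((1 / \<tau> n) *\<^sub>R (\<Sum>k=idx n s..<idx n t. h n *\<^sub>R y n k))
            + (c - z) \<bullet> (x n (idx n t) - x n (idx n s)) + \<phi> (x n (idx n t)) - \<phi> (x n (idx n s)) - \<epsilon> n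
            - \<tau> n * (M * \<delta> + \<epsilon> n))
          \<longlonglongrightarrow> (t - s) * \<phi> ((1 / (t - s)) *\<^sub>R (p t - p s)) + (c - z) \<bullet> (u t - u s) + \<phi> (u t) - \<phi> (u s)
            - (t - s) * (M * \<delta>)" by simp
      show "\<forall>\<^sub>F n in sequentially. \<tau> n * \<phi> ((1 / \<tau> n) *\<^sub>R (\<Sum>k=idx n s..<idx n t. h n *\<^sub>R y n k))
            + (c - z) \<bullet> (x n (idx n t) - x n (idx n s)) + \<phi> (x n (idx n t)) - \<phi> (x n (idx n s)) - \<epsilon> n
            - \<tau> n * (M * \<delta> + \<epsilon> n) \<le> \<tau> n * \<phi> z"
      proof (rule eventually_mono[OF good])
        fix n assume n: "M * h n + norm (x n (idx n s) - u s) < d - M * (t - s) \<and> h n < d3 \<and> h n < t - s"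
        show "\<tau> n * \<phi> ((1 / \<tau> n) *\<^sub>R (\<Sum>k=idx n s..<idx n t. h n *\<^sub>R y n k))
            + (c - z) \<bullet> (x n (idx n t) - x n (idx n s)) + \<phi> (x n (idx n t)) - \<phi> (x n (idx n s)) - \<epsilon> n
            - \<tau> n * (M * \<delta> + \<epsilon> n) \<le> \<tau> n * \<phi> z"
          unfolding \<tau>_def h_def
          by (rule discrete_inclusion_outer[OF sol less idx_le[OF t0 t(3)]])
            (use n close in \<open>auto simp: h_def\<close>)
      qed
    qed
    show ?B
    proof (rule tendsto_le[OF sequentially_bot])
      show "(\<lambda>n. \<tau> n * \<phi> z) \<longlonglongrightarrow> (t - s) * \<phi> z" by (intro tendsto_intros \<tau>_lim)
      have "(\<lambda>n. \<tau> n * \<phi> (u s) + ((\<Sum>k=idx n s..<idx n t. h n *\<^sub>R y n k) - \<tau> n *\<^sub>R c) \<bullet> (z - u s)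
            - \<tau> n * (\<delta> + \<epsilon> n + \<delta> * norm (z - u s) + (M + norm c + \<delta>) * \<delta>))
          \<longlonglongrightarrow> (t - s) * \<phi> (u s) + ((p t - p s) - (t - s) *\<^sub>R c) \<bullet> (z - u s)
            - (t - s) * (\<delta> + 0 + \<delta> * norm (z - u s) + (M + norm c + \<delta>) * \<delta>)"
        by (intro tendsto_intros \<tau>_lim P_lim \<epsilon>)
      then show "(\<lambda>n. \<tau> n * \<phi> (u s) + ((\<Sum>k=idx n s..<idx n t. h n *\<^sub>R y n k) - \<tau> n *\<^sub>R c) \<bullet> (z - u s)
            - \<tau> n * (\<delta> + \<epsilon> n + \<delta> * norm (z - u s) + (M + norm c + \<delta>) * \<delta>))
          \<longlonglongrightarrow> (t - s) * \<phi> (u s) + ((p t - p s) - (t - s) *\<^sub>R c) \<bullet> (z - u s)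
            - (t - s) * (\<delta> + \<delta> * norm (z - u s) + (M + norm c + \<delta>) * \<delta>)" by simp
      show "\<forall>\<^sub>F n in sequentially. \<tau> n * \<phi> (u s)
            + ((\<Sum>k=idx n s..<idx n t. h n *\<^sub>R y n k) - \<tau> n *\<^sub>R c) \<bullet> (z - u s)
            - \<tau> n * (\<delta> + \<epsilon> n + \<delta> * norm (z - u s) + (M + norm c + \<delta>) * \<delta>) \<le> \<tau> n * \<phi> z"
      proof (rule eventually_mono[OF good])
        fix n assume n: "M * h n + norm (x n (idx n s) - u s) < d - M * (t - s) \<and> h n < d3 \<and> h n < t - s"
        show "\<tau> n * \<phi> (u s)
            + ((\<Sum>k=idx n s..<idx n t. h n *\<^sub>R y n k) - \<tau> n *\<^sub>R c) \<bullet> (z - u s)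
            - \<tau> n * (\<delta> + \<epsilon> n + \<delta> * norm (z - u s) + (M + norm c + \<delta>) * \<delta>) \<le> \<tau> n * \<phi> z"
          unfolding \<tau>_def h_def
        proof (rule discrete_inclusion_inner[OF sol less idx_le[OF t0 t(3)]])
          fix k assume k: "idx n s \<le> k" "k < idx n t"
          have xk: "norm (x n k - u s) < d" "norm (g (x n k) - f (k * h n) - c) \<le> \<delta>"
            using close[of n k] n k by auto
          then show "norm (x n k - u s) \<le> \<delta>" using d(4) by simp
          show "norm (g (x n k) - f (k * (T / m n)) - c) \<le> \<delta>" using xk(2) by (simp add: h_def)
          show "\<phi> (u s) - \<delta> \<le> \<phi> (x n k)"
            using d2(2)[of "x n k"] xk(1) d(3) by (auto simp: abs_less_iff)
        qed (use n in auto)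
      qed
    qed
  qed
  show ?thesis by (rule that[OF \<rho>(1) main])
qed


text \<open>Both limit functions are right differentiable almost everywhere. At such a point \<open>s\<close> the local
  inequalities, divided by \<open>t - s\<close>, give the two inclusions as \<open>t\<close> decreases to \<open>s\<close> and then \<open>\<delta>\<close> to 0;
  the second inclusion bounds the difference quotient of \<open>\<phi> \<circ> u\<close> in the first one from below.\<close>

theorem solution_exists:
  obtains C u v \<mu> N where "C-lipschitz_on {0..T} u" "u 0 = u\<^sub>0"
    "v \<in> borel_measurable borel" "\<And>t. norm (v t) \<le> C"
    "\<mu> \<in> borel_measurable borel" "\<And>t. norm (\<mu> t) \<le> C" "negligible N"
    "\<And>t. t \<notin> N \<Longrightarrow> 0 \<le> t \<Longrightarrow> t < T \<Longrightarrow> ((\<lambda>h. (u (t + h) - u t) /\<^sub>R h) \<longlongrightarrow> v t) (at_right 0)"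
    "\<And>t. t \<notin> N \<Longrightarrow> 0 \<le> t \<Longrightarrow> t < T \<Longrightarrow> - v t \<in> subdifferential \<phi> (\<mu> t)"
    "\<And>t. t \<notin> N \<Longrightarrow> 0 \<le> t \<Longrightarrow> t < T \<Longrightarrow> \<mu> t - (g (u t) - f t) \<in> subdifferential \<phi> (u t)"
proof -
  obtain M where M: "M > 0" and ex: "\<And>\<epsilon>. \<epsilon> > 0 \<Longrightarrow> \<exists>m u v \<mu>. discrete_solution M \<epsilon> m u v \<mu>"
    using discrete_solutions_exist by blast
  define \<epsilon> where "\<epsilon> = (\<lambda>n::nat. 1 / (real n + 1))"
  have \<epsilon>_pos: "0 < \<epsilon> n" "\<epsilon> n \<le> 1" for n by (auto simp: \<epsilon>_def)
  have \<epsilon>: "\<epsilon> \<longlonglongrightarrow> 0" unfolding \<epsilon>_def by real_asymp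
  have "\<forall>n. \<exists>m u v \<mu>. discrete_solution M (\<epsilon> n) m u v \<mu>" using ex \<epsilon>_pos by blast
  then obtain m x w y where sol: "\<And>n. discrete_solution M (\<epsilon> n) (m n) (x n) (w n) (y n)" by metis
  define h where "h = (\<lambda>n. T / m n)"
  have m: "0 < m n" and h_le: "h n \<le> \<epsilon> n" for n using sol[of n] by (auto simp: discrete_solution_def h_def)
  have h: "0 < h n" and mh: "real (m n) * h n = T" for n using m[of n] T_pos by (auto simp: h_def)
  have h_lim: "h \<longlonglongrightarrow> 0"
    by (rule tendsto_sandwich[OF _ _ tendsto_const \<epsilon>]) (use h h_le in \<open>auto intro!: always_eventually less_imp_le\<close>)
  define idx where "idx = (\<lambda>n. mesh_index (h n))"
  have idx: "real (idx n t) * h n \<le> t" "t < (real (idx n t) + 1) * h n" if "0 \<le> t" for n t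
    unfolding idx_def by (fact mesh_index_bounds[OF h that])+
  have idx_le: "idx n t \<le> m n" if "0 \<le> t" "t \<le> T" for n t
    unfolding idx_def by (rule mesh_index_le[OF h that(1)]) (use that mh in simp)
  have idx_mono: "idx n a \<le> idx n b" if "a \<le> b" for n a b
    unfolding idx_def by (rule mesh_index_mono[OF h that])
  have idx_0: "idx n 0 = 0" for n by (simp add: idx_def mesh_index_def)
  \<comment> \<open>The states are paired with the primitives of the chemical potentials, to extract one
    subsequence for both.\<close>
  define X where "X = (\<lambda>n t. (x n (idx n t), \<Sum>k<idx n t. h n *\<^sub>R y n k))"
  have increment: "norm (\<Sum>k=idx n s..<idx n t. h n *\<^sub>R z k) \<le> M * (t - s + h n)"
    if st: "0 \<le> s" "s \<le> t" "t \<le> T" and z: "\<And>k. k \<le> m n \<Longrightarrow> norm (z k) \<le> M" for n s t z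
  proof -
    have "norm (\<Sum>k=idx n s..<idx n t. h n *\<^sub>R z k) \<le> (\<Sum>k=idx n s..<idx n t. h n * M)"
      using z idx_le[of t n] st h[of n] by (intro sum_norm_le) auto
    also have "\<dots> = (real (idx n t) * h n - real (idx n s) * h n) * M"
      using idx_mono[OF st(2), of n] by (simp add: of_nat_diff algebra_simps)
    also have "\<dots> \<le> (t - s + h n) * M"
    proof (rule mult_right_mono)
      show "real (idx n t) * h n - real (idx n s) * h n \<le> t - s + h n"
        using idx(1)[of t n] idx(2)[of s n] st unfolding distrib_right by linarith
    qed (use M in simp)
    finally show ?thesis by (simp add: mult.commute)
  qed
  have X_diff: "X n t - X n s = (\<Sum>k=idx n s..<idx n t. h n *\<^sub>R w n k, \<Sum>k=idx n s..<idx n t. h n *\<^sub>R y n k)"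
    if "s \<le> t" for n s t
    using discrete_increment[OF sol idx_mono[OF that], of n] idx_mono[OF that, of n]
      sum_diff_nat_ivl[of 0 "idx n s" "idx n t" "\<lambda>k. h n *\<^sub>R y n k"]
    by (simp add: X_def h_def atLeast0LessThan)
  have bounds: "norm (x n k) \<le> M" "norm (w n k) \<le> M" "norm (y n k) \<le> M" if "k \<le> m n" for n k
    using sol[of n] that by (auto simp: discrete_solution_def)
  have X_lip: "norm (X n t - X n s) \<le> (2 * M) * (t - s + h n)" if "0 \<le> s" "s \<le> t" "t \<le> T" for n s t
  proof -
    have "norm (X n t - X n s) \<le> norm (\<Sum>k=idx n s..<idx n t. h n *\<^sub>R w n k)
        + norm (\<Sum>k=idx n s..<idx n t. h n *\<^sub>R y n k)"
      unfolding X_diff[OF that(2)] by (rule norm_Pair_le)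
    then show ?thesis using increment[OF that, of n "w n"] increment[OF that, of n "y n"] bounds by force
  qed
  have X_bound: "norm (X n t) \<le> M + (2 * M) * (T + 1)" if t: "0 \<le> t" "t \<le> T" for n t
  proof -
    have "X n 0 = (x n 0, 0)" by (simp add: X_def idx_0)
    then have "norm (X n 0) \<le> M" using bounds(1)[of 0 n] by (simp add: norm_Pair)
    moreover have "norm (X n t - X n 0) \<le> (2 * M) * (T + 1)"
    proof (rule order_trans[OF X_lip[of 0 t n]])
      show "2 * M * (t - 0 + h n) \<le> 2 * M * (T + 1)"
        using M t h_le[of n] \<epsilon>_pos(2)[of n] by (intro mult_left_mono) auto
    qed (use t in auto)
    ultimately show ?thesis using norm_triangle_ineq[of "X n 0" "X n t - X n 0"] by simp
  qed
  obtain r Y where r: "strict_mono r" "\<And>t. 0 \<le> t \<Longrightarrow> t \<le> T \<Longrightarrow> (\<lambda>n. X (r n) t) \<longlonglongrightarrow> Y t"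
      and Y: "(2 * M)-lipschitz_on {0..T} Y"
    by (rule almost_lipschitz_subsequence[OF X_lip h_lim X_bound T_pos]) (use M in auto)
  define u p where "u = (\<lambda>t. fst (Y t))" and "p = (\<lambda>t. snd (Y t))"
  have u_lip: "(2 * M)-lipschitz_on {0..T} u" and p_lip: "(2 * M)-lipschitz_on {0..T} p"
    using Y unfolding lipschitz_on_def u_def p_def
    by (auto intro: order_trans[OF dist_fst_le] order_trans[OF dist_snd_le])
  have U: "(\<lambda>n. x (r n) (idx (r n) t)) \<longlonglongrightarrow> u t"
    and P: "(\<lambda>n. \<Sum>k<idx (r n) t. h (r n) *\<^sub>R y (r n) k) \<longlonglongrightarrow> p t" if "0 \<le> t" "t \<le> T" for t
    using tendsto_fst[OF r(2)[OF that]] tendsto_snd[OF r(2)[OF that]] by (auto simp: X_def u_def p_def)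
  have u0: "u 0 = u\<^sub>0"
  proof (rule LIMSEQ_unique[OF U])
    show "(\<lambda>n. x (r n) (idx (r n) 0)) \<longlonglongrightarrow> u\<^sub>0"
      using sol by (simp add: idx_0 discrete_solution_def)
  qed (use T_pos in auto)
  obtain v N1 where v: "v \<in> borel_measurable borel" "\<And>t. norm (v t) \<le> 2 * M" "negligible N1"
    "\<And>t. t \<notin> N1 \<Longrightarrow> 0 \<le> t \<Longrightarrow> t < T \<Longrightarrow> ((\<lambda>h. (u (t + h) - u t) /\<^sub>R h) \<longlongrightarrow> v t) (at_right 0)"
    by (rule lipschitz_derivative_on[OF u_lip T_pos]) blast
  obtain \<mu> N2 where \<mu>: "\<mu> \<in> borel_measurable borel" "\<And>t. norm (\<mu> t) \<le> 2 * M" "negligible N2"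
    "\<And>t. t \<notin> N2 \<Longrightarrow> 0 \<le> t \<Longrightarrow> t < T \<Longrightarrow> ((\<lambda>h. (p (t + h) - p t) /\<^sub>R h) \<longlongrightarrow> \<mu> t) (at_right 0)"
    by (rule lipschitz_derivative_on[OF p_lip T_pos]) blast
  have inclusions: "- v s \<in> subdifferential \<phi> (\<mu> s) \<and> \<mu> s - (g (u s) - f s) \<in> subdifferential \<phi> (u s)"
    if s: "s \<notin> N1 \<union> N2" "0 \<le> s" "s < T" for s
  proof -
    define c where "c = g (u s) - f s"
    define V where "V = (\<lambda>h. (u (s + h) - u s) /\<^sub>R h)"
    define Q where "Q = (\<lambda>h. (p (s + h) - p s) /\<^sub>R h)"
    have V_lim: "(V \<longlongrightarrow> v s) (at_right 0)" and Q_lim: "(Q \<longlongrightarrow> \<mu> s) (at_right 0)"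
      using v(4) \<mu>(4) s by (auto simp: V_def Q_def)
    have local: "\<forall>\<^sub>F h in at_right 0.
        \<phi> (Q h) + (c - z) \<bullet> V h + (\<phi> (u (s + h)) - \<phi> (u s)) / h - M * \<delta> \<le> \<phi> z \<and>
        \<phi> (u s) + (Q h - c) \<bullet> (z - u s) - (\<delta> + \<delta> * norm (z - u s) + (M + norm c + \<delta>) * \<delta>) \<le> \<phi> z"
      if \<delta>: "0 < \<delta>" for \<delta> z
    proof -
      obtain \<rho> where \<rho>: "0 < \<rho>" and A:
          "\<And>t z. s < t \<Longrightarrow> t < s + \<rho> \<Longrightarrow> t \<le> T \<Longrightarrow>
            (t - s) * \<phi> ((1 / (t - s)) *\<^sub>R (p t - p s)) + (c - z) \<bullet> (u t - u s) + \<phi> (u t) - \<phi> (u s)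
              - (t - s) * (M * \<delta>) \<le> (t - s) * \<phi> z"
          "\<And>t z. s < t \<Longrightarrow> t < s + \<rho> \<Longrightarrow> t \<le> T \<Longrightarrow>
            (t - s) * \<phi> (u s) + ((p t - p s) - (t - s) *\<^sub>R c) \<bullet> (z - u s)
              - (t - s) * (\<delta> + \<delta> * norm (z - u s) + (M + norm c + \<delta>) * \<delta>) \<le> (t - s) * \<phi> z"
        unfolding c_def
        by (rule local_inequalities[of M "\<lambda>n. \<epsilon> (r n)" "\<lambda>n. m (r n)" "\<lambda>n. x (r n)" "\<lambda>n. w (r n)" "\<lambda>n. y (r n)" u p s \<delta>])
          (use sol M U P s \<delta> LIMSEQ_subseq_LIMSEQ[OF \<epsilon> r(1)] in \<open>auto simp: idx_def h_def o_def\<close>)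
      show ?thesis
      proof (rule eventually_mono[OF eventually_at_right_real[of 0 "min \<rho> (T - s)"]])
        fix h assume "h \<in> {0<..<min \<rho> (T - s)}"
        then have h: "0 < h" "s < s + h" "s + h < s + \<rho>" "s + h \<le> T" by auto
        have "p (s + h) - p s = h *\<^sub>R Q h" "u (s + h) - u s = h *\<^sub>R V h"
            "\<phi> (u (s + h)) - \<phi> (u s) = h * ((\<phi> (u (s + h)) - \<phi> (u s)) / h)"
          using h by (auto simp: Q_def V_def)
        note eqs = this
        have "h * (\<phi> (Q h) + (c - z) \<bullet> V h + (\<phi> (u (s + h)) - \<phi> (u s)) / h - M * \<delta>) \<le> h * \<phi> z"
          using A(1)[OF h(2-4), of z] h(1) eqs by (simp add: algebra_simps)
        moreover have "h * (\<phi> (u s) + (Q h - c) \<bullet> (z - u s)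
            - (\<delta> + \<delta> * norm (z - u s) + (M + norm c + \<delta>) * \<delta>)) \<le> h * \<phi> z"
          using A(2)[OF h(2-4), of z] unfolding eqs(1) by (simp add: algebra_simps)
        ultimately show "\<phi> (Q h) + (c - z) \<bullet> V h + (\<phi> (u (s + h)) - \<phi> (u s)) / h - M * \<delta> \<le> \<phi> z \<and>
            \<phi> (u s) + (Q h - c) \<bullet> (z - u s) - (\<delta> + \<delta> * norm (z - u s) + (M + norm c + \<delta>) * \<delta>) \<le> \<phi> z"
          using h(1) by simp
      qed (use \<rho> s in auto)
    qed
    have inner: "(\<mu> s - c) \<bullet> (z - u s) \<le> \<phi> z - \<phi> (u s)" for z
    proof -
      have "\<phi> (u s) + (\<mu> s - c) \<bullet> (z - u s) \<le> \<phi> z"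
      proof (rule le_if_le_up_to_small[where b = "1 + norm (z - u s) + M + norm c"])
        fix \<delta> :: real assume \<delta>: "0 < \<delta>"
        have "\<phi> (u s) + (\<mu> s - c) \<bullet> (z - u s) - (\<delta> + \<delta> * norm (z - u s) + (M + norm c + \<delta>) * \<delta>) \<le> \<phi> z"
        proof (rule tendsto_upperbound)
          show "((\<lambda>h. \<phi> (u s) + (Q h - c) \<bullet> (z - u s) - (\<delta> + \<delta> * norm (z - u s) + (M + norm c + \<delta>) * \<delta>))
              \<longlongrightarrow> \<phi> (u s) + (\<mu> s - c) \<bullet> (z - u s) - (\<delta> + \<delta> * norm (z - u s) + (M + norm c + \<delta>) * \<delta>)) (at_right 0)"
            by (intro tendsto_intros Q_lim)
        qed (use eventually_mono[OF local[OF \<delta>, of z]] in auto)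
        then show "\<phi> (u s) + (\<mu> s - c) \<bullet> (z - u s) - \<delta> * (1 + norm (z - u s) + M + norm c + \<delta>) \<le> \<phi> z"
          by (simp add: algebra_simps)
      qed
      then show ?thesis by simp
    qed
    have outer: "- v s \<bullet> (z - \<mu> s) \<le> \<phi> z - \<phi> (\<mu> s)" for z
    proof -
      have "\<phi> (\<mu> s) + (\<mu> s - z) \<bullet> v s \<le> \<phi> z"
      proof (rule le_if_le_up_to_small[where b = M])
        fix \<delta> :: real assume \<delta>: "0 < \<delta>"
        have "\<phi> (\<mu> s) + (c - z) \<bullet> v s + (\<mu> s - c) \<bullet> v s - M * \<delta> \<le> \<phi> z"
        proof (rule tendsto_upperbound)
          have "isCont \<phi> (\<mu> s)" using continuous[of UNIV] by (simp add: continuous_on_eq_continuous_at)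
          from isCont_tendsto_compose[OF this Q_lim]
          show "((\<lambda>h. \<phi> (Q h) + (c - z) \<bullet> V h + (\<mu> s - c) \<bullet> V h - M * \<delta>)
              \<longlongrightarrow> \<phi> (\<mu> s) + (c - z) \<bullet> v s + (\<mu> s - c) \<bullet> v s - M * \<delta>) (at_right 0)"
            by (intro tendsto_intros V_lim)
          show "\<forall>\<^sub>F h in at_right 0. \<phi> (Q h) + (c - z) \<bullet> V h + (\<mu> s - c) \<bullet> V h - M * \<delta> \<le> \<phi> z"
          proof (rule eventually_elim2[OF local[OF \<delta>, of z] eventually_at_right_less])
            fix h :: real
            assume h: "\<phi> (Q h) + (c - z) \<bullet> V h + (\<phi> (u (s + h)) - \<phi> (u s)) / h - M * \<delta> \<le> \<phi> z \<and>
              \<phi> (u s) + (Q h - c) \<bullet> (z - u s) - (\<delta> + \<delta> * norm (z - u s) + (M + norm c + \<delta>) * \<delta>) \<le> \<phi> z"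
              "0 < h"
            have "(\<mu> s - c) \<bullet> V h = ((\<mu> s - c) \<bullet> (u (s + h) - u s)) / h"
              by (simp add: V_def divide_inverse)
            also have "\<dots> \<le> (\<phi> (u (s + h)) - \<phi> (u s)) / h"
              using inner h(2) by (intro divide_right_mono) auto
            finally show "\<phi> (Q h) + (c - z) \<bullet> V h + (\<mu> s - c) \<bullet> V h - M * \<delta> \<le> \<phi> z" using h(1) by linarith
          qed
        qed simp
        moreover have "(c - z) \<bullet> v s + (\<mu> s - c) \<bullet> v s = (\<mu> s - z) \<bullet> v s"
          by (simp add: inner_diff_left)
        moreover have "M * \<delta> \<le> \<delta> * (M + \<delta>)" using \<delta> by (simp add: algebra_simps)
        ultimately show "\<phi> (\<mu> s) + (\<mu> s - z) \<bullet> v s - \<delta> * (M + \<delta>) \<le> \<phi> z" by linarith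
      qed
      then show ?thesis by (simp add: inner_diff_left inner_diff_right inner_commute)
    qed
    show ?thesis using inner outer by (auto simp: subdifferential_def c_def)
  qed
  show ?thesis
    by (rule that[of "2 * M" u v \<mu> "N1 \<union> N2"])
      (use u_lip u0 v \<mu> inclusions in \<open>auto simp: negligible_Un_eq\<close>)
qed

end

section \<open>The hypergraph energy\<close>

lemma edge_spread_image: "edge_spread e x = Max ((\<lambda>(i, j). \<bar>x $ i - x $ j\<bar>) ` (e \<times> e))"
proof -
  have "{\<bar>x $ i - x $ j\<bar> | i j. i \<in> e \<and> j \<in> e} = (\<lambda>(i, j). \<bar>x $ i - x $ j\<bar>) ` (e \<times> e)" by auto
  then show ?thesis by (simp add: edge_spread_def)
qed

lemma edge_spread_ge: "i \<in> e \<Longrightarrow> j \<in> e \<Longrightarrow> \<bar>x $ i - x $ j\<bar> \<le> edge_spread e x"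
  for e :: "'n::finite set"
  unfolding edge_spread_image by (intro Max_ge) auto

lemma edge_spread_le:
  fixes e :: "'n::finite set"
  assumes "e \<noteq> {}" "\<And>i j. i \<in> e \<Longrightarrow> j \<in> e \<Longrightarrow> \<bar>x $ i - x $ j\<bar> \<le> b"
  shows "edge_spread e x \<le> b"
  unfolding edge_spread_image using assms by (subst Max_le_iff) auto

lemma edge_spread_nonneg:
  fixes e :: "'n::finite set"
  assumes "e \<noteq> {}"
  shows "0 \<le> edge_spread e x"
proof -
  obtain i where "i \<in> e" using assms by blast
  then show ?thesis using edge_spread_ge[of i e i x] by simp
qed

lemma edge_spread_convex:
  fixes e :: "'n::finite set"
  assumes "e \<noteq> {}" "0 \<le> t" "t \<le> 1"
  shows "edge_spread e ((1 - t) *\<^sub>R x + t *\<^sub>R y) \<le> (1 - t) * edge_spread e x + t * edge_spread e y"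
proof (rule edge_spread_le[OF assms(1)])
  fix i j assume ij: "i \<in> e" "j \<in> e"
  have "((1 - t) *\<^sub>R x + t *\<^sub>R y) $ i - ((1 - t) *\<^sub>R x + t *\<^sub>R y) $ j
      = (1 - t) * (x $ i - x $ j) + t * (y $ i - y $ j)" by (simp add: algebra_simps)
  also have "\<bar>\<dots>\<bar> \<le> (1 - t) * \<bar>x $ i - x $ j\<bar> + t * \<bar>y $ i - y $ j\<bar>"
    using assms by (intro order_trans[OF abs_triangle_ineq]) (simp add: abs_mult)
  also have "\<dots> \<le> (1 - t) * edge_spread e x + t * edge_spread e y"
    using edge_spread_ge[OF ij] assms by (intro add_mono mult_left_mono) auto
  finally show "\<bar>((1 - t) *\<^sub>R x + t *\<^sub>R y) $ i - ((1 - t) *\<^sub>R x + t *\<^sub>R y) $ j\<bar>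
      \<le> (1 - t) * edge_spread e x + t * edge_spread e y" .
qed

lemma powr_convex_nonneg:
  fixes a b p t :: real
  assumes p: "1 \<le> p" and "0 \<le> a" "0 \<le> b" "0 < t" "t < 1"
  shows "((1 - t) * a + t * b) powr p \<le> (1 - t) * a powr p + t * b powr p"
proof -
  have scale: "(s * x) powr p \<le> s * x powr p" if "0 < s" "s < 1" "0 \<le> x" for s x :: real
  proof -
    have "s powr p \<le> s powr 1" using that p by (intro powr_mono') auto
    then show ?thesis using that by (simp add: powr_mult mult_right_mono)
  qed
  consider "a = 0" | "b = 0" | "0 < a" "0 < b" using assms by linarith
  then show ?thesis
  proof cases
    case 1
    then show ?thesis using scale[of t b] assms by simp
  next
    case 2
    then show ?thesis using scale[of "1 - t" a] assms by simp
  next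
    case 3
    then show ?thesis using convex_onD[OF powr_convex[OF p], of t a b] assms by simp
  qed
qed

lemma hypergraph_energy_potential:
  fixes E :: "'n::finite set set"
  assumes G: "weighted_hypergraph E w" and p: "1 \<le> p"
  shows "convex_potential (hypergraph_energy E w p)"
proof
  have ne: "e \<noteq> {}" and w: "0 \<le> w e" if "e \<in> E" for e
    using G that by (auto simp: weighted_hypergraph_def intro: less_imp_le)
  show "0 \<le> hypergraph_energy E w p x" for x
    unfolding hypergraph_energy_def using p w by (intro mult_nonneg_nonneg sum_nonneg) auto
  have "edge_spread e 0 = 0" if "e \<in> E" for e
    using edge_spread_le[OF ne[OF that], of 0 0] edge_spread_nonneg[OF ne[OF that], of 0] by simp
  then show "hypergraph_energy E w p 0 = 0" by (simp add: hypergraph_energy_def)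
  show "convex_on UNIV (hypergraph_energy E w p)"
  proof (rule convex_onI)
    fix t :: real and x y :: "real ^ 'n"
    assume t: "0 < t" "t < 1"
    have "edge_spread e ((1 - t) *\<^sub>R x + t *\<^sub>R y) powr p
        \<le> (1 - t) * edge_spread e x powr p + t * edge_spread e y powr p" if e: "e \<in> E" for e
    proof -
      have "edge_spread e ((1 - t) *\<^sub>R x + t *\<^sub>R y) powr p
          \<le> ((1 - t) * edge_spread e x + t * edge_spread e y) powr p"
        using edge_spread_convex[OF ne[OF e], of t x y] edge_spread_nonneg[OF ne[OF e]] t p
        by (intro powr_mono2) auto
      also have "\<dots> \<le> (1 - t) * edge_spread e x powr p + t * edge_spread e y powr p"
        using t edge_spread_nonneg[OF ne[OF e]] by (intro powr_convex_nonneg p) auto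
      finally show ?thesis .
    qed
    then have "(\<Sum>e\<in>E. w e * edge_spread e ((1 - t) *\<^sub>R x + t *\<^sub>R y) powr p)
        \<le> (\<Sum>e\<in>E. w e * ((1 - t) * edge_spread e x powr p + t * edge_spread e y powr p))"
      using w by (intro sum_mono mult_left_mono) auto
    also have "\<dots> = (1 - t) * (\<Sum>e\<in>E. w e * edge_spread e x powr p) + t * (\<Sum>e\<in>E. w e * edge_spread e y powr p)"
      by (simp add: sum_distrib_left sum.distrib[symmetric] algebra_simps)
    finally have "(1 / p) * (\<Sum>e\<in>E. w e * edge_spread e ((1 - t) *\<^sub>R x + t *\<^sub>R y) powr p)
        \<le> (1 / p) * ((1 - t) * (\<Sum>e\<in>E. w e * edge_spread e x powr p) + t * (\<Sum>e\<in>E. w e * edge_spread e y powr p))"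
      using p by (intro mult_left_mono) auto
    then show "hypergraph_energy E w p ((1 - t) *\<^sub>R x + t *\<^sub>R y)
        \<le> (1 - t) * hypergraph_energy E w p x + t * hypergraph_energy E w p y"
      unfolding hypergraph_energy_def by (simp only: distrib_left mult.left_commute)
  qed simp
qed

section \<open>The power nonlinearity with a Lipschitz perturbation\<close>

lemma gderiv_norm_powr:
  fixes x :: "'a::real_inner"
  assumes q: "2 < q"
  shows "GDERIV (\<lambda>x. norm x powr q) x :> q *\<^sub>R (norm x powr (q - 2) *\<^sub>R x)"
proof (cases "x = 0")
  case True
  have "((\<lambda>y. norm y powr q) has_derivative (\<lambda>h. 0)) (at (0::'a))"
    unfolding has_derivative_at2
  proof (intro conjI)
    show "(\<lambda>y::'a. (1 / norm (y - 0)) *\<^sub>R (norm y powr q - (norm (0::'a) powr q + 0))) \<midarrow>0\<rightarrow> (0::real)"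
    proof (rule Lim_null_comparison)
      show "((\<lambda>y::'a. norm y) \<longlongrightarrow> 0) (at 0)" by (rule tendsto_norm_zero) simp
      show "\<forall>\<^sub>F y in at (0::'a).
          norm ((1 / norm (y - 0)) *\<^sub>R (norm y powr q - (norm (0::'a) powr q + 0))) \<le> norm y"
        unfolding eventually_at
      proof (intro exI[of _ 1] conjI ballI impI)
        fix y :: 'a assume y: "y \<noteq> 0 \<and> dist y 0 < 1"
        have "norm y powr q \<le> norm y powr 2" using y q by (intro powr_mono') auto
        also have "\<dots> = norm y * norm y" using y by (simp add: power2_eq_square)
        finally have "norm y powr q / norm y \<le> norm y" using y by (simp add: divide_le_eq)
        then show "norm ((1 / norm (y - 0)) *\<^sub>R (norm y powr q - (norm (0::'a) powr q + 0))) \<le> norm y"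
          using q by simp
      qed simp
    qed
  qed simp
  then show ?thesis using True by (simp add: gderiv_def)
next
  case False
  have "GDERIV (\<lambda>x. norm x powr q) x :> (q * norm x powr (q - 1)) *\<^sub>R sgn x"
    by (rule GDERIV_DERIV_compose[OF GDERIV_norm[OF False] has_real_derivative_powr]) (use False in simp)
  moreover have "(q * norm x powr (q - 1)) *\<^sub>R sgn x = q *\<^sub>R (norm x powr (q - 2) *\<^sub>R x)"
  proof -
    have "norm x powr (q - 1) = norm x powr (q - 2) * norm x"
      using powr_add[of "norm x" "q - 2" 1] False by simp
    then show ?thesis using False by (simp add: sgn_div_norm)
  qed
  ultimately show ?thesis by simp
qed

lemma lipschitz_primitive_lower_bound:
  fixes k :: "'a::real_inner \<Rightarrow> real"
  assumes k: "\<And>x. GDERIV k x :> \<pi> x" and L: "L-lipschitz_on UNIV \<pi>"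
  shows "k 0 - (norm (\<pi> 0) + L * norm x) * norm x \<le> k x"
proof -
  obtain s where s: "0 < s" "s < 1" "k x - k 0 = \<pi> (0 + s *\<^sub>R (x - 0)) \<bullet> (x - 0)"
    using gderiv_increment[OF k] by blast
  have L0: "0 \<le> L" using L by (rule lipschitz_on_nonneg)
  have "norm (\<pi> (s *\<^sub>R x)) \<le> norm (\<pi> 0) + norm (\<pi> (s *\<^sub>R x) - \<pi> 0)"
    using norm_triangle_ineq[of "\<pi> 0" "\<pi> (s *\<^sub>R x) - \<pi> 0"] by simp
  also have "norm (\<pi> (s *\<^sub>R x) - \<pi> 0) \<le> L * norm (s *\<^sub>R x)"
    using lipschitz_onD[OF L, of "s *\<^sub>R x" 0] by (simp add: dist_norm)
  also have "\<dots> \<le> L * norm x" using s L0 by (intro mult_left_mono) (auto simp: mult_left_le_one_le)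
  finally have "norm (\<pi> (s *\<^sub>R x)) * norm x \<le> (norm (\<pi> 0) + L * norm x) * norm x"
    by (intro mult_right_mono) auto
  moreover have "\<bar>\<pi> (s *\<^sub>R x) \<bullet> x\<bar> \<le> norm (\<pi> (s *\<^sub>R x)) * norm x" by (rule Cauchy_Schwarz_ineq2)
  ultimately show ?thesis using s(3) by simp
qed

text \<open>Since \<open>q > 2\<close>, the power dominates any quadratic, and with it the at most quadratic decrease of a
  primitive of a Lipschitz field.\<close>

lemma powr_primitive_superlinear:
  fixes k :: "'a::real_inner \<Rightarrow> real"
  assumes k: "\<And>x. GDERIV k x :> \<pi> x" and L: "L-lipschitz_on UNIV \<pi>" and a: "0 < a" and q: "2 < q"
  shows "\<exists>D. \<forall>x. c * norm x - D \<le> a / q * norm x powr q + k x"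
proof -
  have L0: "0 \<le> L" using L by (rule lipschitz_on_nonneg)
  define A where "A = (L + 1) * q / a"
  have A: "0 < A" using L0 a q by (simp add: A_def)
  \<comment> \<open>\<open>b\<close> is chosen so that \<open>a / q * b powr (q - 2) = L + 1\<close>.\<close>
  define b where "b = A powr (1 / (q - 2))"
  have b: "0 < b" "b powr (q - 2) = A" using A q by (auto simp: b_def powr_powr)
  have quadratic: "A * r\<^sup>2 - A * b\<^sup>2 \<le> r powr q" if r: "0 \<le> r" for r
  proof (cases "b \<le> r")
    case True
    have "A * r\<^sup>2 \<le> r powr (q - 2) * r\<^sup>2"
      using True b q by (intro mult_right_mono) (auto simp flip: b(2) intro!: powr_mono2)
    also have "\<dots> = r powr q" using powr_add[of r "q - 2" 2] r True b by (simp add: powr_numeral)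
    finally show ?thesis using mult_nonneg_nonneg[OF less_imp_le[OF A] zero_le_power2[of b]] by linarith
  next
    case False
    then have "A * r\<^sup>2 \<le> A * b\<^sup>2" using A r by (intro mult_left_mono power_mono) auto
    then show ?thesis by (simp add: order_trans[of _ 0])
  qed
  define N where "N = norm (\<pi> 0) + c"
  have "c * norm x - ((L + 1) * b\<^sup>2 - k 0 + N\<^sup>2 / 4) \<le> a / q * norm x powr q + k x" for x
  proof -
    have "a / q * (A * (norm x)\<^sup>2 - A * b\<^sup>2) \<le> a / q * norm x powr q"
      using quadratic[of "norm x"] a q by (intro mult_left_mono) auto
    moreover have "a / q * (A * (norm x)\<^sup>2 - A * b\<^sup>2) = (L + 1) * (norm x)\<^sup>2 - (L + 1) * b\<^sup>2"
      using a q by (simp add: A_def field_simps)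
    moreover have "k 0 - norm (\<pi> 0) * norm x - L * (norm x)\<^sup>2 \<le> k x"
      using lipschitz_primitive_lower_bound[OF k L, of x] by (simp add: algebra_simps power2_eq_square)
    moreover have "N * norm x \<le> (norm x)\<^sup>2 + N\<^sup>2 / 4"
      using zero_le_power2[of "norm x - N / 2"] by (simp add: power2_eq_square algebra_simps)
    ultimately show ?thesis unfolding N_def distrib_right by simp
  qed
  then show ?thesis by blast
qed

section \<open>Solutions of the hypergraph system\<close>

lemma lipschitz_abs_continuous_on:
  fixes u :: "real \<Rightarrow> 'a::real_normed_vector"
  assumes u: "C-lipschitz_on {a..b} u"
  shows "abs_continuous_on a b u"
  unfolding abs_continuous_on_def
proof (intro allI impI)
  fix e :: real assume e: "0 < e"
  have C: "0 \<le> C" using u by (rule lipschitz_on_nonneg)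
  show "\<exists>\<delta>>0. \<forall>(n::nat) x y. (\<forall>i<n. a \<le> x i \<and> x i \<le> y i \<and> y i \<le> b) \<and>
      disjoint_family_on (\<lambda>i. {x i<..<y i}) {..<n} \<and> (\<Sum>i<n. y i - x i) < \<delta> \<longrightarrow>
      (\<Sum>i<n. norm (u (y i) - u (x i))) < e"
  proof (intro exI[of _ "e / (C + 1)"] conjI allI impI)
    show "0 < e / (C + 1)" using e C by simp
    fix n :: nat and x y :: "nat \<Rightarrow> real"
    assume xy: "(\<forall>i<n. a \<le> x i \<and> x i \<le> y i \<and> y i \<le> b) \<and>
      disjoint_family_on (\<lambda>i. {x i<..<y i}) {..<n} \<and> (\<Sum>i<n. y i - x i) < e / (C + 1)"
    have "(\<Sum>i<n. norm (u (y i) - u (x i))) \<le> (\<Sum>i<n. C * (y i - x i))"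
    proof (rule sum_mono)
      fix i assume "i \<in> {..<n}"
      then have "a \<le> x i" "x i \<le> y i" "y i \<le> b" using xy by auto
      then show "norm (u (y i) - u (x i)) \<le> C * (y i - x i)"
        using lipschitz_onD[OF u, of "y i" "x i"] by (simp add: dist_norm)
    qed
    also have "\<dots> = C * (\<Sum>i<n. y i - x i)" by (simp add: sum_distrib_left)
    also have "\<dots> \<le> (C + 1) * (\<Sum>i<n. y i - x i)"
      using xy by (intro mult_right_mono sum_nonneg) auto
    also have "\<dots> < e"
      using xy C by (simp add: pos_less_divide_eq mult.commute)
    finally show "(\<Sum>i<n. norm (u (y i) - u (x i))) < e" .
  qed
qed

theorem theorem3p1:
  fixes E :: "'n::finite set set" and w :: "'n set \<Rightarrow> real"
    and p a q T :: real
    and \<pi> :: "real ^ 'n \<Rightarrow> real ^ 'n" and k :: "real ^ 'n \<Rightarrow> real"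
    and u\<^sub>0 :: "real ^ 'n" and f :: "real \<Rightarrow> real ^ 'n"
  assumes "weighted_hypergraph E w" and "hypergraph_connected E"
    and "p \<ge> 1" and "a > 0" and "q > 2" and "T > 0"
    and "\<exists>L. L-lipschitz_on UNIV \<pi>"
    and "\<forall>x. GDERIV k x :> \<pi> x"
    and "f \<in> W_one_one T"
  shows "\<exists>u \<mu>. is_solution E w p a q \<pi> T f u\<^sub>0 u \<mu> \<and> u \<in> W_one_infty T \<and> \<mu> \<in> L_infty T"
proof -
  obtain L where L: "L-lipschitz_on UNIV \<pi>" using assms(7) by blast
  have k: "\<And>x. GDERIV k x :> \<pi> x" using assms(8) by blast
  obtain f' where "has_weak_derivative f f' T" using assms(9) by (auto simp: W_one_one_def)
  then obtain F N\<^sub>f where F: "negligible N\<^sub>f" "\<And>t. t \<notin> N\<^sub>f \<Longrightarrow> 0 < t \<Longrightarrow> t < T \<Longrightarrow> f t = F t"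
    "\<And>s t. 0 \<le> s \<Longrightarrow> s \<le> t \<Longrightarrow> t \<le> T \<Longrightarrow> F t - F s = integral {s..t} f'"
    and f': "f' absolutely_integrable_on {0..T}"
    by (rule weak_derivative_representation[OF _ \<open>T > 0\<close>]) blast
  define g where "g = (\<lambda>x. a *\<^sub>R (norm x powr (q - 2) *\<^sub>R x) + \<pi> x)"
  define K where "K = (\<lambda>x. a / q * norm x powr q + k x)"
  define G where "G = (\<lambda>t. integral {0..t} (\<lambda>r. norm (f' r)))"
  have int: "f' integrable_on {0..T}" "(\<lambda>r. norm (f' r)) integrable_on {0..T}"
    using f' by (auto simp: absolutely_integrable_on_def)
  \<comment> \<open>The system is solved for the continuous representative \<open>F\<close> of \<open>f\<close>.\<close>
  interpret convex_potential "hypergraph_energy E w p"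
    by (rule hypergraph_energy_potential) (use assms in auto)
  interpret gradient_system "hypergraph_energy E w p" g K F G T u\<^sub>0
  proof
    have "continuous_on UNIV \<pi>" by (rule lipschitz_on_continuous_on[OF L])
    moreover have "continuous_on UNIV (\<lambda>x::real^'n. norm x powr (q - 2))"
      by (rule continuous_on_powr'[OF continuous_on_norm[OF continuous_on_id] continuous_on_const])
        (use \<open>q > 2\<close> in auto)
    ultimately show "continuous_on UNIV g"
      unfolding g_def by (intro continuous_on_add continuous_on_scaleR continuous_on_const continuous_on_id)
    show "GDERIV K x :> g x" for x
    proof -
      have "GDERIV (\<lambda>x. a / q * norm x powr q) x :> (a / q) *\<^sub>R (q *\<^sub>R (norm x powr (q - 2) *\<^sub>R x)) + (norm x powr q) *\<^sub>R 0"
        by (rule GDERIV_mult[OF GDERIV_const gderiv_norm_powr[OF \<open>q > 2\<close>]])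
      then have "GDERIV (\<lambda>x. a / q * norm x powr q) x :> a *\<^sub>R (norm x powr (q - 2) *\<^sub>R x)"
        using \<open>q > 2\<close> by simp
      then show ?thesis unfolding K_def g_def by (rule GDERIV_add[OF _ k])
    qed
    show "\<exists>D. \<forall>x. c * norm x - D \<le> K x" for c
      unfolding K_def by (rule powr_primitive_superlinear[OF k L \<open>a > 0\<close> \<open>q > 2\<close>])
    show "0 < T" by fact
    have "continuous_on {0..T} (\<lambda>t. F 0 + integral {0..t} f')"
      by (intro continuous_intros indefinite_integral_continuous_1 int)
    then show "continuous_on {0..T} F"
      by (rule continuous_on_eq) (simp add: F(3)[of 0, symmetric])
    show "norm (F t - F s) \<le> G t - G s" if st: "0 \<le> s" "s \<le> t" "t \<le> T" for s t
    proof -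
      have sub: "f' integrable_on {s..t}" "(\<lambda>r. norm (f' r)) integrable_on {s..t}"
          "(\<lambda>r. norm (f' r)) integrable_on {0..t}"
        using st by (auto intro: integrable_on_subinterval[OF int(1)] integrable_on_subinterval[OF int(2)])
      have "norm (F t - F s) \<le> integral {s..t} (\<lambda>r. norm (f' r))"
        unfolding F(3)[OF st] by (intro integral_norm_bound_integral sub) auto
      also have "\<dots> = G t - G s"
        using Henstock_Kurzweil_Integration.integral_combine[OF st(1,2) sub(3)] by (simp add: G_def)
      finally show ?thesis .
    qed
  qed
  obtain C u v \<mu> N where u: "C-lipschitz_on {0..T} u" "u 0 = u\<^sub>0"
    and v: "v \<in> borel_measurable borel" "\<And>t. norm (v t) \<le> C"
    and \<mu>: "\<mu> \<in> borel_measurable borel" "\<And>t. norm (\<mu> t) \<le> C" and N: "negligible N"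
    and deriv: "\<And>t. t \<notin> N \<Longrightarrow> 0 \<le> t \<Longrightarrow> t < T \<Longrightarrow> ((\<lambda>h. (u (t + h) - u t) /\<^sub>R h) \<longlongrightarrow> v t) (at_right 0)"
    and incl: "\<And>t. t \<notin> N \<Longrightarrow> 0 \<le> t \<Longrightarrow> t < T \<Longrightarrow> - v t \<in> subdifferential (hypergraph_energy E w p) (\<mu> t)"
      "\<And>t. t \<notin> N \<Longrightarrow> 0 \<le> t \<Longrightarrow> t < T \<Longrightarrow>
        \<mu> t - (g (u t) - F t) \<in> subdifferential (hypergraph_energy E w p) (u t)"
    by (rule solution_exists) blast
  note weak = lipschitz_has_weak_derivative[OF u(1) \<open>T > 0\<close> v N deriv]
  note \<mu>_L = bounded_measurable_L_infty[OF borel_measurable_lebesgue_on[OF \<mu>(1)] \<mu>(2), of T]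
  have AE: "AE t in lebesgue_on {0<..<T}. t \<notin> N \<union> N\<^sub>f \<and> 0 < t \<and> t < T"
  proof -
    have "N \<union> N\<^sub>f \<in> null_sets lebesgue" using N F(1) negligible_iff_null_sets negligible_Un by blast
    then show ?thesis by (subst AE_restrict_space_iff) (auto elim!: eventually_mono dest: AE_not_in)
  qed
  have "is_solution E w p a q \<pi> T f u\<^sub>0 u \<mu>"
    unfolding is_solution_def hypergraph_laplacian_def
  proof (intro conjI exI[of _ v])
    show "u \<in> W_one_one T" using weak(1) by (auto simp: W_one_one_def)
    show "abs_continuous_on 0 T u" by (rule lipschitz_abs_continuous_on[OF u(1)])
    show "AE t in lebesgue_on {0<..<T}.
        0 \<in> {v t + \<eta> | \<eta>. \<eta> \<in> subdifferential (hypergraph_energy E w p) (\<mu> t)}"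
      using AE by (rule eventually_mono) (auto intro!: exI[of _ "- v _"] incl(1))
    show "AE t in lebesgue_on {0<..<T}. \<mu> t \<in> {\<eta> + a *\<^sub>R (norm (u t) powr (q - 2) *\<^sub>R u t) + \<pi> (u t) - f t | \<eta>.
        \<eta> \<in> subdifferential (hypergraph_energy E w p) (u t)}"
      using AE
    proof (rule eventually_mono)
      fix t assume t: "t \<notin> N \<union> N\<^sub>f \<and> 0 < t \<and> t < T"
      show "\<mu> t \<in> {\<eta> + a *\<^sub>R (norm (u t) powr (q - 2) *\<^sub>R u t) + \<pi> (u t) - f t | \<eta>.
          \<eta> \<in> subdifferential (hypergraph_energy E w p) (u t)}"
        using incl(2)[of t] t F(2)[of t]
        by (intro CollectI exI[of _ "\<mu> t - (g (u t) - F t)"]) (auto simp: g_def)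
    qed
  qed (use weak(1) \<mu>_L(2) u(2) in auto)
  moreover have "u \<in> W_one_infty T" using weak by (auto simp: W_one_infty_def)
  ultimately show ?thesis using \<mu>_L(1) by blast
qed

end
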